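(* Let $n\ge1$, $1\le k\le n+1$, $\mathrm{IG}=\mathrm{IG}(k,2n+1)$, $\deg q=2n+2-k$, and let $w\in W^P\cap W^{odd}$. Then $$\dim\Gamma_1(X(w))-\dim X(w)\le\deg q-1,$$ $$\dim\Gamma_d(X(w))-\dim X(w)<d\deg q-1\quad\text{for all } d\ge2.$$ Further, if the Schubert variety $X(w)$ is not contained in the closed orbit $X_c$ of $\mathrm{IG}$, then $$\dim\Gamma_1(X(w))-\dim X(w)<\deg q-1.$$
   Context: Let $\mathbf e_1,\dots,\mathbf e_{2n+2}$ be the standard basis of $\mathbb C^{2n+2}$, $\bar i=2n+3-i$, and let $\tilde\omega$ be the symplectic form with $\tilde\omega(\mathbf e_i,\mathbf e_j)=\delta_{i,\bar j}$ for $i\le j$. Let $\omega$ be its restriction to $E=\mathbb C^{2n+1}=\langle\mathbf e_1,\dots,\mathbf e_{2n+1}\rangle$ (its kernel is spanned by $\mathbf e_1$). $\mathrm{IG}(k,2n+1)$ is the smooth projective variety of $k$-dimensional $\omega$-isotropic subspaces of $E$. $\mathrm{Sp}_{2n+1}\subset GL(E)$ is the group preserving $\omega$ and $B$ its subgroup of upper triangular matrices. The closed $\mathrm{Sp}_{2n+1}$-orbit is $X_c=\{V\in\mathrm{IG}:\mathbf e_1\in V\}$. $W$ is the group of signed permutations, i.e. permutations $w$ of $\{1<\dots<n+1<\overline{n+1}<\dots<\bar1\}=\{1,\dots,2n+2\}$ with $w(\bar i)=\overline{w(i)}$, with simple reflections $s_i$ ($1\le i\le n$) exchanging $i,i+1$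 and $s_{n+1}$ exchanging $n+1,\overline{n+1}$. $W_P=\langle s_i:i\ne k\rangle$, and $W^P$ is the set of minimal length representatives of $W/W_P$, identified with sequences $w(1)<\dots<w(k)$ (the remaining values satisfy $w(k+1)<\dots<w(n+1)\le n+1$). $W^{odd}=\{w\in W:w(j)\ne\bar1\text{ for }1\le j\le n+1\}$. For $w\in W^P\cap W^{odd}$, $X(w)\subset\mathrm{IG}$ is the closure of the $B$-orbit of $\langle\mathbf e_{w(1)},\dots,\mathbf e_{w(k)}\rangle$. $H_2(\mathrm{IG})\cong\mathbb Z$ (generated by the Schubert line), and degrees are non-negative integers. For a degree $d$ and a closed subvariety $\Omega\subset\mathrm{IG}$, the curve neighborhood is $\Gamma_d(\Omega)=\mathrm{ev}_2(\mathrm{ev}_1^{-1}(\Omega))$ with reduced structure, where $\mathrm{ev}_1,\mathrm{ev}_2:\overline{\mathcal M}_{0,2}(\mathrm{IG},d)\to\mathrm{IG}$ are the evaluation maps on the Kontsevich moduli space of stable maps. *)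

theory Defs
  imports
    "HOL-Analysis.Analysis"
    "HOL-Library.Function_Algebras"
    "HOL-Combinatorics.Combinatorics"
    "Jordan_Normal_Form.Determinant"
begin

section \<open>Linear algebra\<close>

text \<open>Vectors are functions with coordinates indexed from 1; \<open>\<complex>\<^sup>m\<close> consists of the functions
  supported in \<open>{1..m}\<close>, so that \<open>E = \<complex>\<^sup>2\<^sup>n\<^sup>+\<^sup>1\<close> is literally contained in \<open>\<complex>\<^sup>2\<^sup>n\<^sup>+\<^sup>2\<close>.\<close>

type_synonym cvec = "nat \<Rightarrow> complex"

definition cscale :: "complex \<Rightarrow> cvec \<Rightarrow> cvec" where
  "cscale c v = (\<lambda>i. c * v i)"

global_interpretation cvec: vector_space cscale
  by unfold_locales (auto simp: cscale_def algebra_simps fun_eq_iff)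

definition unit_v :: "nat \<Rightarrow> cvec" where
  "unit_v j = (\<lambda>i. if i = j then 1 else 0)"

definition bar :: "nat \<Rightarrow> nat \<Rightarrow> nat" where
  "bar n i = 2 * n + 3 - i"

definition omega :: "nat \<Rightarrow> cvec \<Rightarrow> cvec \<Rightarrow> complex" where
  "omega n u v = (\<Sum>i = 1..n + 1. u i * v (bar n i) - u (bar n i) * v i)"

lemma omega_skew: "omega n v u = - omega n u v"
  by (simp add: omega_def sum_subtractf algebra_simps)

lemma omega_unit_v:
  assumes "1 \<le> i" "i \<le> j" "j \<le> 2 * n + 2"
  shows "omega n (unit_v i) (unit_v j) = (if i = bar n j then 1 else 0)"
proof -
  have "unit_v i l * unit_v j (bar n l) - unit_v i (bar n l) * unit_v j l =
      (if l = i then (if i = bar n j then 1 else 0) else 0)" if "l \<in> {1..n + 1}" for l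
    using that assms by (auto simp: unit_v_def bar_def)
  then have "omega n (unit_v i) (unit_v j) =
      (\<Sum>l = 1..n + 1. if l = i then (if i = bar n j then 1 else 0) else 0)"
    unfolding omega_def by (intro sum.cong) auto
  also have "\<dots> = (if i = bar n j then 1 else 0)"
    using assms by (auto simp: bar_def)
  finally show ?thesis .
qed

definition E :: "nat \<Rightarrow> cvec set" where
  "E n = {v. \<forall>i. i \<notin> {1..2 * n + 1} \<longrightarrow> v i = 0}"

definition IG :: "nat \<Rightarrow> nat \<Rightarrow> cvec set set" where
  "IG n k = {V. cvec.subspace V \<and> V \<subseteq> E n \<and> cvec.dim V = k \<and> (\<forall>u\<in>V. \<forall>v\<in>V. omega n u v = 0)}"

definition closed_orbit :: "nat \<Rightarrow> nat \<Rightarrow> cvec set set" where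
  "closed_orbit n k = {V \<in> IG n k. unit_v 1 \<in> V}"

text \<open>Elements of \<open>GL(E)\<close> are given by linear maps on all of \<^typ>\<open>cvec\<close> that restrict to
  automorphisms of \<open>E\<close>; only their action on \<open>E\<close> matters.\<close>

definition Sp_odd :: "nat \<Rightarrow> (cvec \<Rightarrow> cvec) set" where
  "Sp_odd n = {g. Vector_Spaces.linear cscale cscale g \<and> bij_betw g (E n) (E n) \<and>
     (\<forall>u\<in>E n. \<forall>v\<in>E n. omega n (g u) (g v) = omega n u v)}"

definition Borel :: "nat \<Rightarrow> (cvec \<Rightarrow> cvec) set" where
  "Borel n = {g \<in> Sp_odd n. \<forall>i\<in>{1..2 * n + 1}. \<forall>j\<in>{1..2 * n + 1}. j < i \<longrightarrow> g (unit_v j) i = 0}"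


section \<open>Projective geometry of \<open>IG\<close>\<close>

text \<open>The homogeneous coordinate vectors of the image of \<open>V\<close> under the Pluecker embedding of
  \<open>Gr(k, E)\<close>, one for each ordered basis of \<open>V\<close>. They are indexed by the \<open>k\<close>-element subsets of
  \<open>{1..2n+1}\<close>. For \<open>dim V = k\<close> this set is the whole punctured line over the Pluecker point.\<close>

definition minor :: "nat \<Rightarrow> nat \<Rightarrow> (nat \<Rightarrow> cvec) \<Rightarrow> nat set \<Rightarrow> complex" where
  "minor n k b I = (if I \<subseteq> {1..2 * n + 1} \<and> card I = k
     then det (mat k k (\<lambda>(r, c). b r (sorted_list_of_set I ! c))) else 0)"

definition plucker_coords :: "nat \<Rightarrow> nat \<Rightarrow> cvec set \<Rightarrow> (nat set \<Rightarrow> complex) set" where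
  "plucker_coords n k V = {minor n k b | b. cvec.span (b ` {..<k}) = V}"

inductive hom_poly :: "nat \<Rightarrow> (('i \<Rightarrow> complex) \<Rightarrow> complex) \<Rightarrow> bool" where
  const: "hom_poly 0 (\<lambda>x. c)"
| coord: "hom_poly 1 (\<lambda>x. x i)"
| add: "hom_poly d p \<Longrightarrow> hom_poly d q \<Longrightarrow> hom_poly d (\<lambda>x. p x + q x)"
| mult: "hom_poly d p \<Longrightarrow> hom_poly d' q \<Longrightarrow> hom_poly (d + d') (\<lambda>x. p x * q x)"

text \<open>The Zariski topology, generated by the complements of hypersurfaces in the Pluecker
  embedding. For \<open>V \<in> IG n k\<close>, the vectors in \<^term>\<open>plucker_coords n k V\<close> are proportional,
  so the choice of \<open>x\<close> does not matter.\<close>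

definition zariski :: "nat \<Rightarrow> nat \<Rightarrow> cvec set topology" where
  "zariski n k = topology_generated_by
     {{V \<in> IG n k. \<exists>x\<in>plucker_coords n k V. F x \<noteq> 0} | F d. hom_poly d F}"

definition irreducible_closed :: "'a topology \<Rightarrow> 'a set \<Rightarrow> bool" where
  "irreducible_closed X Z \<longleftrightarrow> closedin X Z \<and> Z \<noteq> {} \<and>
     (\<forall>A B. closedin X A \<and> closedin X B \<and> Z \<subseteq> A \<union> B \<longrightarrow> Z \<subseteq> A \<or> Z \<subseteq> B)"

text \<open>Krull dimension. The supremum is taken in \<^typ>\<open>nat\<close>; it is meaningful for non-empty subsets
  of a projective variety, where the lengths of chains are bounded.\<close>

definition krull_dim :: "'a topology \<Rightarrow> nat" where
  "krull_dim X = Sup {m. \<exists>Z. (\<forall>i\<le>m. irreducible_closed X (Z i)) \<and> (\<forall>i<m. Z i \<subset> Z (Suc i))}"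

definition dim_IG :: "nat \<Rightarrow> nat \<Rightarrow> cvec set set \<Rightarrow> nat" where
  "dim_IG n k S = krull_dim (subtopology (zariski n k) S)"


section \<open>Schubert varieties\<close>

definition signed_perms :: "nat \<Rightarrow> (nat \<Rightarrow> nat) set" where
  "signed_perms n = {w. w permutes {1..2 * n + 2} \<and> (\<forall>i\<in>{1..2 * n + 2}. w (bar n i) = bar n (w i))}"

definition simple_refl :: "nat \<Rightarrow> nat \<Rightarrow> nat \<Rightarrow> nat" where
  "simple_refl n i = (if i \<le> n
     then Transposition.transpose i (i + 1) \<circ> Transposition.transpose (bar n i) (bar n (i + 1))
     else Transposition.transpose (n + 1) (bar n (n + 1)))"

definition refl_word :: "nat \<Rightarrow> nat list \<Rightarrow> nat \<Rightarrow> nat" where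
  "refl_word n is = foldr (\<lambda>i w. simple_refl n i \<circ> w) is id"

definition weyl_length :: "nat \<Rightarrow> (nat \<Rightarrow> nat) \<Rightarrow> nat" where
  "weyl_length n w = (LEAST l. \<exists>is. set is \<subseteq> {1..n + 1} \<and> length is = l \<and> refl_word n is = w)"

definition parabolic :: "nat \<Rightarrow> nat \<Rightarrow> (nat \<Rightarrow> nat) set" where
  "parabolic n k = {refl_word n is | is. set is \<subseteq> {1..n + 1} - {k}}"

definition min_reps :: "nat \<Rightarrow> nat \<Rightarrow> (nat \<Rightarrow> nat) set" where
  "min_reps n k = {w \<in> signed_perms n.
     \<forall>u\<in>parabolic n k. weyl_length n w \<le> weyl_length n (w \<circ> u)}"

definition W_odd :: "nat \<Rightarrow> (nat \<Rightarrow> nat) set" where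
  "W_odd n = {w \<in> signed_perms n. \<forall>j\<in>{1..n + 1}. w j \<noteq> bar n 1}"

definition schubert :: "nat \<Rightarrow> nat \<Rightarrow> (nat \<Rightarrow> nat) \<Rightarrow> cvec set set" where
  "schubert n k w = zariski n k closure_of
     {g ` cvec.span ((\<lambda>j. unit_v (w j)) ` {1..k}) | g. g \<in> Borel n}"


section \<open>Stable maps and curve neighborhoods\<close>

text \<open>\<open>\<P>\<^sup>1\<close> as \<open>\<complex> \<union> {\<infinity>}\<close>, where \<^term>\<open>Some z\<close> is the point \<open>[z : 1]\<close> and
  \<^term>\<open>None\<close> is \<open>[1 : 0]\<close>. A binary form \<open>\<Sum>i\<le>d. a\<^sub>i x\<^sup>i y\<^sup>d\<^sup>-\<^sup>i\<close> of degree \<open>d\<close> is represented by the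
  polynomial \<open>\<Sum>i\<le>d. a\<^sub>i x\<^sup>i\<close>.\<close>

type_synonym P1 = "complex option"

definition form_at :: "nat \<Rightarrow> complex poly \<Rightarrow> P1 \<Rightarrow> complex" where
  "form_at d p x = (case x of Some z \<Rightarrow> poly p z | None \<Rightarrow> coeff p d)"

text \<open>Morphisms \<open>\<P>\<^sup>1 \<rightarrow> IG\<close> of degree \<open>d\<close>: they are given by forms of degree \<open>d\<close> without a common
  zero (Pluecker vectors are non-zero). The degree is that of the pullback of \<open>\<O>(1)\<close>;
  this is the degree in \<open>H\<^sub>2(IG) \<cong> \<int>\<close>, since the generating Schubert line is a line
  in the Pluecker embedding (see \<open>schubert_line_degree_1\<close> below).\<close>

definition P1_maps :: "nat \<Rightarrow> nat \<Rightarrow> nat \<Rightarrow> (P1 \<Rightarrow> cvec set) set" where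
  "P1_maps n k d = {f. (\<forall>x. f x \<in> IG n k) \<and>
     (\<exists>F :: nat set \<Rightarrow> complex poly. (\<forall>I. degree (F I) \<le> d) \<and>
        (\<forall>x. (\<lambda>I. form_at d (F I) x) \<in> plucker_coords n k (f x)))}"

text \<open>The one-dimensional Schubert variety is the line of all \<open>V\<close> with \<open>A \<subseteq> V \<subseteq> A + \<langle>e\<^sub>k, e\<^sub>j\<rangle>\<close>,
  where \<open>A = \<langle>e\<^sub>1, \<dots>, e\<^bsub>k-1\<^esub>\<rangle>\<close> and \<open>j\<close> is \<open>k + 1\<close> for \<open>k \<le> n\<close> and \<open>n + 2\<close> for \<open>k = n + 1\<close>.\<close>

definition line_basis :: "nat \<Rightarrow> nat \<Rightarrow> P1 \<Rightarrow> nat \<Rightarrow> cvec" where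
  "line_basis n k x r = (if r + 1 < k then unit_v (r + 1) else
     case x of Some z \<Rightarrow> cscale z (unit_v k) + unit_v (if k \<le> n then k + 1 else n + 2)
             | None \<Rightarrow> unit_v k)"

definition schubert_line :: "nat \<Rightarrow> nat \<Rightarrow> P1 \<Rightarrow> cvec set" where
  "schubert_line n k x = cvec.span (line_basis n k x ` {..<k})"

lemma dim_span_echelon:
  assumes "\<And>m. m < k \<Longrightarrow> \<exists>i. b m i \<noteq> 0 \<and> (\<forall>r<m. b r i = 0)"
  shows "cvec.dim (cvec.span (b ` {..<k})) = k"
proof -
  have *: "cvec.independent (b ` {..<m}) \<and> card (b ` {..<m}) = m" if "m \<le> k" for m
    using that
  proof (induction m)
    case 0
    then show ?case by (simp add: cvec.independent_empty)
  next
    case (Suc m)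
    obtain i where i: "b m i \<noteq> 0" "\<forall>r<m. b r i = 0"
      using assms[of m] Suc.prems by auto
    have "cvec.subspace {v. v i = 0}"
      by (auto simp: cvec.subspace_def cscale_def)
    then have "cvec.span (b ` {..<m}) \<subseteq> {v. v i = 0}"
      using i(2) by (intro cvec.span_minimal) auto
    then have "b m \<notin> cvec.span (b ` {..<m})"
      using i(1) by auto
    moreover from this have "b m \<notin> b ` {..<m}"
      by (rule contrapos_nn) (rule cvec.span_base)
    ultimately show ?case
      using Suc.IH Suc.prems by (simp add: lessThan_Suc cvec.independent_insert)
  qed
  show ?thesis
    using *[of k] by (simp add: cvec.dim_eq_card_independent)
qed

lemma minor_line:
  assumes "1 \<le> k" "k < j" "j \<le> 2 * n + 1"
    and b: "\<And>r. b r = (if r + 1 < k then unit_v (r + 1) else cscale c (unit_v k) + cscale c' (unit_v j))"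
  shows "minor n k b I = (if I = {1..k} then c else if I = insert j {1..<k} then c' else 0)"
proof (cases "I \<subseteq> {1..2 * n + 1} \<and> card I = k")
  case False
  have "card (insert j {1..<k}) = k" using assms by simp
  then show ?thesis using False assms by (auto simp: minor_def)
next
  case I: True
  then have fin: "finite I" by (meson finite_atLeastAtMost finite_subset)
  define A where "A = mat k k (\<lambda>(r, c). b r (sorted_list_of_set I ! c))"
  have A: "A \<in> carrier_mat k k" by (simp add: A_def)
  have mA: "minor n k b I = det A" using I by (simp add: minor_def A_def)
  have len: "length (sorted_list_of_set I) = k" using I by simp
  have set: "set (sorted_list_of_set I) = I" using fin by simp
  have diag: "minor n k b I = b (k - 1) m"
    if m: "sorted_list_of_set I = [1..<k] @ [m]" and "m \<ge> k" for m
  proof -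
    have "upper_triangular A"
      using len m that assms(1,2) b by (auto simp: A_def upper_triangular_def unit_v_def cscale_def nth_append)
    then have "det A = prod_list (diag_mat A)" by (rule det_upper_triangular[OF _ A])
    also have "\<dots> = (\<Prod>r<k. b r (sorted_list_of_set I ! r))"
      by (auto simp: prod_list_diag_prod A_def lessThan_atLeast0 intro!: prod.cong)
    also have "\<dots> = (\<Prod>r<Suc (k - 1). b r (sorted_list_of_set I ! r))"
      using assms(1) by simp
    also have "\<dots> = b (k - 1) m"
    proof -
      have "(\<Prod>r<k - 1. b r (sorted_list_of_set I ! r)) = 1"
        using assms(1) b by (intro prod.neutral) (auto simp: m nth_append unit_v_def)
      moreover have "sorted_list_of_set I ! (k - 1) = m"
        by (simp add: m nth_append)
      ultimately show ?thesis by (simp only: prod.lessThan_Suc mult_1)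
    qed
    finally show ?thesis using mA by simp
  qed
  have sl: "sorted_list_of_set (insert m {1..<k}) = [1..<k] @ [m]" if "m \<ge> k" for m
  proof -
    have "sorted ([1..<k] @ [m])" "distinct ([1..<k] @ [m])" "set ([1..<k] @ [m]) = insert m {1..<k}"
      using that by (auto simp: sorted_append)
    then show ?thesis by (metis sorted_list_of_set.idem_if_sorted_distinct)
  qed
  have ins: "{1..k} = insert k {1..<k}" using assms(1) by auto
  consider "I = {1..k}" | "I = insert j {1..<k}"
    | (zero_col) m where "m \<in> I" "m \<notin> {1..k}" "m \<noteq> j"
    | (zero_row) "I \<subseteq> insert j {1..k}" "I \<noteq> {1..k}" "I \<noteq> insert j {1..<k}"
  proof (cases "I \<subseteq> insert j {1..k}")
    case True
    then show ?thesis using that by (cases "I = {1..k} \<or> I = insert j {1..<k}") auto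
  next
    case False
    then obtain m where "m \<in> I" "m \<notin> insert j {1..k}" by blast
    then show ?thesis using that(3)[of m] by simp
  qed
  then show ?thesis
  proof cases
    case 1
    then have "sorted_list_of_set I = [1..<k] @ [k]"
      using sl[of k] by (simp only: ins order_refl)
    then have "minor n k b I = b (k - 1) k" by (intro diag) simp_all
    then show ?thesis using 1 assms(1,2) b by (simp add: cscale_def unit_v_def)
  next
    case 2
    then have "sorted_list_of_set I = [1..<k] @ [j]"
      using sl[of j] assms(2) by simp
    then have "minor n k b I = b (k - 1) j" using assms(2) by (intro diag) simp_all
    moreover have "j \<in> I" using 2 by simp
    then have "I \<noteq> {1..k}" using assms(2) by auto
    ultimately show ?thesis using 2 assms(1,2) b by (simp add: cscale_def unit_v_def)
  next
    case (zero_col m)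
    then obtain q where q: "q < k" "sorted_list_of_set I ! q = m"
      using set len by (metis in_set_conv_nth)
    have "m \<noteq> 0" using zero_col(1) I by auto
    then have "b r m = 0" if "r < k" for r
      using zero_col that b by (auto simp: cscale_def unit_v_def)
    then have "\<exists>r<k. A $$ (r, p r) = 0" if p: "p permutes {0..<k}" for p
    proof -
      obtain r where r: "p r = q" using permutes_surj[OF p] by (metis surj_def)
      then have "r < k" using q(1) permutes_in_image[OF p, of r] by simp
      then show ?thesis using q r \<open>\<And>r. r < k \<Longrightarrow> b r m = 0\<close>
        by (intro exI[of _ r]) (simp add: A_def)
    qed
    then have "det A = 0"
      unfolding det_def'[OF A] by (intro sum.neutral) (auto simp: prod_zero_iff Bex_def)
    moreover have "I \<noteq> {1..k}" "I \<noteq> insert j {1..<k}" using zero_col by auto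
    ultimately show ?thesis using mA by simp
  next
    case zero_row
    have "\<exists>m\<in>{1..<k}. m \<notin> I"
    proof (rule ccontr)
      assume "\<not> ?thesis"
      then have sub: "{1..<k} \<subseteq> I" by auto
      have "card (I - {1..<k}) = card I - card {1..<k}"
        by (rule card_Diff_subset[OF _ sub]) simp
      also have "\<dots> = 1"
        using I assms(1) by simp
      finally have "card (I - {1..<k}) = 1" .
      then obtain m where m: "I - {1..<k} = {m}" by (auto simp: card_1_singleton_iff)
      then have "I = insert m {1..<k}" using sub by auto
      moreover have "m \<in> insert j {1..k}" "m \<notin> {1..<k}" using m zero_row(1) by blast+
      then have "m = k \<or> m = j" by auto
      ultimately show False using zero_row ins by auto
    qed
    then obtain m where m: "m \<in> {1..<k}" "m \<notin> I" by blast
    have "sorted_list_of_set I ! q \<noteq> m" if "q < k" for q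
      using m(2) set len that nth_mem by metis
    then have "A $$ (m - 1, q) = 0" if "q < k" for q
      using m(1) b that by (auto simp: A_def unit_v_def)
    then have "\<exists>r<k. A $$ (r, p r) = 0" if "p permutes {0..<k}" for p
      using m(1) permutes_in_image[OF that, of "m - 1"] by (intro exI[of _ "m - 1"]) auto
    then have "det A = 0"
      unfolding det_def'[OF A] by (intro sum.neutral) (auto simp: prod_zero_iff Bex_def)
    then show ?thesis using mA zero_row by simp
  qed
qed

lemma schubert_line_degree_1:
  assumes "1 \<le> n" "1 \<le> k" "k \<le> n + 1"
  shows "schubert_line n k \<in> P1_maps n k 1"
proof -
  define j where "j = (if k \<le> n then k + 1 else n + 2)"
  have j: "k < j" "j \<le> 2 * n + 1" using assms by (auto simp: j_def)
  define c where "c x = (case x of Some z \<Rightarrow> z | None \<Rightarrow> 1)" for x :: P1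
  define c' :: "P1 \<Rightarrow> complex" where "c' x = (case x of Some z \<Rightarrow> 1 | None \<Rightarrow> 0)" for x
  have b: "line_basis n k x r = (if r + 1 < k then unit_v (r + 1)
      else cscale (c x) (unit_v k) + cscale (c' x) (unit_v j))" for x r
    by (auto simp: line_basis_def c_def c'_def j_def cscale_def split: option.splits)
  have nz: "c x \<noteq> 0 \<or> c' x \<noteq> 0" for x by (auto simp: c_def c'_def split: option.splits)
  have bz: "line_basis n k x r i = 0" if "r < k" "i \<notin> {1..k}" "i \<noteq> j" for x r i
    using that by (auto simp: b cscale_def unit_v_def)
  have "schubert_line n k x \<in> IG n k" for x
  proof -
    let ?B = "line_basis n k x ` {..<k}"
    have "cvec.subspace (E n)" by (auto simp: cvec.subspace_def E_def cscale_def)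
    moreover have "?B \<subseteq> E n" using j by (auto simp: E_def intro!: bz)
    ultimately have 1: "cvec.span ?B \<subseteq> E n" by (intro cvec.span_minimal)
    have 2: "cvec.dim (cvec.span ?B) = k"
    proof (rule dim_span_echelon)
      fix m assume m: "m < k"
      show "\<exists>i. line_basis n k x m i \<noteq> 0 \<and> (\<forall>r<m. line_basis n k x r i = 0)"
      proof (cases "m + 1 < k")
        case True
        then show ?thesis by (intro exI[of _ "m + 1"]) (auto simp: b unit_v_def)
      next
        case False
        then show ?thesis using m j nz[of x]
          by (intro exI[of _ "if c x \<noteq> 0 then k else j"]) (auto simp: b unit_v_def cscale_def)
      qed
    qed
    have iso: "omega n (line_basis n k x r) (line_basis n k x s) = 0" if "r < k" "s < k" for r s
    proof -
      have "line_basis n k x r l * line_basis n k x s (bar n l) -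
          line_basis n k x r (bar n l) * line_basis n k x s l = 0" if l: "l \<in> {1..n + 1}" for l
      proof (cases "k = n + 1 \<and> l = n + 1")
        case True
        have *: "line_basis n k x r i = 0" if "r + 1 < k" "i \<ge> k" for r i
          using that by (simp add: b unit_v_def)
        have "r = s \<or> r + 1 < k \<or> s + 1 < k" using \<open>r < k\<close> \<open>s < k\<close> by linarith
        moreover have "l \<ge> k" "bar n l \<ge> k" using True by (auto simp: bar_def)
        ultimately show ?thesis using * by auto
      next
        case False
        then have "bar n l \<notin> {1..k}" "bar n l \<noteq> j"
          using l assms by (auto simp: bar_def j_def)
        then show ?thesis using bz \<open>r < k\<close> \<open>s < k\<close> by simp
      qed
      then show ?thesis by (simp add: omega_def)
    qed
    have sub: "cvec.subspace {u. omega n u v = 0}" "cvec.subspace {u. omega n v u = 0}" for v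
    proof -
      have 1: "omega n v (a + a') = omega n v a + omega n v a'" for a a'
        by (simp add: omega_def algebra_simps sum.distrib sum_subtractf)
      have 2: "omega n v (cscale t a) = t * omega n v a" for t a
        unfolding omega_def cscale_def sum_distrib_left
        by (intro sum.cong) (auto simp: algebra_simps)
      have 3: "omega n v 0 = 0" by (simp add: omega_def)
      show "cvec.subspace {u. omega n v u = 0}"
        using 1 2 3 by (auto simp: cvec.subspace_def)
      then show "cvec.subspace {u. omega n u v = 0}"
        by (simp add: omega_skew[of n v])
    qed
    have "?B \<subseteq> {u. omega n v u = 0}" if "v \<in> ?B" for v using that iso by auto
    then have "cvec.span ?B \<subseteq> {u. omega n v u = 0}" if "v \<in> ?B" for v
      using that by (intro cvec.span_minimal sub) auto
    then have "?B \<subseteq> {u. omega n u v = 0}" if "v \<in> cvec.span ?B" for v using that by blast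
    then have "cvec.span ?B \<subseteq> {u. omega n u v = 0}" if "v \<in> cvec.span ?B" for v
      using that by (intro cvec.span_minimal sub) auto
    then show ?thesis using 1 2 by (auto simp: IG_def schubert_line_def cvec.subspace_span)
  qed
  moreover define F :: "nat set \<Rightarrow> complex poly" where
    "F I = (if I = {1..k} then [:0, 1:] else if I = insert j {1..<k} then 1 else 0)" for I
  have "degree (F I) \<le> 1" for I by (simp add: F_def)
  moreover have "minor n k (line_basis n k x) = (\<lambda>I. form_at 1 (F I) x)" for x
  proof
    fix I
    show "minor n k (line_basis n k x) I = form_at 1 (F I) x"
      unfolding minor_line[OF assms(2) j b]
      by (auto simp: F_def form_at_def c_def c'_def split: option.splits)
  qed
  then have "(\<lambda>I. form_at 1 (F I) x) \<in> plucker_coords n k (schubert_line n k x)" for x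
    unfolding plucker_coords_def schubert_line_def by (metis (mono_tags, lifting) mem_Collect_eq)
  ultimately show ?thesis unfolding P1_maps_def by blast
qed

text \<open>A two-pointed map from a nodal curve of genus 0. The irreducible components of the curve
  are copies of \<open>\<P>\<^sup>1\<close> numbered by \<open>{..<comps}\<close>; the pair \<open>(a, x)\<close> is the point \<open>x\<close> on component \<open>a\<close>.
  The curve arises from the disjoint union of the components by identifying, for each node,
  the two points of which the node consists.\<close>

type_synonym curve_point = "nat \<times> P1"

record pointed_map =
  comps :: nat
  nodes :: "curve_point set set"
  comp_map :: "nat \<Rightarrow> P1 \<Rightarrow> cvec set"
  comp_deg :: "nat \<Rightarrow> nat"
  mark1 :: curve_point
  mark2 :: curve_point

definition points :: "pointed_map \<Rightarrow> curve_point set" where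
  "points C = {..<comps C} \<times> UNIV"

definition nodal_curve :: "pointed_map \<Rightarrow> bool" where
  "nodal_curve C \<longleftrightarrow> comps C > 0 \<and> finite (nodes C) \<and> disjoint (nodes C) \<and>
     (\<forall>N\<in>nodes C. N \<subseteq> points C \<and> card N = 2)"

text \<open>The arithmetic genus of a connected nodal curve with rational components is the first Betti
  number of its dual graph, which vanishes iff there is one node less than there are components.\<close>

definition connected_genus_0 :: "pointed_map \<Rightarrow> bool" where
  "connected_genus_0 C \<longleftrightarrow>
     (\<forall>a<comps C. \<forall>b<comps C. (a, b) \<in> {(i, j). \<exists>x y. {(i, x), (j, y)} \<in> nodes C}\<^sup>*) \<and>
     card (nodes C) + 1 = comps C"

definition special_points :: "pointed_map \<Rightarrow> nat \<Rightarrow> curve_point set" where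
  "special_points C a = {p. fst p = a \<and> (p \<in> \<Union>(nodes C) \<or> p = mark1 C \<or> p = mark2 C)}"

definition map_at :: "pointed_map \<Rightarrow> curve_point \<Rightarrow> cvec set" where
  "map_at C p = comp_map C (fst p) (snd p)"

text \<open>The stable maps representing the points of \<open>\<M>\<^sub>0\<^sub>,\<^sub>2(IG, d)\<close>. Isomorphic maps are not
  identified; they have the same values under the evaluation maps.\<close>

definition stable_maps :: "nat \<Rightarrow> nat \<Rightarrow> nat \<Rightarrow> pointed_map set" where
  "stable_maps n k d = {C. nodal_curve C \<and> connected_genus_0 C \<and>
     mark1 C \<in> points C - \<Union>(nodes C) \<and> mark2 C \<in> points C - \<Union>(nodes C) \<and> mark1 C \<noteq> mark2 C \<and>
     (\<forall>a<comps C. comp_map C a \<in> P1_maps n k (comp_deg C a)) \<and>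
     (\<forall>N\<in>nodes C. \<forall>p\<in>N. \<forall>q\<in>N. map_at C p = map_at C q) \<and>
     (\<Sum>a<comps C. comp_deg C a) = d \<and>
     (\<forall>a<comps C. comp_deg C a = 0 \<longrightarrow> card (special_points C a) \<ge> 3)}"

definition ev1 :: "pointed_map \<Rightarrow> cvec set" where "ev1 C = map_at C (mark1 C)"
definition ev2 :: "pointed_map \<Rightarrow> cvec set" where "ev2 C = map_at C (mark2 C)"

definition curve_nbhd :: "nat \<Rightarrow> nat \<Rightarrow> nat \<Rightarrow> cvec set set \<Rightarrow> cvec set set" where
  "curve_nbhd n k d \<Omega> = ev2 ` {C \<in> stable_maps n k d. ev1 C \<in> \<Omega>}"

definition deg_q :: "nat \<Rightarrow> nat \<Rightarrow> int" where
  "deg_q n k = 2 * int n + 2 - int k"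

end

theory Submission
  imports Defs
begin

text \<open>Attach to \<open>V \<in> IG\<close> its jump set, the set of leading indices of the vectors of \<open>V\<close>. The subspaces with
  a given jump set \<open>J\<close> form a cell with polynomial coordinates, of dimension
  \<open>cell_dim n J = \<Sum>\<^sub>i\<^sub>\<in>\<^sub>J (i - 1) - |{a < b in J}| - |{a < b in J, a + b > 2n + 3}|\<close>. Counting forms of large degree
  bounds the Krull dimension of a union of cells by the largest \<open>cell_dim\<close>, and \<open>X(w)\<close> contains a
  chain of length \<open>cell_dim n I\<close>, \<open>I = w{1..k}\<close>, while all its jump sets are \<open>\<le> I\<close> in the Bruhat
  order. A map \<open>\<P>\<^sup>1 \<rightarrow> IG\<close> of degree \<open>d\<close> changes at most \<open>d\<close> elements of the jump set, and hence so does
  a stable map of degree \<open>d\<close>. Exchanging one element of an isotropic index set raises \<open>cell_dim\<close> by at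
  most \<open>2n + 1 - k = deg q - 1\<close>, and by less if 1 is not in the set; if 1 is not in \<open>I\<close> but in a smaller
  set \<open>I'\<close>, the strict inequality comes from \<open>cell_dim n I' < cell_dim n I\<close>.\<close>


section \<open>Dimensions of isotropic index sets\<close>

text \<open>No curve neighbourhood is computed: an upper bound for the dimension of a union of cells
  is compared with a lower bound for X(w), and the degree enters only through the overlap of jump
  sets. Since dimension is defined by chains of irreducible closed sets, the upper bound is a
  Hilbert function argument. A chain of length \<open>r\<close> produces \<open>(M + 1) ^ r\<close>
  linearly independent forms of degree proportional to \<open>M\<close>, while forms of that degree
  on finitely many cells with at most \<open>m\<close> parameters span a space of dimension O(M^m);
  letting \<open>M\<close> grow forces \<open>r \<le> m\<close>. For curves the obstacle is that a
  map of degree d is given by its Pluecker coordinates alone, so bases of its subspaces are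
  available only pointwise; the entries of a normalised basis have to be recovered from minors by
  Cramer's rule before orders of vanishing can be compared. The index 1 is special because its
  partner \<open>bar n 1 = 2 * n + 2\<close> is missing from \<open>E n\<close>.\<close>

definition isotropic_set :: "nat \<Rightarrow> nat set \<Rightarrow> bool" where
  "isotropic_set n I \<longleftrightarrow> I \<subseteq> {1..2 * n + 1} \<and> (\<forall>i\<in>I. bar n i \<notin> I)"

text \<open>The free entries (row, column) of a reduced echelon basis with pivots \<open>J\<close>.
  A column with \<open>bar n p = i\<close> stays free, since the pairing of a row with itself
  vanishes anyway.\<close>

definition cell_params :: "nat \<Rightarrow> nat set \<Rightarrow> (nat \<times> nat) set" where
  "cell_params n J = {(i, p). i \<in> J \<and> 1 \<le> p \<and> p < i \<and> p \<notin> J \<and> (bar n p \<in> J \<longrightarrow> bar n p \<le> i)}"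

definition rel_pairs :: "(nat \<Rightarrow> nat \<Rightarrow> bool) \<Rightarrow> nat set \<Rightarrow> (nat \<times> nat) set" where
  "rel_pairs r J = {(a, b). a \<in> J \<and> b \<in> J \<and> a < b \<and> r a b}"

definition cell_dim :: "nat \<Rightarrow> nat set \<Rightarrow> int" where
  "cell_dim n J = (\<Sum>i\<in>J. int i - 1) - int (card (rel_pairs (\<lambda>_ _. True) J))
     - int (card (rel_pairs (\<lambda>a b. 2 * n + 3 < a + b) J))"

definition count_gt :: "nat set \<Rightarrow> nat \<Rightarrow> nat" where
  "count_gt I q = card {i \<in> I. q < i}"

text \<open>Equivalent to comparing the increasing sequences entry by entry; the counting form is
  easier to follow through a reflection.\<close>

definition bruhat_le :: "nat set \<Rightarrow> nat set \<Rightarrow> bool" where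
  "bruhat_le I J \<longleftrightarrow> card I = card J \<and> (\<forall>q. count_gt I q \<le> count_gt J q)"

lemma isotropic_set_finite: "isotropic_set n I \<Longrightarrow> finite I"
  unfolding isotropic_set_def using finite_subset by blast

lemma isotropic_setD:
  assumes "isotropic_set n I" "i \<in> I"
  shows "1 \<le> i" "i \<le> 2 * n + 1" "bar n i \<notin> I"
  using assms unfolding isotropic_set_def by auto

lemma finite_rel_pairs: "finite J \<Longrightarrow> finite (rel_pairs r J)"
  by (rule finite_subset[of _ "J \<times> J"]) (auto simp: rel_pairs_def)

lemma card_rel_pairs_insert:
  assumes "finite K" "j \<notin> K" and sym: "\<And>a b. r a b = r b a"
  shows "card (rel_pairs r (insert j K)) = card (rel_pairs r K) + card {a \<in> K. r a j}"
proof -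
  have "rel_pairs r (insert j K) =
      rel_pairs r K \<union> ((\<lambda>a. if a < j then (a, j) else (j, a)) ` {a \<in> K. r a j})"
    using assms by (auto simp: rel_pairs_def image_iff) (metis linorder_neqE_nat)+
  moreover have "card ((\<lambda>a. if a < j then (a, j) else (j, a)) ` {a \<in> K. r a j}) = card {a \<in> K. r a j}"
    by (rule card_image) (auto simp: inj_on_def split: if_splits)
  moreover have "rel_pairs r K \<inter> ((\<lambda>a. if a < j then (a, j) else (j, a)) ` {a \<in> K. r a j}) = {}"
    using assms(2) by (auto simp: rel_pairs_def)
  ultimately show ?thesis
    using assms(1) by (simp add: card_Un_disjoint finite_rel_pairs)
qed

lemma cell_dim_insert:
  assumes "finite K" "j \<notin> K"
  shows "cell_dim n (insert j K) =
    cell_dim n K + int j - 1 - int (card K) - int (card {a \<in> K. 2 * n + 3 < a + j})"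
  using assms by (simp add: cell_dim_def card_rel_pairs_insert add.commute)

text \<open>The columns to the left of pivot \<open>i\<close> split into the free ones, the other
  pivot columns (\<open>P2\<close>), and those determined by orthogonality with a later row
  (\<open>P3\<close>).\<close>

lemma card_cell_params:
  assumes "isotropic_set n J"
  shows "int (card (cell_params n J)) = cell_dim n J"
proof -
  note D = isotropic_setD[OF assms]
  have fin: "finite J" using assms by (rule isotropic_set_finite)
  define P2 where "P2 = prod.swap ` rel_pairs (\<lambda>_ _. True) J"
  define P3 where "P3 = map_prod id (bar n) ` rel_pairs (\<lambda>a b. 2 * n + 3 < a + b) J"
  have P3: "P3 = {(i, p). i \<in> J \<and> bar n p \<in> J \<and> 1 \<le> p \<and> p < i \<and> i < bar n p}"
  proof safe
    fix i p assume "(i, p) \<in> P3"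
    then show "i \<in> J" "bar n p \<in> J" "1 \<le> p" "p < i" "i < bar n p"
      using D by (fastforce simp: P3_def rel_pairs_def bar_def)+
  next
    fix i p assume "i \<in> J" "bar n p \<in> J" "1 \<le> p" "p < i" "i < bar n p"
    then show "(i, p) \<in> P3" unfolding P3_def
      by (intro image_eqI[of _ _ "(i, bar n p)"]) (auto simp: rel_pairs_def bar_def)
  qed
  have "Sigma J (\<lambda>i. {1..<i}) = cell_params n J \<union> P2 \<union> P3"
  proof -
    have "P2 = {(i, p). i \<in> J \<and> p \<in> J \<and> p < i}" by (auto simp: P2_def rel_pairs_def)
    then show ?thesis using D unfolding P3 cell_params_def
      by auto
  qed
  moreover have "finite (cell_params n J)"
    by (rule finite_subset[of _ "Sigma J (\<lambda>i. {1..<i})"]) (use fin in \<open>auto simp: cell_params_def\<close>)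
  moreover have "cell_params n J \<inter> P2 = {}" "(cell_params n J \<union> P2) \<inter> P3 = {}"
    using D(3) unfolding P3 by (auto simp: cell_params_def P2_def rel_pairs_def)
  moreover have "finite P2" "finite P3" using fin by (auto simp: P2_def P3_def finite_rel_pairs)
  ultimately have "card (Sigma J (\<lambda>i. {1..<i})) = card (cell_params n J) + card P2 + card P3"
    by (simp add: card_Un_disjoint)
  moreover have "card P2 = card (rel_pairs (\<lambda>_ _. True) J)"
    unfolding P2_def by (rule card_image) simp
  moreover have "card P3 = card (rel_pairs (\<lambda>a b. 2 * n + 3 < a + b) J)"
    unfolding P3_def
  proof (rule card_image, rule inj_onI, clarsimp simp: rel_pairs_def)
    fix b b' assume "bar n b = bar n b'" "b \<in> J" "b' \<in> J"
    then show "b = b'" using D(2)[of b] D(2)[of b'] by (auto simp: bar_def)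
  qed
  moreover have "int (card (Sigma J (\<lambda>i. {1..<i}))) = (\<Sum>i\<in>J. int i - 1)"
    using fin D by (simp add: card_SigmaI of_nat_diff cong: sum.cong)
  ultimately show ?thesis by (simp add: cell_dim_def)
qed

text \<open>The change is \<open>j - i - hi j + hi i\<close>. Splitting \<open>K\<close> at
  \<open>2 * n + 3 - j\<close> replaces \<open>- hi j\<close> by \<open>card lo - card K\<close>,
  and \<open>card lo \<le> 2 * n + 2 - j\<close>, \<open>hi i \<le> i - 2\<close> leave
  \<open>2 * n - card K\<close>. If \<open>i = 1\<close>, the bound on \<open>hi i\<close> is worth
  one unit less, but 1 is then missing from \<open>lo\<close>, which compensates; if 1 is neither
  \<open>i\<close> nor in \<open>K\<close>, that unit is gained.\<close>

lemma cell_dim_exchange: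
  assumes I: "isotropic_set n (insert i K)" and J: "isotropic_set n (insert j K)"
    and "i \<notin> K" "j \<notin> K" "Suc (card K) \<le> n + 1" "1 \<le> n"
  shows "cell_dim n (insert j K) \<le> cell_dim n (insert i K) + 2 * int n - int (card K)"
    and "1 \<notin> insert i K \<Longrightarrow>
      cell_dim n (insert j K) \<le> cell_dim n (insert i K) + 2 * int n - 1 - int (card K)"
proof -
  have fin: "finite K" using isotropic_set_finite[OF I] by simp
  have K: "1 \<le> a" "a \<le> 2 * n + 1" if "a \<in> K" for a
    using isotropic_setD[OF I, of a] that by auto
  have i: "1 \<le> i" "i \<le> 2 * n + 1" "bar n i \<notin> K" and j: "1 \<le> j" "j \<le> 2 * n + 1" "bar n j \<notin> K"
    using isotropic_setD[OF I, of i] isotropic_setD[OF J, of j] by auto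
  define hi where "hi i = card {a \<in> K. 2 * n + 3 < a + i}" for i
  have diff: "cell_dim n (insert j K) = cell_dim n (insert i K) + int j - int i - int (hi j) + int (hi i)"
    using fin assms by (simp add: cell_dim_insert hi_def)
  have "int j - int i - int (hi j) + int (hi i) \<le> 2 * int n - int (card K) \<and>
    (1 \<notin> insert i K \<longrightarrow> int j - int i - int (hi j) + int (hi i) \<le> 2 * int n - 1 - int (card K))"
  proof (cases "i \<le> j")
    case True
    define lo mid where "lo = {a \<in> K. a + j \<le> 2 * n + 3}"
      and "mid = {a \<in> K. 2 * n + 3 < a + j \<and> a + i \<le> 2 * n + 3}"
    have nbar: "a + j \<noteq> 2 * n + 3" if "a \<in> K" for a
    proof
      assume "a + j = 2 * n + 3"
      then have "a = bar n j" by (simp add: bar_def)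
      then show False using that j(3) by simp
    qed
    have "K = lo \<union> {a \<in> K. 2 * n + 3 < a + j}" by (auto simp: lo_def)
    then have "card K = card lo + hi j"
      unfolding hi_def using fin by (subst card_Un_disjoint[symmetric]) (auto simp: lo_def)
    moreover have "hi i \<le> i - 2"
    proof -
      have "{a \<in> K. 2 * n + 3 < a + i} \<subseteq> {2 * n + 4 - i..2 * n + 1}" using K by auto
      then have "hi i \<le> card {2 * n + 4 - i..2 * n + 1}" unfolding hi_def by (intro card_mono) auto
      then show ?thesis using i by simp
    qed
    moreover have "card lo \<le> 2 * n + 2 - j"
    proof -
      have "lo \<subseteq> {1..<2 * n + 3 - j}" using K j nbar unfolding lo_def by force
      then have "card lo \<le> card {1..<2 * n + 3 - j}" by (intro card_mono) auto
      then show ?thesis by simp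
    qed
    moreover have "card lo \<le> 2 * n + 1 - j" if "1 \<notin> K"
    proof -
      have "2 \<le> a" if "a \<in> K" for a using K[of a] that \<open>1 \<notin> K\<close> by (cases "a = 1") auto
      then have "lo \<subseteq> {2..<2 * n + 3 - j}" using j nbar unfolding lo_def by force
      then have "card lo \<le> card {2..<2 * n + 3 - j}" by (intro card_mono) auto
      then show ?thesis by simp
    qed
    moreover have "1 \<notin> K" if "i = 1" using that assms(3) by simp
    ultimately show ?thesis using i j by (cases "i = 1") auto
  next
    case False
    \<comment> \<open>A downward exchange does not raise the dimension: the pairs lost from
      \<open>hi\<close> lie in a window of \<open>i - j\<close> integers. The claimed bounds are
      non-negative because \<open>card K \<le> n\<close> and \<open>1 \<le> n\<close>.\<close>
    have "{a \<in> K. 2 * n + 3 < a + i} \<subseteq> {a \<in> K. 2 * n + 3 < a + j} \<union> {2 * n + 4 - i..2 * n + 3 - j}"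
      by auto
    then have "hi i \<le> card ({a \<in> K. 2 * n + 3 < a + j} \<union> {2 * n + 4 - i..2 * n + 3 - j})"
      unfolding hi_def using fin by (intro card_mono) auto
    also have "\<dots> \<le> hi j + card {2 * n + 4 - i..2 * n + 3 - j}"
      unfolding hi_def by (rule card_Un_le)
    also have "card {2 * n + 4 - i..2 * n + 3 - j} = i - j" using i j False by simp
    finally show ?thesis using assms False by auto
  qed
  then show "cell_dim n (insert j K) \<le> cell_dim n (insert i K) + 2 * int n - int (card K)"
    and "1 \<notin> insert i K \<Longrightarrow>
      cell_dim n (insert j K) \<le> cell_dim n (insert i K) + 2 * int n - 1 - int (card K)"
    using diff by auto
qed

text \<open>The new index \<open>j\<close> can conflict only with \<open>bar n j\<close>. If that
  lies in \<open>I\<close>, it is not in \<open>J\<close>, so it may itself be the element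
  removed.\<close>

lemma isotropic_exchange:
  assumes I: "isotropic_set n I" and J: "isotropic_set n J" and "card I = card J" "I \<noteq> J"
  obtains i j where "i \<in> I - J" "j \<in> J - I" "isotropic_set n (insert j (I - {i}))"
proof -
  note fin = isotropic_set_finite[OF I] isotropic_set_finite[OF J]
  have ne: "I - J \<noteq> {}" "J - I \<noteq> {}"
    using assms fin by (metis Diff_eq_empty_iff card_subset_eq)+
  then obtain j where j: "j \<in> J - I" by blast
  obtain i where i: "i \<in> I - J" "bar n j \<in> I \<longrightarrow> i = bar n j"
    using ne j J by (cases "bar n j \<in> I") (auto simp: isotropic_set_def)
  have jj: "bar n j \<noteq> j" "1 \<le> j" "j \<le> 2 * n + 1" using j isotropic_setD[OF J, of j] by auto
  have "bar n x \<noteq> j" if "x \<in> I - {i}" for x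
  proof
    assume "bar n x = j"
    then have "bar n j = x" using jj isotropic_setD[OF I, of x] that by (auto simp: bar_def)
    then show False using i that by auto
  qed
  then have "isotropic_set n (insert j (I - {i}))"
    using I J i j jj unfolding isotropic_set_def by auto
  then show ?thesis using that i j by blast
qed

text \<open>Each exchange is made around a common part of \<open>k - 1\<close> elements and so costs
  at most \<open>2 * n - (k - 1)\<close>, the source of the factor
  \<open>2 * n + 1 - k\<close>.\<close>

lemma cell_dim_exchange_iter:
  assumes "isotropic_set n I" "isotropic_set n J" "card I = k" "card J = k"
    and "1 \<le> n" "1 \<le> k" "k \<le> n + 1" "card (I - J) \<le> d"
  shows "cell_dim n J \<le> cell_dim n I + int d * (2 * int n + 1 - int k)"
  using assms
proof (induction d arbitrary: I)
  case 0
  then have "I \<subseteq> J" using isotropic_set_finite[of n I] by simp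
  then have "I = J" using 0 isotropic_set_finite[of n J] by (simp add: card_subset_eq)
  then show ?case by simp
next
  case (Suc d)
  show ?case
  proof (cases "I = J")
    case True
    then show ?thesis using Suc.prems by simp
  next
    case False
    then obtain i j where ij: "i \<in> I - J" "j \<in> J - I" "isotropic_set n (insert j (I - {i}))"
      using isotropic_exchange Suc.prems by metis
    have fin: "finite I" using Suc.prems(1) by (rule isotropic_set_finite)
    have K: "card (I - {i}) = k - 1" using ij fin Suc.prems by simp
    have I: "insert i (I - {i}) = I" using ij by auto
    have "card (insert j (I - {i})) = k" using ij fin K Suc.prems by simp
    moreover have "card (insert j (I - {i}) - J) \<le> d"
    proof -
      have "insert j (I - {i}) - J = (I - J) - {i}" using ij by auto
      then show ?thesis using ij fin Suc.prems by simp
    qed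
    ultimately have "cell_dim n J \<le> cell_dim n (insert j (I - {i})) + int d * (2 * int n + 1 - int k)"
      using Suc.IH ij Suc.prems by blast
    moreover have "cell_dim n (insert j (I - {i})) \<le> cell_dim n I + 2 * int n - int (k - 1)"
      using cell_dim_exchange(1)[of n i "I - {i}" j] ij Suc.prems K unfolding I by auto
    ultimately show ?thesis using Suc.prems by (simp add: algebra_simps of_nat_diff)
  qed
qed

lemma cell_dim_exchange_strict:
  assumes "isotropic_set n I" "isotropic_set n J" "card I = k" "card J = k"
    and "1 \<le> n" "1 \<le> k" "k \<le> n + 1" "card (I - J) \<le> 1" "1 \<notin> I"
  shows "cell_dim n J \<le> cell_dim n I + 2 * int n - int k"
proof (cases "I = J")
  case True
  then show ?thesis using assms by simp
next
  case False
  then obtain i j where ij: "i \<in> I - J" "j \<in> J - I" "isotropic_set n (insert j (I - {i}))"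
    using isotropic_exchange assms by metis
  have fin: "finite I" "finite J" using assms isotropic_set_finite by auto
  have K: "card (I - {i}) = k - 1" using ij fin assms by simp
  have "I - J = {i}"
    using assms(8) ij fin by (metis card_le_Suc0_iff_eq finite_Diff One_nat_def is_singletonI' is_singleton_def singletonD empty_iff)
  then have "insert j (I - {i}) \<subseteq> J" using ij by auto
  moreover have "card (insert j (I - {i})) = card J" using ij fin K assms by simp
  ultimately have J: "insert j (I - {i}) = J" using fin by (simp add: card_subset_eq)
  have I: "insert i (I - {i}) = I" using ij by auto
  show ?thesis
    using cell_dim_exchange(2)[of n i "I - {i}" j] ij assms K unfolding I J by (auto simp: of_nat_diff)
qed


section \<open>Simple reflections and descents of isotropic index sets\<close>

definition sw :: "nat \<Rightarrow> nat \<Rightarrow> nat \<Rightarrow> nat" where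
  "sw n p x = (if x = p \<or> x = 2 * n + 2 - p then x + 1
     else if x = p + 1 \<or> x = 2 * n + 3 - p then x - 1 else x)"

text \<open>The two transpositions of a simple reflection mirror each other, so it has two indices,
  which coincide for \<open>p = n + 1\<close>. A descent can therefore be treated in whichever half
  it occurs.\<close>

lemma sw_flip: "p \<le> 2 * n + 1 \<Longrightarrow> sw n (2 * n + 2 - p) = sw n p"
  by (auto simp: sw_def fun_eq_iff)

text \<open>Replaces truncated subtraction by an index \<open>p'\<close> with
  \<open>p + p' = 2 * n + 2\<close>. Since this sum is even, the two transpositions are disjoint or
  equal, never overlapping.\<close>

lemma sw_cases:
  assumes "p \<le> 2 * n + 1"
  obtains p' where "p + p' = 2 * n + 2" "p \<noteq> p' + 1" "p' \<noteq> p + 1"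
    "sw n p = (\<lambda>x. if x = p \<or> x = p' then x + 1 else if x = p + 1 \<or> x = p' + 1 then x - 1 else x)"
proof (rule that)
  show "p + (2 * n + 2 - p) = 2 * n + 2" using assms by simp
  show "p \<noteq> (2 * n + 2 - p) + 1" "(2 * n + 2 - p) \<noteq> p + 1" using assms by presburger+
  have "2 * n + 3 - p = 2 * n + 2 - p + 1" using assms by simp
  then show "sw n p = (\<lambda>x. if x = p \<or> x = 2 * n + 2 - p then x + 1
      else if x = p + 1 \<or> x = 2 * n + 2 - p + 1 then x - 1 else x)"
    by (simp add: sw_def fun_eq_iff)
qed

lemma sw_invol:
  assumes "1 \<le> p" "p \<le> 2 * n + 1"
  shows "sw n p (sw n p x) = x"
proof -
  obtain p' where "p + p' = 2 * n + 2" "p \<noteq> p' + 1" "p' \<noteq> p + 1"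
    and sw: "sw n p = (\<lambda>x. if x = p \<or> x = p' then x + 1 else if x = p + 1 \<or> x = p' + 1 then x - 1 else x)"
    by (rule sw_cases[OF assms(2)])
  then show ?thesis using assms unfolding sw by auto
qed

lemma sw_inj: "1 \<le> p \<Longrightarrow> p \<le> 2 * n + 1 \<Longrightarrow> inj_on (sw n p) A"
  by (metis inj_onI sw_invol)

lemma sw_bar:
  assumes "1 \<le> p" "p \<le> 2 * n + 1" "1 \<le> x" "x \<le> 2 * n + 2"
  shows "sw n p (bar n x) = bar n (sw n p x)"
proof -
  obtain p' where p': "p + p' = 2 * n + 2" "p \<noteq> p' + 1" "p' \<noteq> p + 1"
    and sw: "sw n p = (\<lambda>x. if x = p \<or> x = p' then x + 1 else if x = p + 1 \<or> x = p' + 1 then x - 1 else x)"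
    by (rule sw_cases[OF assms(2)])
  define y where "y = bar n x"
  have y: "x + y = 2 * n + 3" using assms by (simp add: y_def bar_def)
  then have eqs: "y = p \<longleftrightarrow> x = p' + 1" "y = p' \<longleftrightarrow> x = p + 1" "y = p + 1 \<longleftrightarrow> x = p'" "y = p' + 1 \<longleftrightarrow> x = p"
    using p'(1) by linarith+
  have "bar n (x + 1) = y - 1" "bar n (x - 1) = y + 1"
    using y assms by (auto simp: bar_def)
  then have "bar n (sw n p x) = (if x = p \<or> x = p' then y - 1 else if x = p + 1 \<or> x = p' + 1 then y + 1 else y)"
    by (simp add: sw y_def)
  moreover have "sw n p y = (if x = p' + 1 \<or> x = p + 1 then y + 1 else if x = p' \<or> x = p then y - 1 else y)"
    unfolding sw using eqs by simp
  ultimately show ?thesis using p'(2,3) by (auto simp flip: y_def)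
qed

lemma in_sw_image: "1 \<le> p \<Longrightarrow> p \<le> 2 * n + 1 \<Longrightarrow> x \<in> sw n p ` I \<longleftrightarrow> sw n p x \<in> I"
  by (metis (no_types, lifting) image_iff sw_invol)

text \<open>If only \<open>p + 1\<close> moves, its index drops by one, and no element of the rest
  can cross the bound \<open>2 * n + 3\<close>, since that would make it \<open>bar n p\<close>. If
  \<open>2 * n + 3 - p\<close> moves too, two units are lost, but the sum of the two moved elements
  falls from \<open>2 * n + 4\<close> to \<open>2 * n + 2\<close>, which gives one back.\<close>

lemma sw_descent:
  assumes I: "isotropic_set n I" and p: "1 \<le> p" "p + 1 \<in> I" "p \<notin> I"
  shows "isotropic_set n (sw n p ` I)" "cell_dim n (sw n p ` I) = cell_dim n I - 1"
proof -
  note D = isotropic_setD[OF I]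
  have fin: "finite I" using I by (rule isotropic_set_finite)
  have p2: "p \<le> 2 * n" using D(2)[OF p(2)] by simp
  have nb: "2 * n + 2 - p \<notin> I" using D(3)[OF p(2)] by (simp add: bar_def)
  note mem = in_sw_image[of p n]
  have sub: "1 \<le> sw n p x" "sw n p x \<le> 2 * n + 1" if "x \<in> I" for x
  proof -
    have "x \<noteq> 2 * n + 2 - p" using nb that by auto
    then show "1 \<le> sw n p x" "sw n p x \<le> 2 * n + 1"
      using D[OF that] p p2 by (auto simp: sw_def)
  qed
  have "bar n (sw n p x) \<notin> sw n p ` I" if "x \<in> I" for x
  proof -
    have "bar n (sw n p x) = sw n p (bar n x)"
      using D[OF that] p p2 by (simp add: sw_bar)
    then show ?thesis using D(3)[OF that] p p2 by (simp add: mem sw_invol)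
  qed
  then show "isotropic_set n (sw n p ` I)"
    unfolding isotropic_set_def using sub by auto
  define L where "L = I - {p + 1, 2 * n + 3 - p}"
  have L: "finite L" "p \<notin> L" "p + 1 \<notin> L" "2 * n + 2 - p \<notin> L" "2 * n + 3 - p \<notin> L"
    using fin p nb by (auto simp: L_def)
  have swL: "sw n p ` L = L"
  proof -
    have "sw n p x = x" if "x \<in> L" for x using L that by (auto simp: sw_def)
    then show ?thesis by auto
  qed
  have e1: "{a \<in> L. 2 * n + 3 < a + (p + 1)} = {a \<in> L. 2 * n + 3 < a + p}"
  proof -
    have "a + p \<noteq> 2 * n + 3" if "a \<in> L" for a using L(5) that by (metis diff_add_inverse2)
    then show ?thesis by force
  qed
  have gt: "2 * n + 3 < a + (2 * n + 3 - p) \<longleftrightarrow> p < a" "2 * n + 3 < a + (2 * n + 2 - p) \<longleftrightarrow> p + 1 < a" for a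
    using p2 by linarith+
  have e2: "{a \<in> L. p < a} = {a \<in> L. p + 1 < a}"
  proof -
    have "a \<noteq> p + 1" if "a \<in> L" for a using L(3) that by auto
    then show ?thesis by force
  qed
  show "cell_dim n (sw n p ` I) = cell_dim n I - 1"
  proof (cases "2 * n + 3 - p \<in> I \<and> p \<noteq> n + 1")
    case True
    have I2: "I = insert (2 * n + 3 - p) (insert (p + 1) L)" using True p by (auto simp: L_def)
    have sI: "sw n p ` I = insert (2 * n + 2 - p) (insert p L)"
      proof -
      have "sw n p (p + 1) = p" "sw n p (2 * n + 3 - p) = 2 * n + 2 - p"
        using p2 by (auto simp: sw_def) presburger+
      then show ?thesis unfolding I2 image_insert swL by simp
    qed
    have m1: "{a \<in> insert (p + 1) L. p < a} = insert (p + 1) {a \<in> L. p + 1 < a}"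
      using e2 by auto
    have m2: "{a \<in> insert p L. p + 1 < a} = {a \<in> L. p + 1 < a}" by auto
    have ni: "2 * n + 3 - p \<notin> insert (p + 1) L" "2 * n + 2 - p \<notin> insert p L"
      using True L by auto
    have c: "card (insert (p + 1) L) = card L + 1" "card (insert p L) = card L + 1"
      "card (insert (p + 1) {a \<in> L. p + 1 < a}) = card {a \<in> L. p + 1 < a} + 1"
      using L by auto
    have "cell_dim n I = cell_dim n (insert (p + 1) L) + int (2 * n + 3 - p) - 1 - int (card L + 1)
        - int (card {a \<in> L. p + 1 < a} + 1)"
      using cell_dim_insert[OF _ ni(1), of n] L(1) unfolding I2 gt m1 c by blast
    moreover have "cell_dim n (sw n p ` I) = cell_dim n (insert p L) + int (2 * n + 2 - p) - 1
        - int (card L + 1) - int (card {a \<in> L. p + 1 < a})"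
      using cell_dim_insert[OF _ ni(2), of n] L(1) unfolding sI gt m2 c by blast
    moreover have "cell_dim n (insert (p + 1) L) = cell_dim n (insert p L) + 1"
      using cell_dim_insert[OF L(1,2), of n] cell_dim_insert[OF L(1,3), of n] unfolding e1 by simp
    ultimately show ?thesis using p2 by simp
  next
    case False
    have I2: "I = insert (p + 1) L" using False p by (auto simp: L_def)
    have sI: "sw n p ` I = insert p L"
      proof -
      have "sw n p (p + 1) = p" using p2 by (simp add: sw_def) presburger
      then show ?thesis unfolding I2 image_insert swL by simp
    qed
    show ?thesis
      using cell_dim_insert[OF L(1,2), of n] cell_dim_insert[OF L(1,3), of n] unfolding sI unfolding I2 e1 by simp
  qed
qed

lemma count_gt_Suc: "finite I \<Longrightarrow> count_gt I q = count_gt I (q + 1) + (if q + 1 \<in> I then 1 else 0)"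
proof -
  assume fin: "finite I"
  have "{i \<in> I. q < i} = {i \<in> I. q + 1 < i} \<union> (I \<inter> {q + 1})" by auto
  then show ?thesis using fin unfolding count_gt_def
    by (subst \<open>{i \<in> I. q < i} = _\<close>, subst card_Un_disjoint) auto
qed

text \<open>The reflection carries elements only across the thresholds \<open>p\<close> and
  \<open>2 * n + 2 - p\<close>.\<close>

lemma count_gt_sw:
  assumes p: "1 \<le> p" "p \<le> 2 * n + 1" and "q \<noteq> p" "q \<noteq> 2 * n + 2 - p"
  shows "count_gt (sw n p ` I) q = count_gt I q"
proof -
  have "q < sw n p x \<longleftrightarrow> q < x" for x
  proof -
    obtain p' where "p + p' = 2 * n + 2" "p \<noteq> p' + 1" "p' \<noteq> p + 1"
      and sw: "sw n p = (\<lambda>x. if x = p \<or> x = p' then x + 1 else if x = p + 1 \<or> x = p' + 1 then x - 1 else x)"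
      by (rule sw_cases[OF p(2)])
    moreover from this assms have "q \<noteq> p'" by auto
    ultimately show ?thesis using assms(3) unfolding sw by (simp only: split: if_splits) linarith
  qed
  then have "{i \<in> sw n p ` I. q < i} = sw n p ` {i \<in> I. q < i}" by auto
  then show ?thesis by (simp add: count_gt_def card_image sw_inj[OF p])
qed

lemma count_gt_sw':
  assumes p: "1 \<le> p" "p \<le> 2 * n + 1" and q: "q = p \<or> q = 2 * n + 2 - p" and fin: "finite I"
  shows "count_gt (sw n p ` I) q = count_gt I (q + 1) + (if q \<in> I then 1 else 0)"
proof -
  have "q < sw n p x \<longleftrightarrow> q + 1 < x \<or> x = q" for x
  proof -
    obtain p' where p': "p + p' = 2 * n + 2" "p \<noteq> p' + 1" "p' \<noteq> p + 1"
      and sw: "sw n p = (\<lambda>x. if x = p \<or> x = p' then x + 1 else if x = p + 1 \<or> x = p' + 1 then x - 1 else x)"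
      by (rule sw_cases[OF p(2)])
    define q' where "q' = (if q = p then p' else p)"
    have "q = p \<or> q = p'" using q p'(1) by linarith
    then have "sw n p = (\<lambda>x. if x = q \<or> x = q' then x + 1 else if x = q + 1 \<or> x = q' + 1 then x - 1 else x)"
      "q \<noteq> q' + 1" "q' \<noteq> q + 1"
      using p'(2,3) by (auto simp: sw q'_def fun_eq_iff)
    then show ?thesis by simp linarith
  qed
  then have "{i \<in> sw n p ` I. q < i} = sw n p ` ({i \<in> I. q + 1 < i} \<union> (I \<inter> {q}))" by auto
  then have "count_gt (sw n p ` I) q = card ({i \<in> I. q + 1 < i} \<union> (I \<inter> {q}))"
    by (simp add: count_gt_def card_image sw_inj[OF p])
  also have "\<dots> = count_gt I (q + 1) + (if q \<in> I then 1 else 0)"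
    unfolding count_gt_def using fin by (subst card_Un_disjoint) auto
  finally show ?thesis .
qed

text \<open>The lifting property of the Bruhat order: if \<open>s\<close> is a descent of \<open>I\<close>, then \<open>I' \<le> I\<close> implies
  \<open>s I' \<le> s I\<close> or \<open>I' \<le> s I\<close>, according to whether \<open>s\<close> is a descent of \<open>I'\<close>.\<close>

lemma cell_dim_bruhat_mono:
  assumes "isotropic_set n I" "isotropic_set n I'" "bruhat_le I' I"
  shows "cell_dim n I' \<le> cell_dim n I \<and> (I' \<noteq> I \<longrightarrow> cell_dim n I' < cell_dim n I)"
  using assms
proof (induction "card (cell_params n I)" arbitrary: I I' rule: less_induct)
  case less
  note fin = isotropic_set_finite[OF less.prems(1)] isotropic_set_finite[OF less.prems(2)]
  have card: "card I' = card I" and le: "\<And>q. count_gt I' q \<le> count_gt I q"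
    using less.prems(3) by (auto simp: bruhat_le_def)
  show ?case
  proof (cases "\<exists>p\<ge>1. p + 1 \<in> I \<and> p \<notin> I")
    case False
    \<comment> \<open>Without descents \<open>I\<close> is an initial segment, so the comparison at
      its maximum leaves no other choice for \<open>I'\<close>.\<close>
    have down: "\<forall>i\<in>I. \<forall>j\<in>{1..i}. j \<in> I"
    proof (intro ballI)
      fix i j assume "i \<in> I" "j \<in> {1..i}"
      then have "j \<le> i" "1 \<le> j" by auto
      then show "j \<in> I"
        by (induction rule: inc_induct) (use \<open>i \<in> I\<close> False in auto)
    qed
    have "I' \<subseteq> I"
    proof (cases "I = {}")
      case True
      then show ?thesis using card fin by simp
    next
      case False
      then have m: "Max I \<in> I" using fin by simp
      have "count_gt I (Max I) = 0" using fin Max_ge unfolding count_gt_def by (fastforce simp: not_less)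
      then have "count_gt I' (Max I) = 0" using le[of "Max I"] by simp
      then have "\<forall>i\<in>I'. i \<le> Max I" using fin by (auto simp: count_gt_def)
      then show ?thesis using down m isotropic_setD(1)[OF less.prems(2)] by auto
    qed
    then have "I' = I" using card fin by (simp add: card_subset_eq)
    then show ?thesis by simp
  next
    case True
    then obtain p where p: "1 \<le> p" "p + 1 \<in> I" "p \<notin> I" by blast
    have p2: "p \<le> 2 * n" using isotropic_setD(2)[OF less.prems(1) p(2)] by simp
    define p' where "p' = 2 * n + 2 - p"
    have p': "1 \<le> p'" "p' + 1 = 2 * n + 3 - p" "sw n p' = sw n p" "p' \<le> 2 * n + 1"
      using p p2 sw_flip[of p n] by (auto simp: p'_def)
    have nb: "p' \<notin> I" using isotropic_setD(3)[OF less.prems(1) p(2)] by (simp add: bar_def p'_def)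
    note sI = sw_descent[OF less.prems(1) p]
    \<comment> \<open>Both indices of the reflection are tested, because \<open>I'\<close> may have
      its descent in the other half than \<open>I\<close>.\<close>
    define desc where "desc \<longleftrightarrow> (\<exists>q\<in>{p, p'}. q + 1 \<in> I' \<and> q \<notin> I')"
    define X where "X = (if desc then sw n p ` I' else I')"
    have X: "isotropic_set n X" "cell_dim n X = cell_dim n I' - (if desc then 1 else 0)"
      using sw_descent[OF less.prems(2), of p] sw_descent[OF less.prems(2), of p'] p p' less.prems(2)
      by (auto simp: X_def desc_def)
    have barq: "\<not> (q \<in> I' \<and> 2 * n + 3 - q \<in> I')" for q
      using isotropic_setD(3)[OF less.prems(2), of q] by (auto simp: bar_def)
    \<comment> \<open>Once a descent has been removed, \<open>X\<close> contains
      \<open>q + 1\<close> only if \<open>I'\<close> contains both \<open>q\<close> and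
      \<open>q + 1\<close>; this makes the two cases of the lifting property uniform.\<close>
    have cX: "count_gt X q = count_gt I' (q + 1) + (if q \<in> I' \<and> q + 1 \<in> I' then 1 else 0)"
      if "q \<in> {p, p'}" for q
    proof (cases desc)
      case True
      have "q + 1 \<in> I'" if "q \<in> I'"
        using True that \<open>q \<in> {p, p'}\<close> p' barq[of p] barq[of "p'"] barq[of "p + 1"] p2
        unfolding desc_def by (auto simp: p'_def)
      then show ?thesis
        using count_gt_sw'[of p n q I'] p p2 that fin True by (auto simp: X_def p'_def)
    next
      case False
      then have "q + 1 \<in> I' \<longrightarrow> q \<in> I'" using that by (auto simp: desc_def)
      then show ?thesis
        using count_gt_Suc[OF fin(2), of q] False by (auto simp: X_def)
    qed
    have "count_gt X q \<le> count_gt (sw n p ` I) q" for q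
    proof (cases "q \<in> {p, p'}")
      case False
      then have "count_gt X q = count_gt I' q" "count_gt (sw n p ` I) q = count_gt I q"
        using count_gt_sw[of p n q] p p2 by (auto simp: X_def p'_def)
      then show ?thesis using le by simp
    next
      case True
      then have q1: "1 \<le> q" using p p' by auto
      have qI: "q \<notin> I" using True p nb by auto
      have cI: "count_gt (sw n p ` I) q = count_gt I (q + 1)"
        using count_gt_sw'[of p n q I] p p2 True fin qI by (auto simp: p'_def)
      show ?thesis
      proof (cases "q \<in> I' \<and> q + 1 \<in> I'")
        case False
        then show ?thesis using cX[OF True] cI le[of "q + 1"] by auto
      next
        case both: True
        \<comment> \<open>From threshold \<open>q - 1\<close> to \<open>q + 1\<close> the count of
          \<open>I'\<close> drops by two and that of \<open>I\<close> by at most one, as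
          \<open>q \<notin> I\<close>. So the inequality at \<open>q - 1\<close> yields the one at
          \<open>q + 1\<close> with a slack of one.\<close>
        have "count_gt I' (q - 1) = count_gt I' (q + 1) + 2"
          using count_gt_Suc[OF fin(2), of q] count_gt_Suc[OF fin(2), of "q - 1"] both q1 by simp
        moreover have "count_gt I (q - 1) \<le> count_gt I (q + 1) + 1"
          using count_gt_Suc[OF fin(1), of q] count_gt_Suc[OF fin(1), of "q - 1"] qI q1 by simp
        ultimately show ?thesis using cX[OF True] cI le[of "q - 1"] both by simp
      qed
    qed
    moreover have "card X = card (sw n p ` I)"
      using card p p2 by (simp add: X_def card_image sw_inj)
    ultimately have "bruhat_le X (sw n p ` I)" by (simp add: bruhat_le_def)
    moreover have "card (cell_params n (sw n p ` I)) < card (cell_params n I)"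
      using card_cell_params[OF sI(1)] card_cell_params[OF less.prems(1)] sI(2) by simp
    ultimately have *: "cell_dim n X \<le> cell_dim n (sw n p ` I) \<and>
        (X \<noteq> sw n p ` I \<longrightarrow> cell_dim n X < cell_dim n (sw n p ` I))"
      using less.hyps sI(1) X(1) by blast
    show ?thesis
    proof (cases desc)
      case True
      have "X \<noteq> sw n p ` I" if "I' \<noteq> I"
        using that True sw_inj[of p n UNIV] p p2 by (simp add: X_def inj_image_eq_iff)
      then show ?thesis using * True X(2) sI(2) by auto
    next
      case False
      then show ?thesis using * X(2) sI(2) by auto
    qed
  qed
qed


section \<open>Jump sets and reduced echelon forms\<close>

lemma sum_fun_apply: "(\<Sum>a\<in>A. f a) x = (\<Sum>a\<in>A. f a x :: 'b :: comm_monoid_add)"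
  by (induction A rule: infinite_finite_induct) auto

lemma subspace_E: "cvec.subspace (E n)"
  by (auto simp: cvec.subspace_def E_def cscale_def)

definition jumps :: "cvec set \<Rightarrow> nat set" where
  "jumps V = {i. \<exists>v\<in>V. v i \<noteq> 0 \<and> (\<forall>l>i. v l = 0)}"

definition reduced_at :: "nat set \<Rightarrow> nat \<Rightarrow> cvec \<Rightarrow> bool" where
  "reduced_at J i v \<longleftrightarrow> v i = 1 \<and> (\<forall>l>i. v l = 0) \<and> (\<forall>l\<in>J - {i}. v l = 0)"

text \<open>The choice is unique: two candidates agree on all pivots, so their difference vanishes
  by \<open>vanish_on_jumps\<close>.\<close>

definition red :: "cvec set \<Rightarrow> nat \<Rightarrow> cvec" where
  "red V i = (SOME v. v \<in> V \<and> reduced_at (jumps V) i v)"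

lemma jumps_subset: "V \<subseteq> E n \<Longrightarrow> jumps V \<subseteq> {1..2 * n + 1}"
  unfolding jumps_def E_def by blast

context
  fixes V :: "cvec set" and n :: nat
  assumes V: "cvec.subspace V" "V \<subseteq> E n"
begin

lemma finite_jumps: "finite (jumps V)"
  using jumps_subset[OF V(2)] finite_subset by blast

text \<open>Gaussian elimination from the lowest pivot upwards: vectors already reduced clear one
  lower pivot each without disturbing the others.\<close>

lemma reduced_exists: "i \<in> jumps V \<Longrightarrow> \<exists>v\<in>V. reduced_at (jumps V) i v"
proof (induction i rule: less_induct)
  case (less i)
  define L where "L = {l \<in> jumps V. l < i}"
  have "\<exists>r. \<forall>l\<in>L. r l \<in> V \<and> reduced_at (jumps V) l (r l)"
    using less.IH by (intro bchoice) (auto simp: L_def)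
  then obtain r where r: "\<And>l. l \<in> L \<Longrightarrow> r l \<in> V" "\<And>l. l \<in> L \<Longrightarrow> reduced_at (jumps V) l (r l)"
    by blast
  obtain v where v: "v \<in> V" "v i \<noteq> 0" "\<And>l. l > i \<Longrightarrow> v l = 0"
    using less.prems by (auto simp: jumps_def)
  have fin: "finite L" using finite_jumps by (simp add: L_def)
  define u where "u = cscale (1 / v i) v - (\<Sum>l\<in>L. cscale (v l / v i) (r l))"
  have u: "u x = v x / v i - (\<Sum>l\<in>L. v l / v i * r l x)" for x
    by (simp add: u_def sum_fun_apply cscale_def)
  have "u \<in> V" unfolding u_def
    using V(1) v(1) r(1) by (intro cvec.subspace_diff cvec.subspace_sum cvec.subspace_scale)
  moreover have "reduced_at (jumps V) i u"
    unfolding reduced_at_def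
  proof (intro conjI allI impI ballI)
    have 0: "(\<Sum>l\<in>L. v l / v i * r l x) = 0" if "x \<ge> i" for x
      using r(2) that by (intro sum.neutral) (auto simp: L_def reduced_at_def)
    show "u i = 1" using 0[of i] v(2) by (simp add: u)
    show "u l = 0" if "l > i" for l using 0[of l] v(3)[OF that] that by (simp add: u)
    fix l assume l: "l \<in> jumps V - {i}"
    show "u l = 0"
    proof (cases "l > i")
      case True
      then show ?thesis using 0[of l] v(3) by (simp add: u)
    next
      case False
      then have "l \<in> L" using l by (auto simp: L_def)
      have "(\<Sum>m\<in>L. v m / v i * r m l) = (\<Sum>m\<in>L. if m = l then v l / v i else 0)"
        using r(2) l by (intro sum.cong) (auto simp: reduced_at_def)
      then show ?thesis using \<open>l \<in> L\<close> fin by (simp add: u)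
    qed
  qed
  ultimately show ?case by blast
qed

lemma red: "i \<in> jumps V \<Longrightarrow> red V i \<in> V" "i \<in> jumps V \<Longrightarrow> reduced_at (jumps V) i (red V i)"
  using someI_ex[of "\<lambda>v. v \<in> V \<and> reduced_at (jumps V) i v"] reduced_exists
  unfolding red_def by blast+

lemma vanish_on_jumps:
  assumes "v \<in> V" "\<And>l. l \<in> jumps V \<Longrightarrow> v l = 0"
  shows "v = 0"
proof (rule ccontr)
  assume "v \<noteq> 0"
  define S where "S = {i. v i \<noteq> 0}"
  have "S \<subseteq> {1..2 * n + 1}" using assms(1) V(2) unfolding S_def E_def by blast
  then have S: "finite S" "S \<noteq> {}"
    using \<open>v \<noteq> 0\<close> finite_subset[of S "{1..2 * n + 1}"] by (simp_all add: S_def fun_eq_iff)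
  have "Max S \<in> S" using S by simp
  moreover have "v l = 0" if "l > Max S" for l
    using Max_ge[OF S(1), of l] that unfolding S_def by (metis leD mem_Collect_eq)
  ultimately have "Max S \<in> jumps V" using assms(1) unfolding jumps_def S_def by blast
  then show False using assms(2) \<open>Max S \<in> S\<close> by (auto simp: S_def)
qed

lemma expand_red:
  assumes "v \<in> V"
  shows "v = (\<Sum>i\<in>jumps V. cscale (v i) (red V i))"
proof -
  have "v - (\<Sum>i\<in>jumps V. cscale (v i) (red V i)) = 0"
  proof (rule vanish_on_jumps)
    show "v - (\<Sum>i\<in>jumps V. cscale (v i) (red V i)) \<in> V"
      using assms V(1) red(1) by (intro cvec.subspace_diff cvec.subspace_sum cvec.subspace_scale)
    fix l assume l: "l \<in> jumps V"
    have "(\<Sum>i\<in>jumps V. v i * red V i l) = (\<Sum>i\<in>jumps V. if i = l then v l else 0)"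
      using red(2) l by (intro sum.cong) (auto simp: reduced_at_def)
    then show "(v - (\<Sum>i\<in>jumps V. cscale (v i) (red V i))) l = 0"
      using l finite_jumps by (simp add: sum_fun_apply cscale_def)
  qed
  then show ?thesis by simp
qed

lemma span_red: "cvec.span (red V ` jumps V) = V"
proof
  show "cvec.span (red V ` jumps V) \<subseteq> V"
    using V(1) red(1) by (intro cvec.span_minimal) auto
  show "V \<subseteq> cvec.span (red V ` jumps V)"
  proof
    fix v assume "v \<in> V"
    have "(\<Sum>i\<in>jumps V. cscale (v i) (red V i)) \<in> cvec.span (red V ` jumps V)"
      by (intro cvec.span_sum cvec.span_scale cvec.span_base) auto
    then show "v \<in> cvec.span (red V ` jumps V)"
      using expand_red[OF \<open>v \<in> V\<close>] by simp
  qed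
qed

end

lemma image_nth_sorted:
  assumes "finite J" "card J = k"
  shows "(\<lambda>m. sorted_list_of_set J ! m) ` {..<k} = J"
proof -
  have "(\<lambda>m. sorted_list_of_set J ! m) ` {..<k} = set (sorted_list_of_set J)"
    using assms by (auto simp: set_conv_nth)
  then show ?thesis using assms by simp
qed

lemma nth_sorted_mem: "finite J \<Longrightarrow> card J = k \<Longrightarrow> m < k \<Longrightarrow> sorted_list_of_set J ! m \<in> J"
  using image_nth_sorted by blast

lemma nth_sorted_eq_iff:
  assumes "finite J" "card J = k" "m < k" "m' < k"
  shows "sorted_list_of_set J ! m = sorted_list_of_set J ! m' \<longleftrightarrow> m = m'"
  using assms by (simp add: nth_eq_iff_index_eq)

lemma dim_span_reduced:
  assumes "finite J" "card J = k" "\<And>i. i \<in> J \<Longrightarrow> reduced_at J i (r i)"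
  shows "cvec.dim (cvec.span (r ` J)) = k"
proof -
  have "cvec.dim (cvec.span ((\<lambda>m. r (sorted_list_of_set J ! m)) ` {..<k})) = k"
  proof (rule dim_span_echelon)
    fix m assume m: "m < k"
    let ?s = "sorted_list_of_set J"
    have "r (?s ! m) (?s ! m) \<noteq> 0"
      using assms(3)[OF nth_sorted_mem[OF assms(1,2) m]] by (simp add: reduced_at_def)
    moreover have "r (?s ! l) (?s ! m) = 0" if "l < m" for l
    proof -
      have "?s ! m \<noteq> ?s ! l" "?s ! m \<in> J"
        using nth_sorted_eq_iff[OF assms(1,2), of m l] m that nth_sorted_mem[OF assms(1,2) m] by auto
      then show ?thesis
        using assms(3)[OF nth_sorted_mem[OF assms(1,2), of l]] m that by (simp add: reduced_at_def)
    qed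
    ultimately show "\<exists>i. r (?s ! m) i \<noteq> 0 \<and> (\<forall>l<m. r (?s ! l) i = 0)" by blast
  qed
  moreover have "(\<lambda>m. r (sorted_list_of_set J ! m)) ` {..<k} = r ` J"
    using image_nth_sorted[OF assms(1,2)] by (metis image_image)
  ultimately show ?thesis by simp
qed

lemma card_jumps:
  assumes "cvec.subspace V" "V \<subseteq> E n"
  shows "card (jumps V) = cvec.dim V"
  using dim_span_reduced[OF finite_jumps[OF assms] refl red(2)[OF assms]] span_red[OF assms] by simp

section \<open>The symplectic form on reduced vectors and the parametrisation of a cell\<close>

definition eps :: "nat \<Rightarrow> nat \<Rightarrow> complex" where
  "eps n l = (if l \<le> n + 1 then 1 else - 1)"

lemma eps_square: "eps n l * eps n l = 1" "eps n l * (eps n l * x) = x" "eps n l \<noteq> 0"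
  by (auto simp: eps_def)

lemma eps_bar: "1 \<le> l \<Longrightarrow> l \<le> 2 * n + 2 \<Longrightarrow> eps n (bar n l) = - eps n l"
  by (auto simp: eps_def bar_def)

lemma bar_bar: "l \<le> 2 * n + 3 \<Longrightarrow> bar n (bar n l) = l"
  by (simp add: bar_def)

text \<open>One sum over all \<open>2 * n + 2\<close> indices, in which \<open>eps\<close> absorbs
  the two signs of each pair; every index can then be treated alike.\<close>

lemma omega_eq: "omega n u v = (\<Sum>l=1..2*n+2. eps n l * u l * v (bar n l))"
proof -
  have "{1..2*n+2} = {1..n+1} \<union> {n+2..2*n+2}" by auto
  then have "(\<Sum>l=1..2*n+2. eps n l * u l * v (bar n l)) =
    (\<Sum>l=1..n+1. eps n l * u l * v (bar n l)) + (\<Sum>l=n+2..2*n+2. eps n l * u l * v (bar n l))"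
    by (simp add: sum.union_disjoint)
  also have "(\<Sum>l=1..n+1. eps n l * u l * v (bar n l)) = (\<Sum>l=1..n+1. u l * v (bar n l))"
    by (intro sum.cong) (auto simp: eps_def)
  also have "(\<Sum>l=n+2..2*n+2. eps n l * u l * v (bar n l)) = (\<Sum>l=1..n+1. - (u (bar n l) * v l))"
    by (rule sum.reindex_bij_witness[of _ "bar n" "bar n"]) (auto simp: bar_def eps_def)
  finally show ?thesis by (simp add: omega_def sum_subtractf sum_negf)
qed

lemma omega_linear:
  "omega n (u + u') v = omega n u v + omega n u' v" "omega n u (v + v') = omega n u v + omega n u v'"
  "omega n (u - u') v = omega n u v - omega n u' v" "omega n u (v - v') = omega n u v - omega n u v'"
  "omega n (cscale c u) v = c * omega n u v" "omega n u (cscale c v) = c * omega n u v"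
  "omega n 0 v = 0" "omega n u 0 = 0"
  by (simp_all add: omega_eq cscale_def algebra_simps sum.distrib sum_subtractf sum_distrib_left)

lemma omega_sum:
  "omega n (\<Sum>a\<in>A. f a) v = (\<Sum>a\<in>A. omega n (f a) v)"
  "omega n u (\<Sum>a\<in>A. f a) = (\<Sum>a\<in>A. omega n u (f a))"
  by (induction A rule: infinite_finite_induct) (auto simp: omega_linear)

lemma omega_self: "omega n u u = 0"
  using omega_skew[of n u u] by simp

lemma omega_span_zero:
  assumes "\<And>u v. u \<in> S \<Longrightarrow> v \<in> S \<Longrightarrow> omega n u v = 0" "u \<in> cvec.span S" "v \<in> cvec.span S"
  shows "omega n u v = 0"
proof -
  have sub: "cvec.subspace {u. omega n u v = 0}" "cvec.subspace {u. omega n v u = 0}" for v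
    by (auto simp: cvec.subspace_def omega_linear)
  have "cvec.span S \<subseteq> {u. omega n u v = 0}" if "v \<in> S" for v
    using assms(1) that by (intro cvec.span_minimal sub) auto
  then have "S \<subseteq> {v. omega n u v = 0}" using assms(2) by auto
  then have "cvec.span S \<subseteq> {v. omega n u v = 0}" by (intro cvec.span_minimal sub)
  then show ?thesis using assms(3) by auto
qed

lemma IG_D:
  assumes "V \<in> IG n k"
  shows "cvec.subspace V" "V \<subseteq> E n" "cvec.dim V = k" "\<And>u v. u \<in> V \<Longrightarrow> v \<in> V \<Longrightarrow> omega n u v = 0"
  using assms by (auto simp: IG_def)

lemma card_jumps_IG: "V \<in> IG n k \<Longrightarrow> card (jumps V) = k"
  using card_jumps IG_D by metis

text \<open>If \<open>i\<close> and \<open>bar n i\<close> were both leading indices, the pairing of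
  the two reduced vectors would shrink to its term at \<open>i\<close>: larger \<open>l\<close> are
  killed by \<open>u\<close>, smaller ones by \<open>v\<close>.\<close>

lemma isotropic_jumps:
  assumes "V \<in> IG n k"
  shows "isotropic_set n (jumps V)"
  unfolding isotropic_set_def
proof (intro conjI ballI notI)
  note V = IG_D[OF assms]
  show sub: "jumps V \<subseteq> {1..2 * n + 1}" using V(2) by (rule jumps_subset)
  fix i assume i: "i \<in> jumps V" "bar n i \<in> jumps V"
  define u v where "u = red V i" and "v = red V (bar n i)"
  have u: "u \<in> V" "u i = 1" "\<And>l. l > i \<Longrightarrow> u l = 0"
    and v: "v \<in> V" "v (bar n i) = 1" "\<And>l. l > bar n i \<Longrightarrow> v l = 0"
    using red[OF V(1,2) i(1)] red[OF V(1,2) i(2)] by (auto simp: u_def v_def reduced_at_def)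
  have ib: "i \<in> {1..2*n+2}" using sub i by auto
  have "omega n u v = (\<Sum>l=1..2*n+2. if l = i then eps n i else 0)"
    unfolding omega_eq
  proof (rule sum.cong[OF refl])
    fix l assume l: "l \<in> {1..2*n+2}"
    show "eps n l * u l * v (bar n l) = (if l = i then eps n i else 0)"
      using u v l ib by (cases l i rule: linorder_cases) (auto simp: bar_def)
  qed
  also have "\<dots> = eps n i" using ib by simp
  finally show False using V(4)[OF u(1) v(1)] by (simp add: eps_square)
qed

text \<open>The places where rows with pivots \<open>i\<close> and \<open>i'\<close> can contribute
  to their pairing without involving a pivot of \<open>J\<close> on either side.\<close>

definition mid :: "nat \<Rightarrow> nat set \<Rightarrow> nat \<Rightarrow> nat \<Rightarrow> nat set" where
  "mid n J i i' = {l \<in> {1..2 * n + 2}. l \<notin> J \<and> bar n l \<notin> J \<and> l < i \<and> bar n l < i'}"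

text \<open>A non-zero term needs \<open>l \<le> i\<close> and \<open>bar n l \<le> i'\<close>,
  hence \<open>2 * n + 3 \<le> i + i'\<close>, and isotropy excludes equality. Beyond that bound
  only the two terms at the own pivots \<open>l = i\<close> and \<open>bar n l = i'\<close> survive
  next to \<open>mid\<close>.\<close>

lemma omega_reduced:
  assumes J: "isotropic_set n J" and i: "i \<in> J" "i' \<in> J" "i < i'"
    and u: "reduced_at J i u" and v: "reduced_at J i' v"
  shows "i + i' \<le> 2 * n + 3 \<Longrightarrow> omega n u v = 0"
    and "2 * n + 3 < i + i' \<Longrightarrow> omega n u v = eps n i * v (bar n i) + eps n (bar n i') * u (bar n i')
      + (\<Sum>l\<in>mid n J i i'. eps n l * u l * v (bar n l))"
proof -
  note D = isotropic_setD[OF J]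
  have b: "1 \<le> i" "i \<le> 2 * n + 1" "1 \<le> i'" "i' \<le> 2 * n + 1" "bar n i \<notin> J" "bar n i' \<notin> J"
    using D[OF i(1)] D[OF i(2)] by auto
  have zero: "eps n l * u l * v (bar n l) = 0"
    if l: "l \<in> {1..2*n+2}" and "l > i \<or> bar n l > i' \<or> (l \<in> J \<and> l \<noteq> i) \<or> (bar n l \<in> J \<and> bar n l \<noteq> i')" for l
    using that u v by (auto simp: reduced_at_def)
  show "omega n u v = 0" if le: "i + i' \<le> 2 * n + 3"
  proof -
    have "i' \<noteq> bar n i" using b i by auto
    then have "i + i' \<noteq> 2 * n + 3" by (auto simp: bar_def)
    then show ?thesis unfolding omega_eq using le
      by (intro sum.neutral ballI zero) (auto simp: bar_def)
  qed
  assume gt: "2 * n + 3 < i + i'"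
  have nm: "i \<notin> mid n J i i'" "bar n i' \<notin> mid n J i i'" "i \<noteq> bar n i'" "finite (mid n J i i')"
    using i b by (auto simp: mid_def bar_bar)
  have "omega n u v = (\<Sum>l\<in>insert i (insert (bar n i') (mid n J i i')). eps n l * u l * v (bar n l))"
    unfolding omega_eq
  proof (rule sum.mono_neutral_right)
    show "insert i (insert (bar n i') (mid n J i i')) \<subseteq> {1..2 * n + 2}"
      using b by (auto simp: mid_def bar_def)
    show "\<forall>l\<in>{1..2 * n + 2} - insert i (insert (bar n i') (mid n J i i')). eps n l * u l * v (bar n l) = 0"
    proof (intro ballI zero)
      fix l assume l: "l \<in> {1..2 * n + 2} - insert i (insert (bar n i') (mid n J i i'))"
      then show "l \<in> {1..2 * n + 2}" by simp
      have "bar n l \<noteq> i'" using l by (auto simp: bar_bar)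
      then show "l > i \<or> bar n l > i' \<or> (l \<in> J \<and> l \<noteq> i) \<or> (bar n l \<in> J \<and> bar n l \<noteq> i')"
        using l by (auto simp: mid_def)
    qed
  qed simp
  also have "\<dots> = eps n i * v (bar n i) + eps n (bar n i') * u (bar n i')
      + (\<Sum>l\<in>mid n J i i'. eps n l * u l * v (bar n l))"
    using nm u v b by (simp add: reduced_at_def bar_bar)
  finally show "omega n u v = eps n i * v (bar n i) + eps n (bar n i') * u (bar n i')
      + (\<Sum>l\<in>mid n J i i'. eps n l * u l * v (bar n l))" .
qed

text \<open>The general element of the Schubert cell of \<open>J\<close> in reduced echelon form. The entries at
  \<^term>\<open>cell_params n J\<close> are free; the entry of row \<open>i\<close> in column \<open>p\<close> with \<open>bar n p \<in> J\<close> and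
  \<open>bar n p > i\<close> is the one determined by the orthogonality of the rows \<open>i\<close> and \<open>bar n p\<close>.\<close>

definition cell_row :: "nat \<Rightarrow> nat set \<Rightarrow> (nat \<times> nat \<Rightarrow> complex) \<Rightarrow> nat \<Rightarrow> cvec" where
  "cell_row n J c i p = (if p = i then 1 else if p \<in> J \<or> p > i \<or> p = 0 then 0
     else if bar n p \<in> J \<and> bar n p > i
     then - eps n p * (eps n i * c (bar n p, bar n i)
       + (\<Sum>l\<in>mid n J i (bar n p). eps n l * c (i, l) * c (bar n p, bar n l)))
     else c (i, p))"

lemma reduced_row: "reduced_at J i (cell_row n J c i)"
  by (auto simp: reduced_at_def cell_row_def)

lemma row_in_E: "isotropic_set n J \<Longrightarrow> i \<in> J \<Longrightarrow> cell_row n J c i \<in> E n"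
  using isotropic_setD[of n J i] by (auto simp: E_def cell_row_def)

lemma row_free: "(i, p) \<in> cell_params n J \<Longrightarrow> cell_row n J c i p = c (i, p)"
  by (auto simp: cell_params_def cell_row_def)

text \<open>For \<open>i < i'\<close> the equation involves a single dependent entry, in row
  \<open>i\<close> and column \<open>bar n i'\<close>, which was defined as its solution. The other
  entries lie in columns conjugate to no pivot or, in row \<open>i'\<close>, to the smaller pivot
  \<open>i\<close>, and are free.\<close>

lemma omega_rows:
  assumes J: "isotropic_set n J" and i: "i \<in> J" "i' \<in> J"
  shows "omega n (cell_row n J c i) (cell_row n J c i') = 0"
proof -
  have *: "omega n (cell_row n J c i) (cell_row n J c i') = 0" if i: "i \<in> J" "i' \<in> J" "i < i'" for i i'
  proof (cases "i + i' \<le> 2 * n + 3")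
    case True
    then show ?thesis using omega_reduced(1)[OF J i reduced_row reduced_row] by simp
  next
    case False
    have b: "1 \<le> i" "i \<le> 2 * n + 1" "1 \<le> i'" "i' \<le> 2 * n + 1" "bar n i \<notin> J" "bar n i' \<notin> J"
      using isotropic_setD[OF J i(1)] isotropic_setD[OF J i(2)] by auto
    have "cell_row n J c i' (bar n i) = c (i', bar n i)"
      using False b i by (auto simp: cell_row_def bar_bar) (auto simp: bar_def)
    moreover have "cell_row n J c i (bar n i') = - eps n (bar n i') * (eps n i * c (i', bar n i)
       + (\<Sum>l\<in>mid n J i i'. eps n l * c (i, l) * c (i', bar n l)))"
      using False b i by (auto simp: cell_row_def bar_bar) (auto simp: bar_def)
    moreover have "(\<Sum>l\<in>mid n J i i'. eps n l * cell_row n J c i l * cell_row n J c i' (bar n l)) =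
        (\<Sum>l\<in>mid n J i i'. eps n l * c (i, l) * c (i', bar n l))"
    proof (rule sum.cong[OF refl])
      fix l assume l: "l \<in> mid n J i i'"
      then have "cell_row n J c i l = c (i, l)" "cell_row n J c i' (bar n l) = c (i', bar n l)"
        by (auto simp: mid_def cell_row_def bar_bar) (auto simp: bar_def)
      then show "eps n l * cell_row n J c i l * cell_row n J c i' (bar n l) = eps n l * c (i, l) * c (i', bar n l)"
        by simp
    qed
    ultimately show ?thesis
      using omega_reduced(2)[OF J i reduced_row[of J i n c] reduced_row[of J i' n c]] False
      by (simp add: eps_square mult.assoc)
  qed
  show ?thesis
    using *[of i i'] *[of i' i] i omega_skew[of n "cell_row n J c i" "cell_row n J c i'"]
    by (cases i i' rule: linorder_cases) (auto simp: omega_self)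
qed

lemma span_rows_IG:
  assumes J: "isotropic_set n J" "card J = k"
  shows "cvec.span (cell_row n J c ` J) \<in> IG n k"
proof -
  have "cvec.span (cell_row n J c ` J) \<subseteq> E n"
    using row_in_E[OF J(1)] by (intro cvec.span_minimal subspace_E) auto
  moreover have "cvec.dim (cvec.span (cell_row n J c ` J)) = k"
    using dim_span_reduced[OF isotropic_set_finite[OF J(1)] J(2) reduced_row] .
  moreover have "\<forall>u\<in>cvec.span (cell_row n J c ` J). \<forall>v\<in>cvec.span (cell_row n J c ` J). omega n u v = 0"
  proof (intro ballI)
    fix u v assume "u \<in> cvec.span (cell_row n J c ` J)" "v \<in> cvec.span (cell_row n J c ` J)"
    then show "omega n u v = 0"
      by (rule omega_span_zero[rotated]) (use omega_rows[OF J(1)] in auto)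
  qed
  ultimately show ?thesis by (simp add: IG_def cvec.subspace_span)
qed

text \<open>The converse of \<open>span_rows_IG\<close>: isotropy of \<open>V\<close> forces the
  dependent entries of its reduced basis, so the cells exhaust \<open>IG n k\<close>.\<close>

lemma red_eq_row:
  assumes V: "V \<in> IG n k" and i: "i \<in> jumps V"
  shows "red V i = cell_row n (jumps V) (\<lambda>(i, p). red V i p) i"
proof
  fix p
  note VD = IG_D[OF V]
  note J = isotropic_jumps[OF V]
  note r = red[OF VD(1,2)]
  have ri: "red V i \<in> V" "reduced_at (jumps V) i (red V i)" using r i by auto
  show "red V i p = cell_row n (jumps V) (\<lambda>(i, p). red V i p) i p"
  proof (cases "p \<noteq> i \<and> p \<notin> jumps V \<and> p \<noteq> 0 \<and> p < i \<and> bar n p \<in> jumps V \<and> bar n p > i")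
    case False
    have "red V i 0 = 0" using ri(1) VD(2) by (auto simp: E_def)
    then show ?thesis using False ri(2) by (auto simp: cell_row_def reduced_at_def)
  next
    case True
    define i' where "i' = bar n p"
    have b: "i \<le> 2 * n + 1" using isotropic_setD[OF J i] by simp
    have p: "p = bar n i'" using True b by (simp add: i'_def bar_bar)
    have i': "i' \<in> jumps V" "i < i'" "2 * n + 3 < i + i'"
      using True b by (auto simp: i'_def bar_def)
    have "0 = eps n i * red V i' (bar n i) + eps n (bar n i') * red V i (bar n i')
      + (\<Sum>l\<in>mid n (jumps V) i i'. eps n l * red V i l * red V i' (bar n l))"
      using omega_reduced(2)[OF J i i'(1,2) ri(2) r(2)[OF i'(1)] i'(3)] VD(4)[OF ri(1) r(1)[OF i'(1)]]
      by simp
    then have *: "eps n p * red V i p = - (eps n i * red V i' (bar n i)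
      + (\<Sum>l\<in>mid n (jumps V) i i'. eps n l * red V i l * red V i' (bar n l)))"
      unfolding p by (simp add: eq_neg_iff_add_eq_0 algebra_simps)
    have "eps n p * (eps n p * red V i p) = - eps n p * (eps n i * red V i' (bar n i)
      + (\<Sum>l\<in>mid n (jumps V) i i'. eps n l * red V i l * red V i' (bar n l)))"
      by (simp only: * mult_minus_left mult_minus_right)
    then show ?thesis using True by (simp add: cell_row_def eps_square i'_def)
  qed
qed


section \<open>Pluecker coordinates and the Zariski topology\<close>

text \<open>A minor for an arbitrary sequence of columns, unsorted or with repetitions, as
  multilinear expansion and column replacement produce them.\<close>

definition tdet :: "nat \<Rightarrow> (nat \<Rightarrow> cvec) \<Rightarrow> (nat \<Rightarrow> nat) \<Rightarrow> complex" where
  "tdet k b t = det (mat k k (\<lambda>(r, c). b r (t c)))"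

lemma minor_tdet: "minor n k b I =
    (if I \<subseteq> {1..2 * n + 1} \<and> card I = k then tdet k b (\<lambda>c. sorted_list_of_set I ! c) else 0)"
  by (simp add: minor_def tdet_def)

lemma det_permute_cols:
  fixes A :: "'a :: comm_ring_1 mat"
  assumes A: "A \<in> carrier_mat k k" and p: "p permutes {0..<k}"
  shows "det (mat k k (\<lambda>(r, c). A $$ (r, p c))) = signof p * det A"
proof -
  have "det (mat k k (\<lambda>(r, c). A $$ (r, p c))) = det (transpose_mat (mat k k (\<lambda>(r, c). A $$ (r, p c))))"
    by (subst det_transpose[of _ k]) auto
  also have "transpose_mat (mat k k (\<lambda>(r, c). A $$ (r, p c))) =
      mat k k (\<lambda>(r, c). transpose_mat A $$ (p r, c))"
  proof (rule eq_matI)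
    fix i j assume "i < dim_row (mat k k (\<lambda>(r, c). transpose_mat A $$ (p r, c)))"
      "j < dim_col (mat k k (\<lambda>(r, c). transpose_mat A $$ (p r, c)))"
    moreover from this have "p i < k" using permutes_in_image[OF p, of i] by simp
    ultimately show "transpose_mat (mat k k (\<lambda>(r, c). A $$ (r, p c))) $$ (i, j) =
        mat k k (\<lambda>(r, c). transpose_mat A $$ (p r, c)) $$ (i, j)"
      using A by simp
  qed auto
  also have "det \<dots> = signof p * det (transpose_mat A)"
    using A p by (intro det_permute_rows) auto
  also have "det (transpose_mat A) = det A"
    using A by (rule det_transpose)
  finally show ?thesis .
qed

text \<open>The factor is 0 for repeated columns and the sign of the sorting permutation otherwise.
  It depends on \<open>t\<close> only and is thus fixed before the basis \<open>b\<close>.\<close>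

lemma tdet_eq_minor:
  assumes "\<And>c. c < k \<Longrightarrow> t c \<in> {1..2 * n + 1}"
  shows "\<exists>e. \<forall>b. tdet k b t = e * minor n k b (t ` {..<k})"
proof (cases "inj_on t {..<k}")
  case False
  then obtain c c' where c: "c < k" "c' < k" "c \<noteq> c'" "t c = t c'"
    by (auto simp: inj_on_def)
  have "tdet k b t = 0" for b
    unfolding tdet_def using c
    by (intro det_identical_columns[of _ k c c']) (auto intro!: eq_vecI)
  then show ?thesis by (intro exI[of _ 0]) simp
next
  case True
  define I where "I = t ` {..<k}"
  have I: "I \<subseteq> {1..2 * n + 1}" "card I = k" "finite I"
    using assms True by (auto simp: I_def card_image)
  define s where "s c = sorted_list_of_set I ! c" for c
  have s: "bij_betw s {..<k} I"
    unfolding bij_betw_def s_def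
    using image_nth_sorted[OF I(3,2)] nth_sorted_eq_iff[OF I(3,2)] by (auto simp: inj_on_def)
  define p where "p c = (if c < k then inv_into {..<k} s (t c) else c)" for c
  have "bij_betw (inv_into {..<k} s \<circ> t) {..<k} {..<k}"
    using True by (intro bij_betw_trans[of _ _ I] bij_betw_inv_into s) (auto simp: bij_betw_def I_def)
  then have "bij_betw p {..<k} {..<k}"
    by (subst bij_betw_cong[of _ _ "inv_into {..<k} s \<circ> t"]) (auto simp: p_def)
  then have p: "p permutes {0..<k}"
    unfolding lessThan_atLeast0 by (rule bij_imp_permutes) (auto simp: p_def)
  have sp: "s (p c) = t c" if "c < k" for c
    using that s by (auto simp: p_def I_def bij_betw_def f_inv_into_f)
  have "tdet k b t = signof p * minor n k b I" for b
  proof -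
    let ?A = "mat k k (\<lambda>(r, c). b r (s c))"
    have "mat k k (\<lambda>(r, c). b r (t c)) = mat k k (\<lambda>(r, c). ?A $$ (r, p c))"
    proof (rule eq_matI)
      fix i j assume "i < dim_row (mat k k (\<lambda>(r, c). ?A $$ (r, p c)))"
        "j < dim_col (mat k k (\<lambda>(r, c). ?A $$ (r, p c)))"
      moreover from this have "p j < k" using permutes_in_image[OF p, of j] by simp
      ultimately show "mat k k (\<lambda>(r, c). b r (t c)) $$ (i, j) = mat k k (\<lambda>(r, c). ?A $$ (r, p c)) $$ (i, j)"
        using sp by simp
    qed auto
    then have "tdet k b t = signof p * det ?A"
      unfolding tdet_def by (simp only:) (rule det_permute_cols[OF _ p], simp)
    then show ?thesis using I by (simp add: minor_def s_def)
  qed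
  then show ?thesis unfolding I_def by blast
qed

lemma tdet_change:
  assumes "\<And>r. r < k \<Longrightarrow> b' r = (\<Sum>s<k. cscale (M r s) (b s))"
  shows "tdet k b' t = det (mat k k (\<lambda>(r, s). M r s)) * tdet k b t"
proof -
  have "mat k k (\<lambda>(r, c). b' r (t c)) = mat k k (\<lambda>(r, s). M r s) * mat k k (\<lambda>(r, c). b r (t c))"
    by (rule eq_matI)
       (auto simp: assms sum_fun_apply cscale_def scalar_prod_def lessThan_atLeast0)
  then show ?thesis
    unfolding tdet_def by (simp add: det_mult[of _ k])
qed

lemma span_coeffs:
  assumes "v \<in> cvec.span (b ` {..<k})"
  shows "\<exists>M. v = (\<Sum>s<k::nat. cscale (M s) (b s))"
proof -
  let ?S = "range (\<lambda>M. \<Sum>s<k. cscale (M s) (b s))"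
  have "cvec.subspace ?S"
    unfolding cvec.subspace_def
  proof (intro conjI ballI allI)
    show "0 \<in> ?S" by (rule image_eqI[of _ _ "\<lambda>_. 0"]) (auto simp: cscale_def fun_eq_iff sum_fun_apply)
    fix x y c assume "x \<in> ?S" "y \<in> ?S"
    then obtain M N where "x = (\<Sum>s<k. cscale (M s) (b s))" "y = (\<Sum>s<k. cscale (N s) (b s))" by auto
    then have "x + y = (\<Sum>s<k. cscale (M s + N s) (b s))" "cscale c x = (\<Sum>s<k. cscale (c * M s) (b s))"
      by (auto simp: fun_eq_iff sum_fun_apply cscale_def algebra_simps sum.distrib sum_distrib_left)
    then show "x + y \<in> ?S" and "cscale c x \<in> ?S" by auto
  qed
  moreover have "b ` {..<k} \<subseteq> ?S"
  proof safe
    fix s assume s: "s < k"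
    have "b s = (\<Sum>r<k. cscale (if r = s then 1 else 0) (b r))"
    proof
      fix x
      have "(\<Sum>r<k. (if r = s then 1 else 0) * b r x) = (\<Sum>r<k. if r = s then b s x else 0)"
        by (intro sum.cong) auto
      then show "b s x = (\<Sum>r<k. cscale (if r = s then 1 else 0) (b r)) x"
        using s by (simp add: sum_fun_apply cscale_def)
    qed
    then show "b s \<in> ?S" by (rule range_eqI[where x = "\<lambda>r. if r = s then 1 else 0"])
  qed
  ultimately have "cvec.span (b ` {..<k}) \<subseteq> ?S" by (rule cvec.span_minimal[rotated])
  then show ?thesis using assms by blast
qed

text \<open>The representative of the Pluecker point whose coordinate at the jump set is 1; it
  replaces the class of proportional vectors by one value.\<close>

definition plv :: "nat \<Rightarrow> nat \<Rightarrow> cvec set \<Rightarrow> nat set \<Rightarrow> complex" where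
  "plv n k V = minor n k (\<lambda>m. red V (sorted_list_of_set (jumps V) ! m))"

lemma minor_reduced_pivots:
  assumes J: "J \<subseteq> {1..2 * n + 1}" "card J = k" and r: "\<And>i. i \<in> J \<Longrightarrow> reduced_at J i (r i)"
  shows "minor n k (\<lambda>m. r (sorted_list_of_set J ! m)) J = 1"
proof -
  have fin: "finite J" using J(1) finite_subset by blast
  let ?s = "sorted_list_of_set J"
  have "mat k k (\<lambda>(m, c). r (?s ! m) (?s ! c)) = 1\<^sub>m k"
  proof (rule eq_matI)
    fix i j assume "i < dim_row (1\<^sub>m k :: complex mat)" "j < dim_col (1\<^sub>m k :: complex mat)"
    then have ij: "i < k" "j < k" by auto
    then show "mat k k (\<lambda>(m, c). r (?s ! m) (?s ! c)) $$ (i, j) = 1\<^sub>m k $$ (i, j)"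
      using nth_sorted_mem[OF fin J(2)] nth_sorted_eq_iff[OF fin J(2), of j i] r[of "?s ! i"]
      by (auto simp: reduced_at_def)
  qed auto
  then show ?thesis using J by (simp add: minor_def)
qed

context
  fixes n k V assumes V: "V \<in> IG n k"
begin

lemma plv_jumps: "plv n k V (jumps V) = 1"
  unfolding plv_def using isotropic_jumps[OF V] card_jumps_IG[OF V] red(2)[OF IG_D(1,2)[OF V]]
  by (intro minor_reduced_pivots) (auto simp: isotropic_set_def)

lemma span_red_nth: "cvec.span ((\<lambda>m. red V (sorted_list_of_set (jumps V) ! m)) ` {..<k}) = V"
proof -
  have "(\<lambda>m. red V (sorted_list_of_set (jumps V) ! m)) ` {..<k} = red V ` jumps V"
    using image_nth_sorted[OF finite_jumps[OF IG_D(1,2)[OF V]] card_jumps_IG[OF V]] by (metis image_image)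
  then show ?thesis using span_red[OF IG_D(1,2)[OF V]] by simp
qed

lemma plv_in: "plv n k V \<in> plucker_coords n k V"
  unfolding plucker_coords_def plv_def using span_red_nth by blast

lemma minor_proportional:
  assumes "cvec.span (b ` {..<k}) = V" "cvec.span (b' ` {..<k}) = V"
  shows "\<exists>t\<noteq>0. \<forall>\<tau>. tdet k b' \<tau> = t * tdet k b \<tau>"
proof -
  have *: "\<exists>t. \<forall>\<tau>. tdet k b' \<tau> = t * tdet k b \<tau>"
    if "cvec.span (b ` {..<k}) = V" "cvec.span (b' ` {..<k}) = V" for b b' :: "nat \<Rightarrow> cvec"
  proof -
    have "b' r \<in> cvec.span (b ` {..<k})" if "r < k" for r
      using \<open>cvec.span (b' ` {..<k}) = V\<close> \<open>cvec.span (b ` {..<k}) = V\<close> that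
      by (metis cvec.span_base image_eqI lessThan_iff)
    then have "\<exists>M. \<forall>r\<in>{..<k}. b' r = (\<Sum>s<k. cscale (M r s) (b s))"
      by (intro bchoice) (use span_coeffs in blast)
    then show ?thesis using tdet_change by (metis lessThan_iff)
  qed
  let ?r = "\<lambda>m. red V (sorted_list_of_set (jumps V) ! m)"
  obtain t t' u where t: "\<And>\<tau>. tdet k b' \<tau> = t * tdet k b \<tau>" "\<And>\<tau>. tdet k b \<tau> = t' * tdet k b' \<tau>"
    and u: "\<And>\<tau>. tdet k ?r \<tau> = u * tdet k b' \<tau>"
    using *[OF assms] *[OF assms(2,1)] *[OF assms(2) span_red_nth] by metis
  have "\<exists>\<tau>. tdet k ?r \<tau> = 1"
    using plv_jumps isotropic_jumps[OF V] card_jumps_IG[OF V] unfolding plv_def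
    by (metis minor_tdet isotropic_set_def)
  then have "t \<noteq> 0" using t(1) u by auto
  then show ?thesis using t by blast
qed

lemma plucker_proportional:
  assumes "x \<in> plucker_coords n k V"
  shows "\<exists>t\<noteq>0. x = (\<lambda>I. t * plv n k V I)"
proof -
  obtain b where b: "x = minor n k b" "cvec.span (b ` {..<k}) = V"
    using assms by (auto simp: plucker_coords_def)
  obtain t where t: "t \<noteq> 0"
    "\<And>\<tau>. tdet k b \<tau> = t * tdet k (\<lambda>m. red V (sorted_list_of_set (jumps V) ! m)) \<tau>"
    using minor_proportional[OF span_red_nth b(2)] by blast
  have "x I = t * plv n k V I" for I
    using t(2) by (simp add: b plv_def minor_tdet)
  then show ?thesis using t(1) by blast
qed

end

lemma hom_poly_scale: "hom_poly d F \<Longrightarrow> F (\<lambda>I. t * x I) = t ^ d * F x"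
  by (induction rule: hom_poly.induct) (auto simp: algebra_simps power_add)

lemma hom_poly_nonzero_iff:
  assumes "V \<in> IG n k" "hom_poly d F" "x \<in> plucker_coords n k V"
  shows "F x = 0 \<longleftrightarrow> F (plv n k V) = 0"
  using plucker_proportional[OF assms(1,3)] hom_poly_scale[OF assms(2)] by auto

lemma zariski_basis:
  assumes "hom_poly d F"
  shows "{V \<in> IG n k. \<exists>x\<in>plucker_coords n k V. F x \<noteq> 0} = {V \<in> IG n k. F (plv n k V) \<noteq> 0}"
  using hom_poly_nonzero_iff[OF _ assms] plv_in by blast

lemma openin_zariski_basic: "hom_poly d F \<Longrightarrow> openin (zariski n k) {V \<in> IG n k. F (plv n k V) \<noteq> 0}"
  unfolding zariski_def openin_topology_generated_by_iff
  by (rule generate_topology_on.Basis) (use zariski_basis in blast)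

lemma topspace_zariski: "topspace (zariski n k) = IG n k"
proof
  show "topspace (zariski n k) \<subseteq> IG n k"
    unfolding zariski_def topology_generated_by_topspace by auto
  show "IG n k \<subseteq> topspace (zariski n k)"
    using openin_subset[OF openin_zariski_basic[OF hom_poly.const[of 1]]] by auto
qed

text \<open>The generating sets already form a base, since the product of two forms cuts out the
  intersection of their sets.\<close>

lemma zariski_open_contains_basic:
  assumes "openin (zariski n k) U" "V \<in> U"
  shows "\<exists>d F. hom_poly d F \<and> F (plv n k V) \<noteq> 0 \<and> {W \<in> IG n k. F (plv n k W) \<noteq> 0} \<subseteq> U"
proof -
  have "generate_topology_on {{V \<in> IG n k. \<exists>x\<in>plucker_coords n k V. F x \<noteq> 0} | F d. hom_poly d F} U"
    using assms(1) by (simp add: zariski_def openin_topology_generated_by_iff)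
  then show ?thesis using assms(2)
  proof (induction arbitrary: V)
    case (Int a b)
    then have V: "V \<in> a" "V \<in> b" by auto
    obtain d F where "hom_poly d F" "F (plv n k V) \<noteq> 0" "{W \<in> IG n k. F (plv n k W) \<noteq> 0} \<subseteq> a"
      using Int.IH(1)[OF V(1)] by blast
    moreover obtain e G where "hom_poly e G" "G (plv n k V) \<noteq> 0" "{W \<in> IG n k. G (plv n k W) \<noteq> 0} \<subseteq> b"
      using Int.IH(2)[OF V(2)] by blast
    ultimately show ?case
      by (intro exI[of _ "d + e"] exI[of _ "\<lambda>x. F x * G x"]) (auto intro: hom_poly.mult)
  next
    case (UN K)
    then obtain U where "U \<in> K" "V \<in> U" by blast
    then show ?case using UN.IH[of U V] by blast
  next
    case (Basis s)
    then show ?case using zariski_basis[of _ _ n k] by blast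
  qed auto
qed

lemma closedin_zariski_zero: "hom_poly d F \<Longrightarrow> closedin (zariski n k) {V \<in> IG n k. F (plv n k V) = 0}"
proof -
  assume F: "hom_poly d F"
  have "IG n k - {V \<in> IG n k. F (plv n k V) = 0} = {V \<in> IG n k. F (plv n k V) \<noteq> 0}" by auto
  then show ?thesis using openin_zariski_basic[OF F, of n k] by (simp add: closedin_def topspace_zariski)
qed

lemma closed_separation:
  assumes "closedin (subtopology (zariski n k) S) Z" "V \<in> S" "V \<in> IG n k" "V \<notin> Z"
  obtains d F where "hom_poly d F" "F (plv n k V) \<noteq> 0" "\<And>W. W \<in> Z \<Longrightarrow> F (plv n k W) = 0"
proof -
  obtain C where C: "closedin (zariski n k) C" "Z = C \<inter> S"
    using assms(1) by (auto simp: closedin_subtopology)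
  then have "openin (zariski n k) (IG n k - C)" "V \<in> IG n k - C" "Z \<subseteq> IG n k"
    using assms by (auto simp: closedin_def topspace_zariski)
  then show ?thesis using zariski_open_contains_basic[of n k "IG n k - C" V] C that by blast
qed

lemma zariski_closure_zero:
  assumes "hom_poly d F" "\<And>W. W \<in> S \<Longrightarrow> W \<in> IG n k \<Longrightarrow> F (plv n k W) = 0" "V \<in> zariski n k closure_of S"
  shows "F (plv n k V) = 0"
proof -
  have "(zariski n k closure_of (IG n k \<inter> S)) \<subseteq> {V \<in> IG n k. F (plv n k V) = 0}"
    using assms(2) by (intro closure_of_minimal closedin_zariski_zero[OF assms(1)]) auto
  then show ?thesis
    using assms(3) closure_of_restrict[of "zariski n k" S] by (auto simp: topspace_zariski)
qed

text \<open>The homogeneous coordinate ring of an irreducible set has no zero divisors. The upper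
  bound uses the splitting property of irreducible sets only in this shape.\<close>

lemma irreducible_product:
  assumes Z: "irreducible_closed (subtopology (zariski n k) S) Z" and S: "S \<subseteq> IG n k"
    and F: "hom_poly d F" "hom_poly e G" and "\<And>V. V \<in> Z \<Longrightarrow> F (plv n k V) * G (plv n k V) = 0"
  shows "(\<forall>V\<in>Z. F (plv n k V) = 0) \<or> (\<forall>V\<in>Z. G (plv n k V) = 0)"
proof -
  let ?A = "\<lambda>F. {V \<in> IG n k. F (plv n k V) = 0} \<inter> S"
  have ZS: "Z \<subseteq> S" using Z by (metis closedin_subset irreducible_closed_def topspace_subtopology le_inf_iff)
  have "closedin (subtopology (zariski n k) S) (?A F)" "closedin (subtopology (zariski n k) S) (?A G)"
    unfolding closedin_subtopology using closedin_zariski_zero[of _ _ n k] F by blast+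
  moreover have "Z \<subseteq> ?A F \<union> ?A G" using assms(5) ZS S by auto
  ultimately have "Z \<subseteq> ?A F \<or> Z \<subseteq> ?A G" using Z unfolding irreducible_closed_def by blast
  then show ?thesis by blast
qed


section \<open>The upper bound for the dimension\<close>

lemma nontrivial_relation:
  fixes A :: "'i \<Rightarrow> 'j \<Rightarrow> complex"
  assumes "finite Y" "finite X" "card Y < card X"
  shows "\<exists>c. (\<exists>i\<in>X. c i \<noteq> 0) \<and> (\<forall>j\<in>Y. (\<Sum>i\<in>X. c i * A i j) = 0)"
  using assms
proof (induction Y arbitrary: X A rule: finite_induct)
  case empty
  then have "X \<noteq> {}" by auto
  then show ?case by (intro exI[of _ "\<lambda>_. 1"]) auto
next
  case (insert y Y)
  show ?case
  proof (cases "\<forall>i\<in>X. A i y = 0")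
    case True
    obtain c where "\<exists>i\<in>X. c i \<noteq> 0" "\<forall>j\<in>Y. (\<Sum>i\<in>X. c i * A i j) = 0"
      using insert.IH[of X A] insert.prems insert.hyps by auto
    then show ?thesis using True by (intro exI[of _ c]) auto
  next
    case False
    then obtain q where q: "q \<in> X" "A q y \<noteq> 0" by blast
    define X' where "X' = X - {q}"
    have X': "finite X'" "card Y < card X'" "X = insert q X'" "q \<notin> X'"
      using insert.prems insert.hyps q by (auto simp: X'_def)
    obtain c where c: "\<exists>i\<in>X'. c i \<noteq> 0"
      "\<And>j. j \<in> Y \<Longrightarrow> (\<Sum>i\<in>X'. c i * (A i j - A i y / A q y * A q j)) = 0"
      using insert.IH[OF X'(1,2), of "\<lambda>i j. A i j - A i y / A q y * A q j"] by blast
    define c' where "c' = c(q := - (\<Sum>i\<in>X'. c i * A i y) / A q y)"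
    have sum: "(\<Sum>i\<in>X. c' i * A i j) = (\<Sum>i\<in>X'. c i * (A i j - A i y / A q y * A q j))" for j
    proof -
      have "(\<Sum>i\<in>X. c' i * A i j) = c' q * A q j + (\<Sum>i\<in>X'. c i * A i j)"
        unfolding X'(3) using X' by (auto simp: c'_def intro!: sum.cong)
      also have "\<dots> = (\<Sum>i\<in>X'. c i * A i j) - (\<Sum>i\<in>X'. c i * A i y * (A q j / A q y))"
        by (simp add: c'_def sum_distrib_right sum_divide_distrib)
      also have "\<dots> = (\<Sum>i\<in>X'. c i * (A i j - A i y / A q y * A q j))"
        by (simp add: sum_subtractf[symmetric] algebra_simps)
      finally show ?thesis .
    qed
    have "(\<Sum>i\<in>X. c' i * A i j) = 0" if "j \<in> insert y Y" for j
      using that c(2) q(2) by (auto simp: sum)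
    moreover have "\<exists>i\<in>X. c' i \<noteq> 0" using c(1) X' by (auto simp: c'_def)
    ultimately show ?thesis by blast
  qed
qed

text \<open>Polynomial functions with a bound on the exponent of each variable rather than on the
  total degree: the number of monomials is then simply \<open>(e + 1) ^ card P\<close>.\<close>

definition polys :: "'x set \<Rightarrow> nat \<Rightarrow> (('x \<Rightarrow> complex) \<Rightarrow> complex) \<Rightarrow> bool" where
  "polys P e h \<longleftrightarrow> (\<exists>a. \<forall>c. h c = (\<Sum>\<alpha>\<in>P \<rightarrow>\<^sub>E {..e}. a \<alpha> * (\<Prod>x\<in>P. c x ^ \<alpha> x)))"

context
  fixes P :: "'x set" assumes P: "finite P"
begin

lemma finite_exponents: "finite (P \<rightarrow>\<^sub>E {..e::nat})"
  using P by (intro finite_PiE) auto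

lemma polys_monomial:
  assumes "\<alpha> \<in> P \<rightarrow>\<^sub>E {..e}"
  shows "polys P e (\<lambda>c. a * (\<Prod>x\<in>P. c x ^ \<alpha> x))"
  unfolding polys_def
proof (intro exI allI)
  fix c :: "'x \<Rightarrow> complex"
  have "(\<Sum>\<beta>\<in>P \<rightarrow>\<^sub>E {..e}. (if \<beta> = \<alpha> then a else 0) * (\<Prod>x\<in>P. c x ^ \<beta> x)) =
      (\<Sum>\<beta>\<in>P \<rightarrow>\<^sub>E {..e}. if \<beta> = \<alpha> then a * (\<Prod>x\<in>P. c x ^ \<alpha> x) else 0)"
    by (intro sum.cong) auto
  then show "a * (\<Prod>x\<in>P. c x ^ \<alpha> x) = (\<Sum>\<beta>\<in>P \<rightarrow>\<^sub>E {..e}. (if \<beta> = \<alpha> then a else 0) * (\<Prod>x\<in>P. c x ^ \<beta> x))"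
    using assms finite_exponents by simp
qed

lemma polys_add: "polys P e f \<Longrightarrow> polys P e g \<Longrightarrow> polys P e (\<lambda>c. f c + g c)"
  unfolding polys_def
proof (elim exE)
  fix a b assume "\<forall>c. f c = (\<Sum>\<alpha>\<in>P \<rightarrow>\<^sub>E {..e}. a \<alpha> * (\<Prod>x\<in>P. c x ^ \<alpha> x))"
    "\<forall>c. g c = (\<Sum>\<alpha>\<in>P \<rightarrow>\<^sub>E {..e}. b \<alpha> * (\<Prod>x\<in>P. c x ^ \<alpha> x))"
  then show "\<exists>a. \<forall>c. f c + g c = (\<Sum>\<alpha>\<in>P \<rightarrow>\<^sub>E {..e}. a \<alpha> * (\<Prod>x\<in>P. c x ^ \<alpha> x))"
    by (intro exI[of _ "\<lambda>\<alpha>. a \<alpha> + b \<alpha>"]) (auto simp: algebra_simps sum.distrib)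
qed

lemma polys_const: "polys P e (\<lambda>c. a)"
  using polys_monomial[of "\<lambda>x\<in>P. 0" e a] by (simp add: PiE_iff)

lemma polys_coord: "x \<in> P \<Longrightarrow> polys P 1 (\<lambda>c. c x)"
proof -
  assume x: "x \<in> P"
  have "(\<Prod>y\<in>P. c y ^ (\<lambda>y\<in>P. if y = x then 1 else 0) y) = (\<Prod>y\<in>P. if y = x then c x else 1)" for c :: "'x \<Rightarrow> complex"
    by (intro prod.cong) auto
  then have "(\<Prod>y\<in>P. c y ^ (\<lambda>y\<in>P. if y = x then 1 else 0) y) = c x" for c :: "'x \<Rightarrow> complex"
    using x P by simp
  then show ?thesis using polys_monomial[of "\<lambda>y\<in>P. if y = x then 1 else 0" 1 1] by (simp add: PiE_iff)
qed

lemma polys_sum: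
  assumes "\<And>i. i \<in> A \<Longrightarrow> polys P e (f i)"
  shows "polys P e (\<lambda>c. \<Sum>i\<in>A. f i c)"
  using assms
  by (induction A rule: infinite_finite_induct) (auto intro: polys_add polys_const)

lemma polys_mult:
  assumes "polys P e f" "polys P e' g"
  shows "polys P (e + e') (\<lambda>c. f c * g c)"
proof -
  obtain a where a: "\<And>c. f c = (\<Sum>\<alpha>\<in>P \<rightarrow>\<^sub>E {..e}. a \<alpha> * (\<Prod>x\<in>P. c x ^ \<alpha> x))"
    using assms(1) by (auto simp: polys_def)
  obtain b where b: "\<And>c. g c = (\<Sum>\<alpha>\<in>P \<rightarrow>\<^sub>E {..e'}. b \<alpha> * (\<Prod>x\<in>P. c x ^ \<alpha> x))"
    using assms(2) by (auto simp: polys_def)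
  have "polys P (e + e') (\<lambda>c. \<Sum>\<alpha>\<in>P \<rightarrow>\<^sub>E {..e}. \<Sum>\<beta>\<in>P \<rightarrow>\<^sub>E {..e'}.
      (a \<alpha> * b \<beta>) * (\<Prod>x\<in>P. c x ^ (\<lambda>x\<in>P. \<alpha> x + \<beta> x) x))"
    by (intro polys_sum polys_monomial) (fastforce simp: PiE_iff intro: add_mono)
  moreover have "(\<Prod>x\<in>P. c x ^ (\<lambda>x\<in>P. \<alpha> x + \<beta> x) x) = (\<Prod>x\<in>P. c x ^ \<alpha> x) * (\<Prod>x\<in>P. c x ^ \<beta> x)"
    for \<alpha> \<beta> :: "'x \<Rightarrow> nat" and c :: "'x \<Rightarrow> complex"
    by (simp add: prod.distrib[symmetric] power_add)
  ultimately show ?thesis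
    by (simp add: a b sum_product algebra_simps)
qed

lemma polys_mono:
  assumes "polys P e f" "e \<le> e'"
  shows "polys P e' f"
  using polys_mult[OF assms(1) polys_const[of "e' - e" 1]] assms(2) by simp

lemma polys_prod:
  assumes "finite A" "\<And>i. i \<in> A \<Longrightarrow> polys P e (f i)"
  shows "polys P (card A * e) (\<lambda>c. \<Prod>i\<in>A. f i c)"
  using assms
proof (induction A rule: finite_induct)
  case (insert i A)
  then have "polys P (e + card A * e) (\<lambda>c. f i c * (\<Prod>i\<in>A. f i c))"
    by (intro polys_mult) auto
  then show ?case using insert.hyps by simp
qed (simp add: polys_const)

lemma polys_hom_poly:
  assumes "hom_poly d F" "\<And>I. polys P e (\<lambda>c. x c I)"
  shows "polys P (d * e) (\<lambda>c. F (x c))"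
  using assms(1)
proof (induction rule: hom_poly.induct)
  case (coord i)
  then show ?case using assms(2) by simp
next
  case (mult d p d' q)
  then show ?case
    using polys_mult[of "d * e" "\<lambda>c. p (x c)" "d' * e" "\<lambda>c. q (x c)"] by (simp add: add_mult_distrib)
qed (auto intro: polys_const polys_add)

lemma polys_minor:
  assumes "\<And>m p. m < k \<Longrightarrow> polys P e (\<lambda>c. b c m p)"
  shows "polys P (k * e) (\<lambda>c. minor n k (b c) I)"
proof (cases "I \<subseteq> {1..2 * n + 1} \<and> card I = k")
  case True
  have "polys P (k * e) (\<lambda>c. \<Sum>p\<in>{p. p permutes {0..<k}}. signof p *
      (\<Prod>i\<in>{0..<k}. b c i (sorted_list_of_set I ! p i)))"
  proof (intro polys_sum)
    fix p
    have "polys P (0 + card {0..<k} * e) (\<lambda>c. signof p * (\<Prod>i\<in>{0..<k}. b c i (sorted_list_of_set I ! p i)))"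
      using assms by (intro polys_mult polys_const polys_prod) auto
    then show "polys P (k * e) (\<lambda>c. signof p * (\<Prod>i\<in>{0..<k}. b c i (sorted_list_of_set I ! p i)))" by simp
  qed
  moreover have "minor n k (b c) I = (\<Sum>p\<in>{p. p permutes {0..<k}}. signof p *
      (\<Prod>i\<in>{0..<k}. b c i (sorted_list_of_set I ! p i)))" for c
  proof -
    have "minor n k (b c) I = det (mat k k (\<lambda>(r, c'). b c r (sorted_list_of_set I ! c')))"
      using True by (simp add: minor_def)
    also have "\<dots> = (\<Sum>p\<in>{p. p permutes {0..<k}}. signof p *
      (\<Prod>i\<in>{0..<k}. mat k k (\<lambda>(r, c'). b c r (sorted_list_of_set I ! c')) $$ (i, p i)))"
      by (rule det_def') simp
    also have "\<dots> = (\<Sum>p\<in>{p. p permutes {0..<k}}. signof p *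
      (\<Prod>i\<in>{0..<k}. b c i (sorted_list_of_set I ! p i)))"
    proof (intro sum.cong prod.cong arg_cong2[of _ _ _ _ "(*)"] refl)
      fix p i assume "p \<in> {p. p permutes {0..<k}}" "i \<in> {0..<k}"
      then have "p i < k" using permutes_in_image[of p "{0..<k}" i] by simp
      then show "mat k k (\<lambda>(r, c'). b c r (sorted_list_of_set I ! c')) $$ (i, p i) = b c i (sorted_list_of_set I ! p i)"
        using \<open>i \<in> {0..<k}\<close> by simp
    qed
    finally show ?thesis .
  qed
  ultimately show ?thesis by simp
next
  case False
  then have "minor n k (b c) I = 0" for c by (auto simp: minor_def)
  then show ?thesis by (simp add: polys_const)
qed

end

lemma finite_cell_params: "finite J \<Longrightarrow> finite (cell_params n J)"
  by (rule finite_subset[of _ "Sigma J (\<lambda>i. {1..<i})"]) (auto simp: cell_params_def)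

text \<open>The bound 2 stems from the dependent entries, which are quadratic in parameters that are
  all free.\<close>

lemma polys_row:
  assumes J: "isotropic_set n J" and i: "i \<in> J"
  shows "polys (cell_params n J) 2 (\<lambda>c. cell_row n J c i p)"
proof -
  let ?P = "cell_params n J"
  note fin = finite_cell_params[OF isotropic_set_finite[OF J], of n]
  note pc = polys_const[OF fin] and px = polys_coord[OF fin] and pm = polys_mono[OF fin]
  have px2: "polys ?P 2 (\<lambda>c. c x)" if "x \<in> ?P" for x using pm[OF px[OF that], of 2] by simp
  have cm: "polys ?P 2 (\<lambda>c. a * f c)" if "polys ?P 2 f" for a f
    using polys_mult[OF fin pc[of 0 a] that] by (simp only: add_0)
  consider "p = i" | "p \<noteq> i" "p \<in> J \<or> p > i \<or> p = 0"
    | (det) "p \<noteq> i" "p \<notin> J" "p < i" "1 \<le> p" "bar n p \<in> J" "bar n p > i"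
    | (free) "p \<noteq> i" "p \<notin> J" "p < i" "1 \<le> p" "\<not> (bar n p \<in> J \<and> bar n p > i)"
    by fastforce
  then show ?thesis
  proof cases
    case free
    then have "(i, p) \<in> ?P" using i by (auto simp: cell_params_def)
    moreover from this have "cell_row n J c i p = c (i, p)" for c by (rule row_free)
    ultimately show ?thesis using px2 by simp
  next
    case det
    have ib: "1 \<le> i" "i \<le> 2 * n + 1" "bar n i \<notin> J" using isotropic_setD[OF J i] by auto
    have a: "(bar n p, bar n i) \<in> ?P"
      using det ib i by (auto simp: cell_params_def bar_bar) (auto simp: bar_def)
    have b: "(i, l) \<in> ?P" "(bar n p, bar n l) \<in> ?P" if "l \<in> mid n J i (bar n p)" for l
      using that det i by (auto simp: cell_params_def mid_def bar_bar) (auto simp: bar_def)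
    have "polys ?P 2 (\<lambda>c. - eps n p * (eps n i * c (bar n p, bar n i)
       + (\<Sum>l\<in>mid n J i (bar n p). eps n l * (c (i, l) * c (bar n p, bar n l)))))"
    proof (intro cm polys_add[OF fin] polys_sum[OF fin])
      show "polys ?P 2 (\<lambda>c. c (bar n p, bar n i))" using a by (rule px2)
      fix l assume "l \<in> mid n J i (bar n p)"
      then show "polys ?P 2 (\<lambda>c. c (i, l) * c (bar n p, bar n l))"
        using polys_mult[OF fin px px] b by (simp add: numeral_2_eq_2)
    qed
    then show ?thesis using det by (simp add: cell_row_def mult.assoc)
  qed (auto simp: cell_row_def pc)
qed

definition cell_rows :: "nat \<Rightarrow> nat set \<Rightarrow> (nat \<times> nat \<Rightarrow> complex) \<Rightarrow> nat \<Rightarrow> cvec" where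
  "cell_rows n J c m = cell_row n J c (sorted_list_of_set J ! m)"

lemma plv_eq_rows:
  assumes "V \<in> IG n k"
  shows "plv n k V = minor n k (cell_rows n (jumps V) (\<lambda>(i, p). red V i p))"
proof -
  have J: "finite (jumps V)" "card (jumps V) = k"
    using assms isotropic_jumps isotropic_set_finite card_jumps_IG by blast+
  have "red V (sorted_list_of_set (jumps V) ! m) = cell_rows n (jumps V) (\<lambda>(i, p). red V i p) m" if "m < k" for m
    unfolding cell_rows_def using red_eq_row[OF assms nth_sorted_mem[OF J that]] .
  then have "mat k k (\<lambda>(r, c). red V (sorted_list_of_set (jumps V) ! r) (sorted_list_of_set I ! c)) =
      mat k k (\<lambda>(r, c). cell_rows n (jumps V) (\<lambda>(i, p). red V i p) r (sorted_list_of_set I ! c))" for I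
    by (intro eq_matI) auto
  then show ?thesis by (auto simp: plv_def minor_def fun_eq_iff)
qed

lemma polys_rows_form:
  assumes "isotropic_set n J" "card J = k" "hom_poly d F"
  shows "polys (cell_params n J) (d * (k * 2)) (\<lambda>c. F (minor n k (cell_rows n J c)))"
proof -
  note J = isotropic_set_finite[OF assms(1)]
  note fin = finite_cell_params[OF J, of n]
  have "polys (cell_params n J) 2 (\<lambda>c. cell_rows n J c m p)" if "m < k" for m p
    unfolding cell_rows_def using polys_row[OF assms(1) nth_sorted_mem[OF J assms(2) that]] .
  then have "polys (cell_params n J) (k * 2) (\<lambda>c. minor n k (cell_rows n J c) I)" for I
    by (rule polys_minor[OF fin])
  then show ?thesis by (rule polys_hom_poly[OF fin assms(3)])
qed

section \<open>Independent forms along a chain of irreducible sets\<close>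

lemma hom_poly_power: "hom_poly d F \<Longrightarrow> hom_poly (a * d) (\<lambda>x. F x ^ a)"
proof (induction a)
  case 0
  then show ?case using hom_poly.const[of 1] by simp
next
  case (Suc a)
  then show ?case using hom_poly.mult[of d F "a * d" "\<lambda>x. F x ^ a"] by simp
qed

lemma hom_poly_zero: "hom_poly d (\<lambda>x. 0)"
  using hom_poly.mult[OF hom_poly.const[of 0] hom_poly_power[OF hom_poly.coord, of d undefined]] by simp

lemma hom_poly_cmult: "hom_poly d F \<Longrightarrow> hom_poly d (\<lambda>x. a * F x)"
  using hom_poly.mult[OF hom_poly.const[of a], of d F] by simp

lemma hom_poly_sum: "(\<And>i. i \<in> A \<Longrightarrow> hom_poly d (F i)) \<Longrightarrow> hom_poly d (\<lambda>x. \<Sum>i\<in>A. F i x)"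
  by (induction A rule: infinite_finite_induct) (auto intro: hom_poly_zero hom_poly.add)

definition independent_on where
  "independent_on n k Z N b \<longleftrightarrow> (\<forall>c :: nat \<Rightarrow> complex.
     (\<forall>V\<in>Z. (\<Sum>i<N. c i * b i (plv n k V)) = 0) \<longrightarrow> (\<forall>i<N. c i = 0))"

text \<open>If \<open>b\<close> is independent on \<open>Z'\<close> and \<open>F\<close> vanishes on \<open>Z'\<close> but not on the irreducible \<open>Z \<supseteq> Z'\<close>,
  then the products of the \<open>b i\<close> with the powers of \<open>F\<close>, homogenised by a coordinate, are
  independent on \<open>Z\<close>: divide a relation by the largest possible power of \<open>F\<close> and restrict to \<open>Z'\<close>.\<close>

lemma independent_step:
  fixes M :: nat
  assumes S: "S \<subseteq> IG n k"
    and Z: "irreducible_closed (subtopology (zariski n k) S) Z"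
    and Z': "irreducible_closed (subtopology (zariski n k) S) Z'" "Z' \<subseteq> Z"
    and x: "U \<in> Z'" "plv n k U I \<noteq> 0"
    and F: "hom_poly d F" "\<And>V. V \<in> Z' \<Longrightarrow> F (plv n k V) = 0" "W \<in> Z" "F (plv n k W) \<noteq> 0"
    and b: "\<And>i. i < N \<Longrightarrow> hom_poly L (b i)" "independent_on n k Z' N b"
  defines "b' \<equiv> \<lambda>j y. F y ^ (j div N) * y I ^ ((M - j div N) * d) * b (j mod N) y"
  shows "\<And>j. j < Suc M * N \<Longrightarrow> hom_poly (L + M * d) (b' j)" "independent_on n k Z (Suc M * N) b'"
proof -
  have coord: "hom_poly (a * 1) (\<lambda>y. y I ^ a)" for a by (intro hom_poly_power hom_poly.coord)
  show "hom_poly (L + M * d) (b' j)" if j: "j < Suc M * N" for j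
  proof -
    have N: "0 < N" using j by (cases N) auto
    have le: "j div N \<le> M" using j N by (simp add: div_less_iff_less_mult less_Suc_eq_le[symmetric])
    have "hom_poly ((j div N) * d + ((M - j div N) * d) * 1 + L) (b' j)"
      unfolding b'_def using N by (intro hom_poly.mult hom_poly_power[OF F(1)] coord b(1)) auto
    moreover have "(j div N) * d + ((M - j div N) * d) * 1 + L = L + M * d"
      using le by (simp add: add_mult_distrib[symmetric])
    ultimately show ?thesis by (simp only:)
  qed
  show "independent_on n k Z (Suc M * N) b'"
  proof (cases "N = 0")
    case True
    then show ?thesis by (simp add: independent_on_def)
  next
    case False
    show ?thesis
      unfolding independent_on_def
    proof (intro allI impI)
      fix c :: "nat \<Rightarrow> complex" and j
      assume rel: "\<forall>V\<in>Z. (\<Sum>j<Suc M * N. c j * b' j (plv n k V)) = 0" and j: "j < Suc M * N"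
      \<comment> \<open>The index \<open>j\<close> encodes the pair
        \<open>(j div N, j mod N)\<close>, and \<open>Q t\<close> is the coefficient of
        \<open>F ^ t\<close> in the relation.\<close>
      define Q where "Q t y = (\<Sum>i<N. c (t * N + i) * b i y)" for t y
      have Qhom: "hom_poly L (Q t)" for t
        unfolding Q_def by (intro hom_poly_sum hom_poly_cmult b(1)) auto
      have decomp: "(\<Sum>j<Suc M * N. c j * b' j y) = (\<Sum>t<Suc M. F y ^ t * y I ^ ((M - t) * d) * Q t y)" for y
      proof -
        have "(\<Sum>j<Suc M * N. c j * b' j y) = (\<Sum>t<Suc M. sum (\<lambda>j. c j * b' j y) {t * N..<t * N + N})"
          by (rule sum.nat_group[symmetric])
        also have "\<dots> = (\<Sum>t<Suc M. F y ^ t * y I ^ ((M - t) * d) * Q t y)"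
        proof (rule sum.cong[OF refl])
          fix t
          have "sum (\<lambda>j. c j * b' j y) {t * N..<t * N + N} = (\<Sum>i<N. c (t * N + i) * b' (t * N + i) y)"
            using sum.shift_bounds_nat_ivl[of "\<lambda>j. c j * b' j y" 0 "t * N" N]
            by (simp add: lessThan_atLeast0 add.commute)
          also have "\<dots> = (\<Sum>i<N. F y ^ t * y I ^ ((M - t) * d) * (c (t * N + i) * b i y))"
            using False by (intro sum.cong) (auto simp: b'_def)
          finally show "sum (\<lambda>j. c j * b' j y) {t * N..<t * N + N} = F y ^ t * y I ^ ((M - t) * d) * Q t y"
            by (simp add: Q_def sum_distrib_left)
        qed
        finally show ?thesis .
      qed
      have zero: "\<forall>i<N. c (t * N + i) = 0" if "t \<le> M" for t
        using that
      proof (induction t rule: less_induct)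
        case (less t)
        define R where "R y = (\<Sum>s=t..M. F y ^ (s - t) * y I ^ ((M - s) * d) * Q s y)" for y
        have "hom_poly ((M - t) * d + L) R"
          unfolding R_def
        proof (intro hom_poly_sum)
          fix s assume s: "s \<in> {t..M}"
          have "hom_poly ((s - t) * d + ((M - s) * d) * 1 + L) (\<lambda>y. F y ^ (s - t) * y I ^ ((M - s) * d) * Q s y)"
            by (intro hom_poly.mult hom_poly_power[OF F(1)] coord Qhom)
          moreover have "(s - t) * d + ((M - s) * d) * 1 = (M - t) * d"
            using s by (simp add: add_mult_distrib[symmetric])
          ultimately show "hom_poly ((M - t) * d + L) (\<lambda>y. F y ^ (s - t) * y I ^ ((M - s) * d) * Q s y)"
            by (simp only:)
        qed
        note Rhom = this
        have "F (plv n k V) ^ t * R (plv n k V) = 0" if V: "V \<in> Z" for V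
        proof -
          let ?y = "plv n k V"
          have "{..<Suc M} = {..<t} \<union> {t..M}" using less.prems by auto
          then have "(\<Sum>s<Suc M. F ?y ^ s * ?y I ^ ((M - s) * d) * Q s ?y) =
             (\<Sum>s<t. F ?y ^ s * ?y I ^ ((M - s) * d) * Q s ?y) + (\<Sum>s=t..M. F ?y ^ s * ?y I ^ ((M - s) * d) * Q s ?y)"
            by (simp add: sum.union_disjoint ivl_disj_int)
          moreover have "(\<Sum>s<t. F ?y ^ s * ?y I ^ ((M - s) * d) * Q s ?y) = 0"
            using less.IH less.prems by (intro sum.neutral) (auto simp: Q_def)
          moreover have "(\<Sum>s=t..M. F ?y ^ s * ?y I ^ ((M - s) * d) * Q s ?y) = F ?y ^ t * R ?y"
            unfolding R_def sum_distrib_left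
            by (intro sum.cong) (auto simp: mult.assoc[symmetric] power_add[symmetric])
          ultimately show ?thesis using rel V decomp by simp
        qed
        then have "(\<forall>V\<in>Z. F (plv n k V) ^ t = 0) \<or> (\<forall>V\<in>Z. R (plv n k V) = 0)"
          using irreducible_product[OF Z S hom_poly_power[OF F(1)] Rhom] by blast
        then have R0: "\<forall>V\<in>Z. R (plv n k V) = 0" using F(3,4) by auto
        have "plv n k V I ^ ((M - t) * d) * Q t (plv n k V) = 0" if V: "V \<in> Z'" for V
        proof -
          let ?y = "plv n k V"
          have "R ?y = (\<Sum>s=t..M. if s = t then ?y I ^ ((M - t) * d) * Q t ?y else 0)"
            unfolding R_def using F(2)[OF V] by (intro sum.cong) auto
          also have "\<dots> = ?y I ^ ((M - t) * d) * Q t ?y" using less.prems by simp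
          finally show ?thesis using R0 V Z'(2) by auto
        qed
        then have "(\<forall>V\<in>Z'. plv n k V I ^ ((M - t) * d) = 0) \<or> (\<forall>V\<in>Z'. Q t (plv n k V) = 0)"
          using irreducible_product[OF Z'(1) S coord Qhom] by blast
        then have "\<forall>V\<in>Z'. Q t (plv n k V) = 0" using x by auto
        then show ?case
          using b(2)[unfolded independent_on_def, rule_format, of "\<lambda>i. c (t * N + i)"] unfolding Q_def by blast
      qed
      have "j div N \<le> M" using j False by (simp add: div_less_iff_less_mult less_Suc_eq_le[symmetric])
      then show "c j = 0" using zero[of "j div N", rule_format, of "j mod N"] False by simp
    qed
  qed
qed

text \<open>Two counts of forms are compared as \<open>M\<close> grows: the chain supplies at least
  order \<open>M ^ r\<close> independent ones, the cells admit at most order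
  \<open>M ^ m\<close>.\<close>

lemma chain_length_le:
  assumes S: "S \<subseteq> IG n k"
    and m: "\<And>V. V \<in> S \<Longrightarrow> card (cell_params n (jumps V)) \<le> m"
    and Z: "\<And>i. i \<le> r \<Longrightarrow> irreducible_closed (subtopology (zariski n k) S) (Z i)"
    and chain: "\<And>i. i < r \<Longrightarrow> Z i \<subset> Z (Suc i)"
  shows "r \<le> m"
proof -
  have ZS: "Z i \<subseteq> S" if "i \<le> r" for i
    using Z[OF that] by (metis closedin_subset irreducible_closed_def topspace_subtopology le_inf_iff)
  have mono: "Z 0 \<subseteq> Z i" if "i \<le> r" for i
    using that by (induction i) (use chain in \<open>auto simp: Suc_le_eq\<close>)
  have "\<exists>d F. hom_poly d F \<and> (\<forall>V\<in>Z i. F (plv n k V) = 0) \<and> (\<exists>W\<in>Z (Suc i). F (plv n k W) \<noteq> 0)"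
    if i: "i < r" for i
  proof -
    obtain W where W: "W \<in> Z (Suc i)" "W \<notin> Z i" using chain[OF i] by blast
    then have "W \<in> S" using ZS[of "Suc i"] i by auto
    moreover have "closedin (subtopology (zariski n k) S) (Z i)"
      using Z[of i] i by (simp add: irreducible_closed_def)
    ultimately obtain d F where "hom_poly d F" "F (plv n k W) \<noteq> 0" "\<And>V. V \<in> Z i \<Longrightarrow> F (plv n k V) = 0"
      using closed_separation[of n k S "Z i" W] W S by blast
    then show ?thesis using W(1) by blast
  qed
  then obtain d F where F: "\<And>i. i < r \<Longrightarrow> hom_poly (d i) (F i)"
    "\<And>i V. i < r \<Longrightarrow> V \<in> Z i \<Longrightarrow> F i (plv n k V) = 0"
    "\<And>i. i < r \<Longrightarrow> \<exists>W\<in>Z (Suc i). F i (plv n k W) \<noteq> 0"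
    by metis
  obtain U where U: "U \<in> Z 0" using Z[of 0] unfolding irreducible_closed_def by auto
  have UI: "U \<in> IG n k" using U ZS[of 0] S by auto
  \<comment> \<open>The constant 1 starts the family; each step of the chain multiplies its size by
    \<open>M + 1\<close> and adds \<open>M * d s\<close> to the degree. The point \<open>U\<close>
    of the smallest set lies in all of them, so its coordinate at \<open>jumps U\<close> always
    serves to homogenise.\<close>
  have family: "\<exists>b. (\<forall>i<Suc M ^ s. hom_poly (M * sum d {..<s}) (b i)) \<and> independent_on n k (Z s) (Suc M ^ s) b"
    if "s \<le> r" for s M
    using that
  proof (induction s)
    case 0
    show ?case
      using hom_poly.const[of 1] U by (intro exI[of _ "\<lambda>_ _. 1"]) (auto simp: independent_on_def)
  next
    case (Suc s)
    then obtain b where b: "\<And>i. i < Suc M ^ s \<Longrightarrow> hom_poly (M * sum d {..<s}) (b i)"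
      "independent_on n k (Z s) (Suc M ^ s) b" by auto
    have s: "s < r" using Suc.prems by simp
    obtain W where W: "W \<in> Z (Suc s)" "F s (plv n k W) \<noteq> 0" using F(3)[OF s] by blast
    have "U \<in> Z s" using U mono[of s] s by auto
    have "plv n k U (jumps U) \<noteq> 0" using plv_jumps[OF UI] by simp
    note step = independent_step[OF S Z[OF Suc.prems] Z[OF less_imp_le[OF s]] psubset_imp_subset[OF chain[OF s]]
      \<open>U \<in> Z s\<close> this F(1)[OF s] F(2)[OF s] W b, where M = M]
    then show ?case
      by (intro exI[of _ "\<lambda>j y. F s y ^ (j div Suc M ^ s) * y (jumps U) ^ ((M - j div Suc M ^ s) * d s) * b (j mod Suc M ^ s) y"])
         (simp add: algebra_simps)
  qed
  define \<delta> where "\<delta> = sum d {..<r}"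
  \<comment> \<open>The power of two bounds the number of jump sets; the other factor turns the
    exponent bound \<open>M * \<delta> * (k * 2) + 1\<close> into a multiple of
    \<open>Suc M\<close>.\<close>
  define K where "K = 2 ^ (2 * n + 1) * (\<delta> * (k * 2) + 1) ^ m"
  have bound: "Suc M ^ r \<le> K * Suc M ^ m" for M
  proof (rule ccontr)
    assume contra: "\<not> Suc M ^ r \<le> K * Suc M ^ m"
    obtain b where b: "\<And>i. i < Suc M ^ r \<Longrightarrow> hom_poly (M * \<delta>) (b i)" "independent_on n k (Z r) (Suc M ^ r) b"
      using family[OF order_refl, of M] unfolding \<delta>_def by blast
    define e where "e = M * \<delta> * (k * 2)"
    define \<J> where "\<J> = jumps ` S"
    have J: "isotropic_set n J" "card J = k" "card (cell_params n J) \<le> m" if "J \<in> \<J>" for J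
      using that S m isotropic_jumps card_jumps_IG by (auto simp: \<J>_def)
    have Jsub: "\<J> \<subseteq> Pow {1..2 * n + 1}" using J(1) unfolding isotropic_set_def by auto
    then have finJ: "finite \<J>" and cardJ: "card \<J> \<le> 2 ^ (2 * n + 1)"
      using finite_subset[OF Jsub] card_mono[OF _ Jsub] by (auto simp: card_Pow)
    define coeffs where "coeffs i J a \<longleftrightarrow> (\<forall>c. b i (minor n k (cell_rows n J c)) =
        (\<Sum>\<alpha>\<in>cell_params n J \<rightarrow>\<^sub>E {..e}. a \<alpha> * (\<Prod>x\<in>cell_params n J. c x ^ \<alpha> x)))" for i J a
    have ex: "\<exists>a. coeffs i J a"
      if "i < Suc M ^ r" "J \<in> \<J>" for i J
      using polys_rows_form[OF J(1,2)[OF that(2)] b(1)[OF that(1)]] unfolding polys_def e_def coeffs_def .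
    define a where "a i J = (SOME a. coeffs i J a)" for i J
    have "coeffs i J (a i J)" if "i < Suc M ^ r" "J \<in> \<J>" for i J
      unfolding a_def by (rule someI_ex[OF ex[OF that]])
    then have a: "\<And>i J c. i < Suc M ^ r \<Longrightarrow> J \<in> \<J> \<Longrightarrow> b i (minor n k (cell_rows n J c)) =
        (\<Sum>\<alpha>\<in>cell_params n J \<rightarrow>\<^sub>E {..e}. a i J \<alpha> * (\<Prod>x\<in>cell_params n J. c x ^ \<alpha> x))"
      unfolding coeffs_def by blast
    \<comment> \<open>One linear equation for each cell and each monomial on it. A solution gives a
      combination of the forms that vanishes on every cell meeting \<open>S\<close>, hence on
      \<open>Z r\<close>.\<close>
    define Y where "Y = Sigma \<J> (\<lambda>J. cell_params n J \<rightarrow>\<^sub>E {..e})"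
    have finP: "finite (cell_params n J)" if "J \<in> \<J>" for J
      using J(1)[OF that] isotropic_set_finite finite_cell_params by blast
    have finY: "finite Y" using finJ finP by (auto simp: Y_def intro!: finite_SigmaI finite_PiE)
    have "card Y = (\<Sum>J\<in>\<J>. card (cell_params n J \<rightarrow>\<^sub>E {..e}))"
      unfolding Y_def using finJ finP by (intro card_SigmaI) (auto intro!: finite_PiE)
    also have "\<dots> \<le> (\<Sum>J\<in>\<J>. Suc e ^ m)"
    proof (rule sum_mono)
      fix J assume "J \<in> \<J>"
      then show "card (cell_params n J \<rightarrow>\<^sub>E {..e}) \<le> Suc e ^ m"
        using J(3) finP by (subst card_PiE) (auto intro: power_increasing)
    qed
    also have "\<dots> \<le> 2 ^ (2 * n + 1) * Suc e ^ m" using cardJ by simp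
    also have "\<dots> \<le> 2 ^ (2 * n + 1) * ((\<delta> * (k * 2) + 1) * Suc M) ^ m"
      by (intro mult_left_mono power_mono) (auto simp: e_def algebra_simps)
    also have "\<dots> = K * Suc M ^ m" by (simp only: K_def power_mult_distrib mult.assoc)
    finally have "card Y < card {..<Suc M ^ r}" using contra by simp
    then obtain c where c: "\<exists>i\<in>{..<Suc M ^ r}. c i \<noteq> 0"
      "\<forall>j\<in>Y. (\<Sum>i<Suc M ^ r. c i * (case j of (J, \<alpha>) \<Rightarrow> a i J \<alpha>)) = 0"
      using nontrivial_relation[OF finY finite_lessThan, of "Suc M ^ r" "\<lambda>i (J, \<alpha>). a i J \<alpha>"] by blast
    have "(\<Sum>i<Suc M ^ r. c i * b i (plv n k V)) = 0" if V: "V \<in> Z r" for V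
    proof -
      define J where "J = jumps V"
      define x where "x = (\<lambda>(i, p). red V i p)"
      have VS: "V \<in> S" "V \<in> IG n k" using V ZS[of r] S by auto
      have JJ: "J \<in> \<J>" using VS by (simp add: J_def \<J>_def)
      have "(\<Sum>i<Suc M ^ r. c i * b i (plv n k V)) = (\<Sum>i<Suc M ^ r. c i *
          (\<Sum>\<alpha>\<in>cell_params n J \<rightarrow>\<^sub>E {..e}. a i J \<alpha> * (\<Prod>y\<in>cell_params n J. x y ^ \<alpha> y)))"
        using a[OF _ JJ, of _ x] plv_eq_rows[OF VS(2)] by (intro sum.cong) (auto simp: J_def x_def)
      also have "\<dots> = (\<Sum>\<alpha>\<in>cell_params n J \<rightarrow>\<^sub>E {..e}. (\<Sum>i<Suc M ^ r. c i * a i J \<alpha>) * (\<Prod>y\<in>cell_params n J. x y ^ \<alpha> y))"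
        unfolding sum_distrib_left sum_distrib_right by (subst sum.swap) (simp add: mult.assoc)
      also have "\<dots> = 0" using c(2) JJ by (intro sum.neutral) (auto simp: Y_def)
      finally show ?thesis .
    qed
    then show False using b(2) c(1) unfolding independent_on_def by blast
  qed
  show "r \<le> m"
  proof (rule ccontr)
    assume "\<not> r \<le> m"
    \<comment> \<open>The bound holds for every \<open>M\<close>; the choice \<open>M = K\<close>
      refutes it.\<close>
    then have "Suc K ^ Suc m \<le> Suc K ^ r" by (intro power_increasing) auto
    also have "\<dots> \<le> K * Suc K ^ m" by (rule bound)
    finally show False by simp
  qed
qed

lemma dim_IG_le:
  assumes "S \<subseteq> IG n k" "\<And>V. V \<in> S \<Longrightarrow> card (cell_params n (jumps V)) \<le> m"
  shows "dim_IG n k S \<le> m"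
proof -
  let ?X = "{r. \<exists>Z. (\<forall>i\<le>r. irreducible_closed (subtopology (zariski n k) S) (Z i)) \<and> (\<forall>i<r. Z i \<subset> Z (Suc i))}"
  have le: "r \<le> m" if "r \<in> ?X" for r using that chain_length_le[OF assms] by blast
  then have "finite ?X" by (meson finite_nat_set_iff_bounded_le)
  then show ?thesis unfolding dim_IG_def krull_dim_def Sup_nat_def using le by auto
qed

lemma dim_IG_ge:
  assumes "S \<subseteq> IG n k"
    and "\<And>i. i \<le> r \<Longrightarrow> irreducible_closed (subtopology (zariski n k) S) (Z i)"
    and "\<And>i. i < r \<Longrightarrow> Z i \<subset> Z (Suc i)"
  shows "r \<le> dim_IG n k S"
proof -
  let ?X = "{r. \<exists>Z. (\<forall>i\<le>r. irreducible_closed (subtopology (zariski n k) S) (Z i)) \<and> (\<forall>i<r. Z i \<subset> Z (Suc i))}"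
  \<comment> \<open>A crude bound from all index sets; it makes the set of chain lengths finite, so
    that the supremum in the natural numbers is meaningful.\<close>
  define m where "m = (SUP J\<in>Pow {1..2 * n + 1}. card (cell_params n J))"
  have "card (cell_params n (jumps V)) \<le> m" if "V \<in> S" for V
    unfolding m_def using that assms(1) isotropic_jumps[of V n k]
    by (intro cSUP_upper bdd_above_finite) (auto simp: isotropic_set_def)
  then have "r \<le> m" if "r \<in> ?X" for r using that chain_length_le[OF assms(1)] by blast
  then have "finite ?X" by (meson finite_nat_set_iff_bounded_le)
  moreover have "r \<in> ?X" using assms(2,3) by blast
  ultimately show ?thesis
    unfolding dim_IG_def krull_dim_def by (intro cSup_upper) auto
qed


section \<open>Dimension and jump sets of Schubert varieties\<close>

text \<open>Projection to the coordinates orthogonal to all planes spanned by the unit vectors at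
  \<open>j\<close> and \<open>bar n j\<close> with \<open>j \<in> J\<close>.\<close>

definition mid_part :: "nat \<Rightarrow> nat set \<Rightarrow> cvec \<Rightarrow> cvec" where
  "mid_part n J v = (\<lambda>l. if l \<notin> J \<and> bar n l \<notin> J then v l else 0)"

text \<open>\<open>1 + cell_shift\<close> is the symplectic unipotent map sending each \<open>e\<^sub>i\<close> with \<open>i \<in> J\<close> to the row \<open>i\<close>.\<close>

definition cell_shift :: "nat \<Rightarrow> nat set \<Rightarrow> (nat \<Rightarrow> cvec) \<Rightarrow> cvec \<Rightarrow> cvec" where
  "cell_shift n J r v = (\<Sum>i\<in>J. cscale (v i) (r i - unit_v i))
     - (\<Sum>i\<in>J. cscale (eps n i * omega n (mid_part n J (r i)) v) (unit_v (bar n i)))"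

lemma omega_unit_right: "j \<in> {1..2 * n + 2} \<Longrightarrow> omega n u (unit_v j) = - eps n j * u (bar n j)"
proof -
  assume j: "j \<in> {1..2 * n + 2}"
  have "omega n u (unit_v j) = (\<Sum>l=1..2*n+2. if l = bar n j then eps n l * u l else 0)"
    unfolding omega_eq using j by (intro sum.cong) (auto simp: unit_v_def bar_def)
  also have "\<dots> = - eps n j * u (bar n j)"
    using j eps_bar[of j n] by (auto simp: bar_def)
  finally show ?thesis .
qed

lemma omega_unit_left: "j \<in> {1..2 * n + 2} \<Longrightarrow> omega n (unit_v j) u = eps n j * u (bar n j)"
  using omega_unit_right[of j n u] omega_skew[of n "unit_v j" u] by simp

context
  fixes n :: nat and J :: "nat set" and r :: "nat \<Rightarrow> cvec"
  assumes J: "isotropic_set n J"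
    and r: "\<And>i. i \<in> J \<Longrightarrow> reduced_at J i (r i)" "\<And>i. i \<in> J \<Longrightarrow> r i \<in> E n"
      "\<And>i j. i \<in> J \<Longrightarrow> j \<in> J \<Longrightarrow> omega n (r i) (r j) = 0"
begin

private lemma finJ: "finite J" using J by (rule isotropic_set_finite)

private lemma JD: "i \<in> J \<Longrightarrow> i \<in> {1..2*n+2}" "i \<in> J \<Longrightarrow> 1 \<le> i" "i \<in> J \<Longrightarrow> i \<le> 2*n+1"
  "i \<in> J \<Longrightarrow> bar n i \<in> {1..2*n+2}" "i \<in> J \<Longrightarrow> bar n i \<notin> J" "i \<in> J \<Longrightarrow> bar n (bar n i) = i"
  using isotropic_setD[OF J, of i] by (auto simp: bar_def)

private abbreviation "N \<equiv> cell_shift n J r"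
private abbreviation "a \<equiv> \<lambda>i. mid_part n J (r i)"
private abbreviation "s \<equiv> \<lambda>i. r i - unit_v i"

private lemma s_J: "i \<in> J \<Longrightarrow> j \<in> J \<Longrightarrow> s i j = 0"
  using r(1)[of i] by (auto simp: reduced_at_def unit_v_def)

private lemma a_J: "j \<in> J \<Longrightarrow> a i j = 0" "j \<in> J \<Longrightarrow> a i (bar n j) = 0"
  using JD by (auto simp: mid_part_def)

lemma cell_shift_apply:
  "N v x = (\<Sum>i\<in>J. v i * s i x) - (\<Sum>i\<in>J. eps n i * omega n (a i) v * unit_v (bar n i) x)"
  by (simp add: cell_shift_def sum_fun_apply cscale_def)

lemma cell_shift_linear: "N (u + v) = N u + N v" "N (cscale c v) = cscale c (N v)"
proof -
  show "N (u + v) = N u + N v"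
    by (auto simp: fun_eq_iff cell_shift_apply omega_linear algebra_simps sum.distrib sum_subtractf)
  show "N (cscale c v) = cscale c (N v)"
    unfolding fun_eq_iff cell_shift_apply omega_linear
    by (simp add: cscale_def cell_shift_apply right_diff_distrib sum_distrib_left mult.assoc mult.left_commute)
qed

lemma cell_shift_diff: "N (u - v) = N u - N v"
  by (auto simp: fun_eq_iff cell_shift_apply omega_linear algebra_simps sum.distrib sum_subtractf)

private lemma N_J: "i \<in> J \<Longrightarrow> N v i = 0"
proof -
  assume i: "i \<in> J"
  have "(\<Sum>j\<in>J. v j * s j i) = 0" using s_J i by (intro sum.neutral) auto
  moreover have "(\<Sum>j\<in>J. eps n j * omega n (a j) v * unit_v (bar n j) i) = 0"
    using JD(5) i by (intro sum.neutral) (auto simp: unit_v_def)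
  ultimately show ?thesis by (simp add: cell_shift_apply)
qed

private lemma omega_a_unit: "j \<in> J \<Longrightarrow> omega n (a i) (unit_v j) = 0" "j \<in> J \<Longrightarrow> omega n (a i) (unit_v (bar n j)) = 0"
  using JD[of j] a_J by (auto simp: omega_unit_right)

lemma cell_shift_unit: "j \<in> J \<Longrightarrow> N (unit_v j) = r j - unit_v j"
proof
  fix x assume j: "j \<in> J"
  have "(\<Sum>i\<in>J. unit_v j i * s i x) = (\<Sum>i\<in>J. if i = j then s j x else 0)"
    by (intro sum.cong) (auto simp: unit_v_def)
  then show "N (unit_v j) x = (r j - unit_v j) x"
    using j finJ omega_a_unit(1)[OF j] by (simp add: cell_shift_apply)
qed

text \<open>Values of \<open>N\<close> vanish on \<open>J\<close>, so a second application leaves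
  only unit vectors at the indices \<open>bar n i\<close>; these are orthogonal to every
  \<open>a i\<close>, and the third application kills them. Hence \<open>1 - N + N\<dots>N\<close>,
  the truncated geometric series with two applications in its last term, inverts
  \<open>1 + N\<close>.\<close>

private lemma N_cubed: "N (N (N v)) = 0"
proof -
  have *: "N u = 0 - (\<Sum>i\<in>J. cscale (eps n i * omega n (a i) u) (unit_v (bar n i)))"
    if "\<And>i. i \<in> J \<Longrightarrow> u i = 0" for u
    using that by (simp add: cell_shift_def cscale_def fun_eq_iff sum_fun_apply)
  have "N (N v) = 0 - (\<Sum>i\<in>J. cscale (eps n i * omega n (a i) (N v)) (unit_v (bar n i)))"
    by (rule *) (rule N_J)
  then have "omega n (a i) (N (N v)) = 0" for i
    using omega_a_unit(2) by (simp only: omega_linear omega_sum) simp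
  then show ?thesis using *[of "N (N v)"] N_J by (simp add: cscale_def fun_eq_iff sum_fun_apply)
qed

text \<open>The correction for \<open>i = 1\<close> would leave \<open>E n\<close>, as
  \<open>bar n 1 = 2 * n + 2\<close>. Its coefficient vanishes because row 1 has no entry beyond its
  pivot.\<close>

private lemma a_one: "1 \<in> J \<Longrightarrow> omega n (a 1) v = 0"
proof -
  assume 1: "1 \<in> J"
  have "a 1 l = 0" if "l \<in> {1..2*n+2}" for l
    using r(1)[OF 1] 1 that by (cases "l = 1") (auto simp: mid_part_def reduced_at_def)
  then show ?thesis unfolding omega_eq by (intro sum.neutral) auto
qed

lemma cell_shift_E: "v \<in> E n \<Longrightarrow> N v \<in> E n"
proof -
  assume v: "v \<in> E n"
  have "unit_v i \<in> E n" if "i \<in> {1..2*n+1}" for i using that by (auto simp: E_def unit_v_def)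
  then have "s i \<in> E n" if "i \<in> J" for i
    using r(2)[OF that] JD[OF that] by (intro cvec.subspace_diff[OF subspace_E]) auto
  moreover have "cscale (eps n i * omega n (a i) v) (unit_v (bar n i)) \<in> E n" if i: "i \<in> J" for i
  proof (cases "i = 1")
    case True
    then show ?thesis using a_one i by (simp add: E_def cscale_def)
  next
    case False
    then show ?thesis using JD[OF i] by (auto simp: E_def cscale_def unit_v_def bar_def)
  qed
  ultimately have "(\<Sum>i\<in>J. cscale (v i) (s i)) \<in> E n"
    and "(\<Sum>i\<in>J. cscale (eps n i * omega n (a i) v) (unit_v (bar n i))) \<in> E n"
    by (blast intro: cvec.subspace_sum[OF subspace_E] cvec.subspace_scale[OF subspace_E])+
  then show ?thesis unfolding cell_shift_def by (rule cvec.subspace_diff[OF subspace_E])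
qed

text \<open>The vectors \<open>s i\<close> and \<open>a i\<close> differ only in the columns
  \<open>bar n j\<close> with \<open>j \<in> J\<close>, which pair with the entries of
  \<open>v\<close> at \<open>J\<close>.\<close>

private lemma omega_bar_part:
  assumes i: "i \<in> J"
  shows "omega n (s i) v - omega n (a i) v = (\<Sum>j\<in>J. v j * omega n (s i) (unit_v j))"
proof -
  have "omega n (s i) v - omega n (a i) v = (\<Sum>l=1..2*n+2. eps n l * (s i l - a i l) * v (bar n l))"
    unfolding omega_eq sum_subtractf[symmetric]
    by (intro sum.cong refl) (simp only: left_diff_distrib right_diff_distrib)
  also have "\<dots> = (\<Sum>l\<in>bar n ` J. eps n l * (s i l - a i l) * v (bar n l))"
  proof (rule sum.mono_neutral_right)
    show "bar n ` J \<subseteq> {1..2 * n + 2}" using JD(4) by auto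
    show "\<forall>l\<in>{1..2 * n + 2} - bar n ` J. eps n l * (s i l - a i l) * v (bar n l) = 0"
    proof
      fix l assume l: "l \<in> {1..2 * n + 2} - bar n ` J"
      then have "bar n l \<notin> J" using bar_bar[of l n] by force
      then have "s i l = a i l" using s_J[OF i, of l] i by (auto simp: mid_part_def unit_v_def)
      then show "eps n l * (s i l - a i l) * v (bar n l) = 0" by simp
    qed
  qed simp
  also have "\<dots> = (\<Sum>j\<in>J. eps n (bar n j) * (s i (bar n j) - a i (bar n j)) * v (bar n (bar n j)))"
    using JD(6) by (subst sum.reindex) (auto intro!: inj_onI simp: o_def, metis)
  also have "\<dots> = (\<Sum>j\<in>J. v j * omega n (s i) (unit_v j))"
  proof (rule sum.cong[OF refl])
    fix j assume "j \<in> J"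
    then show "eps n (bar n j) * (s i (bar n j) - a i (bar n j)) * v (bar n (bar n j)) = v j * omega n (s i) (unit_v j)"
      using JD[of j] a_J(2)[of j i] eps_bar[of j n] omega_unit_right[of j n "s i"] by simp
  qed
  finally show ?thesis .
qed

private lemma omega_N: "omega n (N u) v = (\<Sum>i\<in>J. u i * omega n (s i) v) + (\<Sum>i\<in>J. omega n (a i) u * v i)"
proof -
  have "omega n (unit_v (bar n i)) v = - eps n i * v i" if "i \<in> J" for i
    using JD[OF that] eps_bar[of i n] by (simp add: omega_unit_left)
  then have "(\<Sum>i\<in>J. eps n i * omega n (a i) u * omega n (unit_v (bar n i)) v) = - (\<Sum>i\<in>J. omega n (a i) u * v i)"
    unfolding sum_negf[symmetric]
    by (intro sum.cong) (auto simp: eps_square algebra_simps)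
  then show ?thesis by (simp add: cell_shift_def omega_linear omega_sum)
qed

text \<open>The terms with \<open>a i\<close> cancel, which is the purpose of the second sum in
  \<open>cell_shift\<close>. What remains is, for each pair \<open>i\<close>, \<open>j\<close>, the
  isotropy of the rows expanded by \<open>r i = unit_v i + s i\<close>.\<close>

lemma cell_shift_omega: "omega n (v + N v) (v' + N v') = omega n v v'"
proof -
  have "omega n (N v) (N v') = (\<Sum>i\<in>J. v i * omega n (s i) (N v'))"
    using N_J by (simp add: omega_N)
  moreover have "omega n (s i) (N v') = (\<Sum>j\<in>J. v' j * omega n (s i) (s j))" if i: "i \<in> J" for i
  proof -
    have "(\<Sum>j\<in>J. omega n (a j) v' * s i j) = 0" using s_J[OF i] by (intro sum.neutral) auto
    then have "omega n (N v') (s i) = (\<Sum>j\<in>J. v' j * omega n (s j) (s i))"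
      by (simp only: omega_N) simp
    then have "omega n (s i) (N v') = - (\<Sum>j\<in>J. v' j * omega n (s j) (s i))"
      using omega_skew[of n "s i" "N v'"] by simp
    also have "\<dots> = (\<Sum>j\<in>J. v' j * omega n (s i) (s j))"
      unfolding sum_negf[symmetric]
    proof (rule sum.cong[OF refl])
      fix j
      show "- (v' j * omega n (s j) (s i)) = v' j * omega n (s i) (s j)"
        using omega_skew[of n "s i" "s j"] by simp
    qed
    finally show ?thesis .
  qed
  ultimately have q: "omega n (N v) (N v') = (\<Sum>i\<in>J. \<Sum>j\<in>J. v i * v' j * omega n (s i) (s j))"
    by (simp add: sum_distrib_left mult.assoc)
  have l: "omega n (N v) v' = (\<Sum>i\<in>J. \<Sum>j\<in>J. v i * v' j * omega n (s i) (unit_v j))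
      + (\<Sum>i\<in>J. v i * omega n (a i) v') + (\<Sum>i\<in>J. omega n (a i) v * v' i)" for v v'
  proof -
    have "omega n (s i) v' = (\<Sum>j\<in>J. v' j * omega n (s i) (unit_v j)) + omega n (a i) v'" if "i \<in> J" for i
      using omega_bar_part[OF that, of v'] unfolding diff_eq_eq .
    then have "(\<Sum>i\<in>J. v i * omega n (s i) v') =
        (\<Sum>i\<in>J. \<Sum>j\<in>J. v i * v' j * omega n (s i) (unit_v j)) + (\<Sum>i\<in>J. v i * omega n (a i) v')"
      by (simp add: algebra_simps sum.distrib sum_distrib_left)
    then show ?thesis by (simp add: omega_N)
  qed
  have "omega n v (N v') = - omega n (N v') v" by (rule omega_skew)
  also have "\<dots> = - (\<Sum>i\<in>J. \<Sum>j\<in>J. v i * v' j * omega n (s j) (unit_v i))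
      - (\<Sum>i\<in>J. v i * omega n (a i) v') - (\<Sum>i\<in>J. omega n (a i) v * v' i)"
    unfolding l by (subst sum.swap) (simp add: algebra_simps)
  finally have l': "omega n v (N v') = - (\<Sum>i\<in>J. \<Sum>j\<in>J. v i * v' j * omega n (s j) (unit_v i))
      - (\<Sum>i\<in>J. v i * omega n (a i) v') - (\<Sum>i\<in>J. omega n (a i) v * v' i)" .
  have "omega n (s i) (unit_v j) - omega n (s j) (unit_v i) + omega n (s i) (s j) = 0"
    if ij: "i \<in> J" "j \<in> J" for i j
  proof -
    have "omega n (unit_v i) (unit_v j) = 0"
      unfolding omega_unit_left[OF JD(1)[OF ij(1)]] using ij JD(5)[OF ij(1)] by (auto simp: unit_v_def)
    moreover have "omega n (s i + unit_v i) (s j + unit_v j) = 0" using r(3)[OF ij] by simp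
    ultimately show ?thesis
      using omega_skew[of n "unit_v i" "s j"] by (simp add: omega_linear del: diff_add_cancel)
  qed
  then have "(\<Sum>i\<in>J. \<Sum>j\<in>J. v i * v' j *
      (omega n (s i) (unit_v j) - omega n (s j) (unit_v i) + omega n (s i) (s j))) = 0"
    by (intro sum.neutral ballI) simp
  then have "omega n (N v) v' + omega n v (N v') + omega n (N v) (N v') = 0"
    unfolding q unfolding l' unfolding l by (simp add: algebra_simps sum.distrib sum_subtractf)
  then show ?thesis by (simp add: omega_linear algebra_simps)
qed

lemma cell_shift_upper:
  assumes "l < x"
  shows "N (unit_v l) x = 0"
proof -
  have "unit_v l i * s i x = 0" if "i \<in> J" for i
    using r(1)[OF that] assms by (auto simp: unit_v_def reduced_at_def)
  moreover have "eps n i * omega n (a i) (unit_v l) * unit_v (bar n i) x = 0" if i: "i \<in> J" for i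
  proof (cases "x = bar n i \<and> 1 \<le> l")
    case True
    then have "l \<in> {1..2*n+2}" "bar n l > i" using assms JD[OF i] by (auto simp: bar_def)
    then show ?thesis using r(1)[OF i] by (simp add: omega_unit_right mid_part_def reduced_at_def)
  next
    case False
    have "omega n (a i) (unit_v 0) = 0" unfolding omega_eq
      by (intro sum.neutral) (auto simp: unit_v_def bar_def)
    then show ?thesis using False by (cases "l = 0") (auto simp: unit_v_def)
  qed
  ultimately show ?thesis unfolding cell_shift_apply by (simp add: sum.neutral)
qed

lemma cell_shift_Borel: "(\<lambda>v. v + N v) \<in> Borel n"
proof -
  have "Vector_Spaces.linear cscale cscale (\<lambda>v. v + N v)"
    unfolding Vector_Spaces.linear_iff
    using cvec.vector_space_axioms by (simp add: cell_shift_linear cvec.scale_right_distrib)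
  moreover have "bij_betw (\<lambda>v. v + N v) (E n) (E n)"
  proof (rule bij_betw_byWitness[of _ "\<lambda>v. v - N v + N (N v)"])
    show "\<forall>v\<in>E n. v + N v - N (v + N v) + N (N (v + N v)) = v"
      using N_cubed by (simp add: cell_shift_linear)
    show "\<forall>v\<in>E n. v - N v + N (N v) + N (v - N v + N (N v)) = v"
      using N_cubed by (simp add: cell_shift_linear cell_shift_diff)
    show "(\<lambda>v. v + N v) ` E n \<subseteq> E n"
      using cell_shift_E cvec.subspace_add[OF subspace_E] by auto
    show "(\<lambda>v. v - N v + N (N v)) ` E n \<subseteq> E n"
      using cell_shift_E cvec.subspace_add[OF subspace_E] cvec.subspace_diff[OF subspace_E] by auto
  qed
  moreover have "\<forall>i\<in>{1..2*n+1}. \<forall>j\<in>{1..2*n+1}. j < i \<longrightarrow> (unit_v j + N (unit_v j)) i = 0"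
    using cell_shift_upper by (auto simp: unit_v_def)
  ultimately show ?thesis
    using cell_shift_omega by (simp add: Borel_def Sp_odd_def)
qed

end

section \<open>Chains of irreducible closed sets inside a cell\<close>

definition cell_point :: "nat \<Rightarrow> nat set \<Rightarrow> (nat \<times> nat \<Rightarrow> complex) \<Rightarrow> cvec set" where
  "cell_point n J c = cvec.span (cell_row n J c ` J)"

lemma Borel_linear: "g \<in> Borel n \<Longrightarrow> Vector_Spaces.linear cscale cscale g"
  by (simp add: Borel_def Sp_odd_def)

lemma Borel_image_span: "g \<in> Borel n \<Longrightarrow> g ` cvec.span S = cvec.span (g ` S)"
proof -
  assume "g \<in> Borel n"
  then interpret g: Vector_Spaces.linear cscale cscale g by (rule Borel_linear)
  show ?thesis using g.span_image[of S] by simp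
qed

lemma cell_point_in_orbit:
  assumes "isotropic_set n J"
  shows "\<exists>g\<in>Borel n. cell_point n J c = g ` cvec.span (unit_v ` J)"
proof -
  let ?r = "cell_row n J c"
  let ?g = "\<lambda>v. v + cell_shift n J ?r v"
  have g: "?g \<in> Borel n"
    using assms by (intro cell_shift_Borel reduced_row row_in_E omega_rows)
  have "?g (unit_v i) = ?r i" if "i \<in> J" for i
    using cell_shift_unit[OF assms reduced_row row_in_E[OF assms] omega_rows[OF assms] that] by simp
  then have "?g ` unit_v ` J = ?r ` J" by (simp add: image_image cong: image_cong)
  then have "cell_point n J c = ?g ` cvec.span (unit_v ` J)"
    unfolding cell_point_def Borel_image_span[OF g] by simp
  then show ?thesis using g by blast
qed

lemma cell_point_IG: "isotropic_set n J \<Longrightarrow> card J = k \<Longrightarrow> cell_point n J c \<in> IG n k"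
  unfolding cell_point_def by (rule span_rows_IG)

lemma cell_point_plucker:
  assumes "isotropic_set n J" "card J = k"
  shows "minor n k (cell_rows n J c) \<in> plucker_coords n k (cell_point n J c)"
proof -
  have "cell_rows n J c ` {..<k} = cell_row n J c ` J"
    using image_nth_sorted[OF isotropic_set_finite[OF assms(1)] assms(2)]
    unfolding cell_rows_def by (metis image_image)
  then show ?thesis unfolding plucker_coords_def cell_point_def by force
qed

lemma cell_point_form_zero_iff:
  assumes "isotropic_set n J" "card J = k" "hom_poly d F"
  shows "F (plv n k (cell_point n J c)) = 0 \<longleftrightarrow> F (minor n k (cell_rows n J c)) = 0"
  using hom_poly_nonzero_iff[OF cell_point_IG[OF assms(1,2)] assms(3) cell_point_plucker[OF assms(1,2)]] by simp

lemma det_replaced_column: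
  assumes "m < k"
  shows "det (mat k k (\<lambda>(i, j). if j = m then x i else if i = j then 1 else 0)) = (x m :: complex)"
proof -
  have "mat k k (\<lambda>(i, j). if j = m then x i else if i = j then 1 else 0) =
      replace_col (1\<^sub>m k) (1\<^sub>m k *\<^sub>v vec k x) m"
    by (rule eq_matI) (auto simp: replace_col_def)
  then show ?thesis using cramer_lemma_mat[of "1\<^sub>m k" k "vec k x" m] assms by simp
qed

text \<open>Exchanging the pivot \<open>i\<close> for the column \<open>p\<close> gives a minor
  equal to the entry of row \<open>i\<close> at \<open>p\<close> up to a sign. So the vanishing of a
  parameter is cut out by a Pluecker coordinate.\<close>

lemma cell_minor_zero_iff:
  assumes J: "isotropic_set n J" "card J = k" and ip: "(i, p) \<in> cell_params n J"
  shows "minor n k (cell_rows n J c) (insert p (J - {i})) = 0 \<longleftrightarrow> c (i, p) = 0"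
proof -
  have fin: "finite J" using J(1) by (rule isotropic_set_finite)
  have i: "i \<in> J" "1 \<le> p" "p < i" "p \<notin> J" using ip by (auto simp: cell_params_def)
  let ?s = "\<lambda>m. sorted_list_of_set J ! m"
  define t where "t m = (if ?s m = i then p else ?s m)" for m
  have "i \<in> ?s ` {..<k}" unfolding image_nth_sorted[OF fin J(2)] by (rule i(1))
  then obtain m where m: "m < k" "?s m = i" by auto
  have sJ: "?s c \<in> J" if "c < k" for c using nth_sorted_mem[OF fin J(2) that] .
  have "t ` {..<k} = (\<lambda>j. if j = i then p else j) ` ?s ` {..<k}"
    unfolding image_image by (intro image_cong refl t_def)
  also have "\<dots> = insert p (J - {i})"
    unfolding image_nth_sorted[OF fin J(2)] using i(1) by auto
  finally have im: "t ` {..<k} = insert p (J - {i})" .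
  have "t c' \<in> {1..2*n+1}" if "c' < k" for c'
    using isotropic_setD[OF J(1) sJ[OF that]] isotropic_setD[OF J(1) i(1)] i by (auto simp: t_def)
  then obtain e where e: "\<And>b. tdet k b t = e * minor n k b (insert p (J - {i}))"
    using tdet_eq_minor[of k t n] im by auto
  have val: "tdet k (cell_rows n J c) t = c (i, p)" for c
  proof -
    have "mat k k (\<lambda>(r, c'). cell_rows n J c r (t c')) =
        mat k k (\<lambda>(r, c'). if c' = m then cell_row n J c (?s r) p else if r = c' then 1 else 0)"
    proof (rule eq_matI)
      fix r c' assume "r < dim_row (mat k k (\<lambda>(r, c'). if c' = m then cell_row n J c (?s r) p else if r = c' then 1 else 0))"
        "c' < dim_col (mat k k (\<lambda>(r, c'). if c' = m then cell_row n J c (?s r) p else if r = c' then 1 else 0))"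
      then have rc: "r < k" "c' < k" by auto
      have "cell_rows n J c r (t c') = (if c' = m then cell_row n J c (?s r) p else if r = c' then 1 else 0)"
      proof (cases "c' = m")
        case True
        then show ?thesis using m by (simp add: cell_rows_def t_def)
      next
        case False
        then have "?s c' \<noteq> i" using nth_sorted_eq_iff[OF fin J(2), of c' m] m rc by simp
        then show ?thesis
          using reduced_row[of J "?s r" n c] sJ rc nth_sorted_eq_iff[OF fin J(2), of c' r] False
          by (auto simp: cell_rows_def t_def reduced_at_def)
      qed
      then show "mat k k (\<lambda>(r, c'). cell_rows n J c r (t c')) $$ (r, c') =
          mat k k (\<lambda>(r, c'). if c' = m then cell_row n J c (?s r) p else if r = c' then 1 else 0) $$ (r, c')"
        using rc by simp
    qed auto
    then have "tdet k (cell_rows n J c) t = cell_row n J c (?s m) p"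
      unfolding tdet_def using det_replaced_column[OF m(1)] by simp
    then show ?thesis using m(2) row_free[OF ip] by simp
  qed
  have "e \<noteq> 0" using e[of "cell_rows n J (\<lambda>_. 1)"] val[of "\<lambda>_. 1"] by auto
  then show ?thesis using e[of "cell_rows n J c"] val[of c] by auto
qed

lemma polys_line:
  assumes "polys P e h"
  shows "\<exists>q. \<forall>s. h (\<lambda>x. u x + s * v x) = poly q s"
proof -
  obtain a where "\<And>c. h c = (\<Sum>\<alpha>\<in>P \<rightarrow>\<^sub>E {..e}. a \<alpha> * (\<Prod>x\<in>P. c x ^ \<alpha> x))"
    using assms by (auto simp: polys_def)
  then have "h (\<lambda>x. u x + s * v x) =
      poly (\<Sum>\<alpha>\<in>P \<rightarrow>\<^sub>E {..e}. Polynomial.smult (a \<alpha>) (\<Prod>x\<in>P. [:u x, v x:] ^ \<alpha> x)) s" for s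
    by (simp add: poly_sum poly_prod poly_power)
  then show ?thesis by blast
qed

text \<open>The set \<open>A\<close> contains the complex line through any two of its points. Forms
  that do not vanish at \<open>u\<close> and at \<open>v\<close> restrict to non-zero polynomials in
  one variable on that line, so their product cannot vanish along it.\<close>

lemma irreducible_closure_cell:
  assumes J: "isotropic_set n J" "card J = k"
    and A: "A \<noteq> {}" "\<And>u v s. u \<in> A \<Longrightarrow> v \<in> A \<Longrightarrow> (\<lambda>x. u x + s * (v x - u x)) \<in> A"
    and X: "closedin (zariski n k) X" "cell_point n J ` A \<subseteq> X"
  shows "irreducible_closed (subtopology (zariski n k) X) ((zariski n k) closure_of (cell_point n J ` A))"
  unfolding irreducible_closed_def
proof (intro conjI allI impI)
  let ?Z = "(zariski n k) closure_of (cell_point n J ` A)"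
  have ZX: "?Z \<subseteq> X" using X by (intro closure_of_minimal)
  show "closedin (subtopology (zariski n k) X) ?Z"
    using ZX by (auto simp: closedin_subtopology intro!: exI[of _ ?Z])
  have pts: "cell_point n J ` A \<subseteq> IG n k" using cell_point_IG[OF J] by auto
  then have sub: "cell_point n J ` A \<subseteq> ?Z" by (intro closure_of_subset) (simp add: topspace_zariski)
  then show "?Z \<noteq> {}" using A(1) by blast
  fix B C assume BC: "closedin (subtopology (zariski n k) X) B \<and> closedin (subtopology (zariski n k) X) C \<and> ?Z \<subseteq> B \<union> C"
  have closedX: "closedin (zariski n k) D" if "closedin (subtopology (zariski n k) X) D" for D
    using that X(1) closedin_trans_full by blast
  show "?Z \<subseteq> B \<or> ?Z \<subseteq> C"
  proof (rule ccontr)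
    assume contra: "\<not> (?Z \<subseteq> B \<or> ?Z \<subseteq> C)"
    then have "\<not> cell_point n J ` A \<subseteq> B" "\<not> cell_point n J ` A \<subseteq> C"
      using closure_of_minimal closedX BC by blast+
    then obtain u v where uv: "u \<in> A" "v \<in> A" "cell_point n J u \<notin> B" "cell_point n J v \<notin> C" by blast
    obtain d F where F: "hom_poly d F" "F (plv n k (cell_point n J u)) \<noteq> 0" "\<And>W. W \<in> B \<Longrightarrow> F (plv n k W) = 0"
      by (rule closed_separation[of n k X B "cell_point n J u"]) (use BC uv X(2) pts in auto)
    obtain d' G where G: "hom_poly d' G" "G (plv n k (cell_point n J v)) \<noteq> 0" "\<And>W. W \<in> C \<Longrightarrow> G (plv n k W) = 0"
      by (rule closed_separation[of n k X C "cell_point n J v"]) (use BC uv X(2) pts in auto)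
    let ?c = "\<lambda>s x. u x + s * (v x - u x)"
    obtain p where p: "\<And>s. F (minor n k (cell_rows n J (?c s))) = poly p s"
      using polys_line[OF polys_rows_form[OF J F(1)], of u "\<lambda>x. v x - u x"] by blast
    obtain q where q: "\<And>s. G (minor n k (cell_rows n J (?c s))) = poly q s"
      using polys_line[OF polys_rows_form[OF J G(1)], of u "\<lambda>x. v x - u x"] by blast
    have "poly p 0 \<noteq> 0"
      using F(2) cell_point_form_zero_iff[OF J F(1), of u] p[of 0] by simp
    moreover have "poly q 1 \<noteq> 0"
      using G(2) cell_point_form_zero_iff[OF J G(1), of v] q[of 1] by simp
    ultimately have "p * q \<noteq> 0" by auto
    moreover have "poly (p * q) s = 0" for s
    proof -
      have "cell_point n J (?c s) \<in> B \<union> C" using A(2)[OF uv(1,2)] sub BC by blast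
      then show ?thesis
        using F(3) G(3) cell_point_form_zero_iff[OF J F(1), of "?c s"] cell_point_form_zero_iff[OF J G(1), of "?c s"] p q
        by auto
    qed
    ultimately show False using poly_all_0_iff_0 by blast
  qed
qed

text \<open>A flag of coordinate subspaces in the parameter space gives the chain; the minors of
  \<open>cell_minor_zero_iff\<close> keep consecutive closures apart.\<close>

lemma dim_ge_cell:
  assumes J: "isotropic_set n J" "card J = k"
    and X: "closedin (zariski n k) X" "range (cell_point n J) \<subseteq> X"
  shows "card (cell_params n J) \<le> dim_IG n k X"
proof -
  define m where "m = card (cell_params n J)"
  have fin: "finite (cell_params n J)" using J isotropic_set_finite finite_cell_params by blast
  obtain e where e: "bij_betw e {0..<m} (cell_params n J)"
    using ex_bij_betw_nat_finite[OF fin] unfolding m_def by blast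
  \<comment> \<open>The parameters with number at least \<open>t\<close> are set to 0; those outside
    \<open>cell_params n J\<close> stay arbitrary, as they do not influence the minors
    tested.\<close>
  define A where "A t = {c :: nat \<times> nat \<Rightarrow> complex. \<forall>j<m. t \<le> j \<longrightarrow> c (e j) = 0}" for t
  define Z where "Z t = (zariski n k) closure_of (cell_point n J ` A t)" for t
  have "m \<le> dim_IG n k X"
  proof (rule dim_IG_ge)
    show "X \<subseteq> IG n k" using closedin_subset[OF X(1)] by (simp add: topspace_zariski)
    fix t
    show "irreducible_closed (subtopology (zariski n k) X) (Z t)"
      unfolding Z_def
      by (rule irreducible_closure_cell[OF J _ _ X(1)]) (use X(2) in \<open>auto simp: A_def\<close>)
  next
    fix t assume t: "t < m"
    obtain i p where ip: "e t = (i, p)" by (cases "e t")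
    have ip': "(i, p) \<in> cell_params n J" using e t ip by (force simp: bij_betw_def)
    let ?F = "\<lambda>y :: nat set \<Rightarrow> complex. y (insert p (J - {i}))"
    have F: "hom_poly 1 ?F" by (rule hom_poly.coord)
    have F_iff: "?F (plv n k (cell_point n J c)) = 0 \<longleftrightarrow> c (i, p) = 0" for c
      using cell_point_form_zero_iff[OF J F, of c] cell_minor_zero_iff[OF J ip', of c] by simp
    define c where "c = (\<lambda>x. if x = e t then 1 else 0 :: complex)"
    have "e j \<noteq> e t" if "j < m" "Suc t \<le> j" for j
      using inj_onD[OF bij_betw_imp_inj_on[OF e], of j t] that t by auto
    then have "c \<in> A (Suc t)" by (auto simp: A_def c_def)
    then have "cell_point n J c \<in> Z (Suc t)"
      unfolding Z_def using cell_point_IG[OF J]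
      by (intro subsetD[OF closure_of_subset]) (auto simp: topspace_zariski)
    moreover have "cell_point n J c \<notin> Z t"
    proof
      assume "cell_point n J c \<in> Z t"
      then have "?F (plv n k (cell_point n J c)) = 0"
        unfolding Z_def by (rule zariski_closure_zero[OF F, rotated]) (use F_iff t ip in \<open>auto simp: A_def\<close>)
      then show False using F_iff[of c] ip by (simp add: c_def)
    qed
    moreover have "Z t \<subseteq> Z (Suc t)"
      unfolding Z_def by (intro closure_of_mono image_mono) (auto simp: A_def)
    ultimately show "Z t \<subset> Z (Suc t)" by blast
  qed
  then show ?thesis by (simp add: m_def)
qed

section \<open>Jump sets occurring in a Schubert variety\<close>

definition pivot_set :: "nat \<Rightarrow> (nat \<Rightarrow> nat) \<Rightarrow> nat set" where
  "pivot_set k w = w ` {1..k}"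

lemma pivot_set_isotropic:
  assumes "w \<in> W_odd n" "k \<le> n + 1"
  shows "isotropic_set n (pivot_set k w)" "card (pivot_set k w) = k"
proof -
  have w: "w permutes {1..2*n+2}" "\<And>i. i \<in> {1..2*n+2} \<Longrightarrow> w (bar n i) = bar n (w i)"
    and odd: "\<And>j. j \<in> {1..n+1} \<Longrightarrow> w j \<noteq> bar n 1"
    using assms(1) by (auto simp: W_odd_def signed_perms_def)
  show "card (pivot_set k w) = k"
    unfolding pivot_set_def using permutes_inj_on[OF w(1), of "{1..k}"] by (simp add: card_image)
  show "isotropic_set n (pivot_set k w)"
    unfolding isotropic_set_def pivot_set_def
  proof (intro conjI subsetI ballI notI)
    fix x assume "x \<in> w ` {1..k}"
    then obtain j where j: "j \<in> {1..k}" "x = w j" by blast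
    then have "w j \<in> {1..2*n+2}" "w j \<noteq> 2 * n + 2"
      using permutes_in_image[OF w(1), of j] odd[of j] assms(2) by (auto simp: bar_def)
    then show "x \<in> {1..2*n+1}" using j by auto
  next
    fix x assume "x \<in> w ` {1..k}" "bar n x \<in> w ` {1..k}"
    then obtain i j where ij: "i \<in> {1..k}" "x = w i" "j \<in> {1..k}" "bar n x = w j" by blast
    then have "w (bar n i) = w j" using w(2)[of i] assms(2) by auto
    then have "bar n i = j" using permutes_inj[OF w(1)] by (simp add: inj_eq)
    then show False using ij assms(2) by (auto simp: bar_def)
  qed
qed

lemma schubert_closed: "closedin (zariski n k) (schubert n k w)"
  unfolding schubert_def by (rule closedin_closure_of)

lemma schubert_alt: "schubert n k w = (zariski n k) closure_of
    {g ` cvec.span (unit_v ` pivot_set k w) | g. g \<in> Borel n}"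
  by (simp add: schubert_def pivot_set_def image_image)

lemma dim_schubert_ge:
  assumes "w \<in> W_odd n" "k \<le> n + 1"
  shows "card (cell_params n (pivot_set k w)) \<le> dim_IG n k (schubert n k w)"
proof (rule dim_ge_cell[OF pivot_set_isotropic[OF assms] schubert_closed])
  let ?O = "{g ` cvec.span (unit_v ` pivot_set k w) | g. g \<in> Borel n}"
  have "cell_point n (pivot_set k w) c \<in> IG n k \<inter> ?O" for c
    using cell_point_in_orbit[OF pivot_set_isotropic(1)[OF assms], of c] cell_point_IG[OF pivot_set_isotropic[OF assms]]
    by auto
  then show "range (cell_point n (pivot_set k w)) \<subseteq> schubert n k w"
    unfolding schubert_alt
    using closure_of_subset_Int[of "zariski n k" ?O] by (auto simp: topspace_zariski)
qed

lemma count_gt_nth: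
  assumes "finite J" "card J = k"
  shows "count_gt J q = card {m. m < k \<and> q < sorted_list_of_set J ! m}"
proof -
  have "{j \<in> J. q < j} = (\<lambda>m. sorted_list_of_set J ! m) ` {m. m < k \<and> q < sorted_list_of_set J ! m}"
    using image_nth_sorted[OF assms] by auto
  then show ?thesis unfolding count_gt_def
    using nth_sorted_eq_iff[OF assms] by (auto simp: inj_on_def intro!: card_image)
qed

text \<open>The Pluecker coordinate at \<open>jumps V\<close> is non-zero at \<open>V\<close>, hence
  somewhere on the orbit. There the basis comes from an upper triangular map, and a non-zero term of
  the determinant is a matching \<open>p\<close> of pivots with \<open>?t (p m) \<le> ?s m\<close>,
  which gives the Bruhat comparison.\<close>

lemma schubert_jumps:
  assumes w: "w \<in> W_odd n" "k \<le> n + 1" and V: "V \<in> schubert n k w"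
  shows "bruhat_le (jumps V) (pivot_set k w)"
proof -
  define I where "I = pivot_set k w"
  have I: "isotropic_set n I" "card I = k" using pivot_set_isotropic[OF w] by (auto simp: I_def)
  have finI: "finite I" using I(1) by (rule isotropic_set_finite)
  have VI: "V \<in> IG n k" using V closedin_subset[OF schubert_closed] by (auto simp: topspace_zariski)
  define J where "J = jumps V"
  have J: "isotropic_set n J" "card J = k" using isotropic_jumps[OF VI] card_jumps_IG[OF VI] by (auto simp: J_def)
  have finJ: "finite J" using J(1) by (rule isotropic_set_finite)
  let ?F = "\<lambda>y :: nat set \<Rightarrow> complex. y J"
  let ?O = "{g ` cvec.span (unit_v ` I) | g. g \<in> Borel n}"
  have F: "hom_poly 1 ?F" by (rule hom_poly.coord)
  have "?F (plv n k V) \<noteq> 0" using plv_jumps[OF VI] by (simp add: J_def)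
  then have "\<exists>U\<in>?O. U \<in> IG n k \<and> ?F (plv n k U) \<noteq> 0"
    using zariski_closure_zero[OF F, of ?O n k V] V unfolding schubert_alt I_def by blast
  then obtain g where g: "g \<in> Borel n" "g ` cvec.span (unit_v ` I) \<in> IG n k"
    "?F (plv n k (g ` cvec.span (unit_v ` I))) \<noteq> 0" by blast
  let ?s = "\<lambda>m. sorted_list_of_set I ! m" and ?t = "\<lambda>m. sorted_list_of_set J ! m"
  define b where "b m = g (unit_v (?s m))" for m
  have "b ` {..<k} = g ` unit_v ` I"
    using image_nth_sorted[OF finI I(2)] unfolding b_def by (metis image_image)
  then have "minor n k b \<in> plucker_coords n k (g ` cvec.span (unit_v ` I))"
    unfolding plucker_coords_def Borel_image_span[OF g(1)] by auto
  then have nz: "minor n k b J \<noteq> 0" using hom_poly_nonzero_iff[OF g(2) F] g(3) by blast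
  have "minor n k b J = det (mat k k (\<lambda>(r, c). b r (?t c)))"
    using J by (simp add: minor_def isotropic_set_def)
  also have "\<dots> = (\<Sum>p\<in>{p. p permutes {0..<k}}. signof p * (\<Prod>i\<in>{0..<k}. mat k k (\<lambda>(r, c). b r (?t c)) $$ (i, p i)))"
    by (rule det_def') simp
  finally obtain p where p: "p permutes {0..<k}" "(\<Prod>i\<in>{0..<k}. mat k k (\<lambda>(r, c). b r (?t c)) $$ (i, p i)) \<noteq> 0"
    using nz by (metis (mono_tags, lifting) mem_Collect_eq mult_zero_right sum.neutral)
  have pk: "p m < k" if "m < k" for m using permutes_in_image[OF p(1), of m] that by simp
  have le: "?t (p m) \<le> ?s m" if m: "m < k" for m
  proof (rule ccontr)
    assume "\<not> ?t (p m) \<le> ?s m"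
    then have "b m (?t (p m)) = 0"
      using g(1) nth_sorted_mem[OF finI I(2) m] nth_sorted_mem[OF finJ J(2) pk[OF m]]
        isotropic_setD(1,2)[OF I(1)] isotropic_setD(1,2)[OF J(1)]
      unfolding b_def Borel_def by auto
    moreover have "mat k k (\<lambda>(r, c). b r (?t c)) $$ (m, p m) \<noteq> 0"
      using p(2) m by (auto simp: prod_zero_iff)
    ultimately show False using m pk[OF m] by simp
  qed
  have "count_gt J q \<le> count_gt I q" for q
  proof -
    have "p ` {m. m < k \<and> q < ?t (p m)} = {m. m < k \<and> q < ?t m}"
    proof
      show "p ` {m. m < k \<and> q < ?t (p m)} \<subseteq> {m. m < k \<and> q < ?t m}" using pk by auto
      show "{m. m < k \<and> q < ?t m} \<subseteq> p ` {m. m < k \<and> q < ?t (p m)}"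
      proof
        fix m assume "m \<in> {m. m < k \<and> q < ?t m}"
        moreover from this have "m \<in> p ` {0..<k}" using permutes_image[OF p(1)] by simp
        ultimately show "m \<in> p ` {m. m < k \<and> q < ?t (p m)}" by auto
      qed
    qed
    then have "count_gt J q = card (p ` {m. m < k \<and> q < ?t (p m)})"
      by (simp add: count_gt_nth[OF finJ J(2)])
    also have "\<dots> = card {m. m < k \<and> q < ?t (p m)}"
      by (rule card_image[OF permutes_inj_on[OF p(1)]])
    also have "\<dots> \<le> card {m. m < k \<and> q < ?s m}"
      using le by (intro card_mono) (auto intro: less_le_trans)
    finally show ?thesis by (simp add: count_gt_nth[OF finI I(2)])
  qed
  then show ?thesis using I J by (simp add: bruhat_le_def I_def J_def)
qed

text \<open>The Bruhat comparison at threshold 1 puts 1 into every jump set, and the reduced vector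
  with leading index 1 is \<open>unit_v 1\<close>. The contrapositive serves the strict
  estimate.\<close>

lemma schubert_in_closed_orbit:
  assumes w: "w \<in> W_odd n" "k \<le> n + 1" "1 \<le> k" and 1: "1 \<in> pivot_set k w"
  shows "schubert n k w \<subseteq> closed_orbit n k"
proof
  fix V assume V: "V \<in> schubert n k w"
  have VI: "V \<in> IG n k" using V closedin_subset[OF schubert_closed] by (auto simp: topspace_zariski)
  note VD = IG_D[OF VI]
  define I where "I = pivot_set k w"
  have I: "isotropic_set n I" "card I = k" using pivot_set_isotropic[OF w(1,2)] by (auto simp: I_def)
  have fin: "finite I" "finite (jumps V)"
    using I isotropic_set_finite finite_jumps[OF VD(1,2)] by blast+
  have "count_gt I 1 < card I"
    unfolding count_gt_def using 1 fin(1) by (intro psubset_card_mono) (auto simp: I_def)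
  then have "count_gt (jumps V) 1 < k"
    using schubert_jumps[OF w(1,2) V] I unfolding bruhat_le_def I_def by (metis le_less_trans)
  moreover have "count_gt (jumps V) 1 = k" if "1 \<notin> jumps V"
  proof -
    have "{i \<in> jumps V. 1 < i} = jumps V"
      using that isotropic_setD(1)[OF isotropic_jumps[OF VI]] by (force simp: le_less)
    then show ?thesis using card_jumps_IG[OF VI] by (simp add: count_gt_def)
  qed
  ultimately have "1 \<in> jumps V" by blast
  note r = red[OF VD(1,2) this]
  have "red V 1 = unit_v 1"
  proof
    fix x
    show "red V 1 x = unit_v 1 x"
      using r VD(2) by (cases "x = 0") (auto simp: reduced_at_def unit_v_def E_def)
  qed
  then show "V \<in> closed_orbit n k" using r(1) VI by (simp add: closed_orbit_def)
qed


section \<open>Degree and jump sets\<close>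

lemma det_linear_cols:
  assumes "finite Q"
  shows "det (mat k k (\<lambda>(r, c). \<Sum>q\<in>Q. M c q * b r q)) =
    (\<Sum>t\<in>{0..<k} \<rightarrow>\<^sub>E Q. (\<Prod>c\<in>{0..<k}. M c (t c)) * tdet k b t)"
proof -
  let ?P = "{p. p permutes {0..<k}}"
  have "det (mat k k (\<lambda>(r, c). \<Sum>q\<in>Q. M c q * b r q)) =
      (\<Sum>p\<in>?P. signof p * (\<Prod>c\<in>{0..<k}. \<Sum>q\<in>Q. M c q * b (p c) q))"
    by (subst det_col[of _ k]) (auto intro!: sum.cong prod.cong simp: permutes_in_image)
  also have "\<dots> = (\<Sum>p\<in>?P. \<Sum>t\<in>{0..<k} \<rightarrow>\<^sub>E Q. (\<Prod>c\<in>{0..<k}. M c (t c)) *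
      (signof p * (\<Prod>c\<in>{0..<k}. b (p c) (t c))))"
    using assms by (simp add: prod_sum_PiE prod.distrib sum_distrib_left mult.left_commute)
  also have "\<dots> = (\<Sum>t\<in>{0..<k} \<rightarrow>\<^sub>E Q. (\<Prod>c\<in>{0..<k}. M c (t c)) *
      (\<Sum>p\<in>?P. signof p * (\<Prod>c\<in>{0..<k}. b (p c) (t c))))"
    by (subst sum.swap) (simp add: sum_distrib_left)
  moreover have "(\<Sum>p\<in>?P. signof p * (\<Prod>c\<in>{0..<k}. b (p c) (t c))) = tdet k b t" for t
    unfolding tdet_def
    by (subst det_col[of _ k]) (auto intro!: sum.cong prod.cong simp: permutes_in_image)
  ultimately show ?thesis by (simp only:)
qed

lemma form_at_sum: "form_at d (\<Sum>a\<in>A. Polynomial.smult (u a) (F a)) x = (\<Sum>a\<in>A. u a * form_at d (F a) x)"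
  by (cases x) (simp_all add: form_at_def poly_sum coeff_sum)

lemma degree_sum_smult_le:
  "finite A \<Longrightarrow> (\<And>a. a \<in> A \<Longrightarrow> degree (F a) \<le> d) \<Longrightarrow> degree (\<Sum>a\<in>A. Polynomial.smult (u a) (F a)) \<le> d"
  by (intro degree_sum_le) (use degree_smult_le le_trans in blast)+

text \<open>Let \<open>I\<close> and \<open>J\<close> be the jump sets at the points \<open>z\<close> and \<open>y\<close>. The linear forms \<open>M p\<close>, \<open>p \<in> J\<close>, are
  a coordinate system on \<open>f y\<close>, and those with \<open>p \<notin> I\<close> vanish on \<open>f z\<close>. Hence their determinant on
  \<open>f t\<close>, a polynomial in \<open>t\<close> of degree at most \<open>d\<close>, is non-zero and vanishes to order
  \<open>card (J - I)\<close> at \<open>z\<close>.\<close>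

lemma P1_map_jumps_finite_point:
  assumes f: "f \<in> P1_maps n k d"
  shows "card (jumps (f y) - jumps (f (Some z))) \<le> d"
proof -
  have IG: "f x \<in> IG n k" for x using f by (auto simp: P1_maps_def)
  obtain F where F: "\<And>I. degree (F I) \<le> d"
    "\<And>x. (\<lambda>I. form_at d (F I) x) \<in> plucker_coords n k (f x)"
    using f by (auto simp: P1_maps_def)
  have "\<exists>b. (\<lambda>I. form_at d (F I) x) = minor n k b \<and> cvec.span (b ` {..<k}) = f x" for x
    using F(2)[of x] by (auto simp: plucker_coords_def)
  then obtain b where b: "\<And>x. (\<lambda>I. form_at d (F I) x) = minor n k (b x)" "\<And>x. cvec.span (b x ` {..<k}) = f x"
    by metis
  have bF: "minor n k (b x) I = form_at d (F I) x" for x I using b(1)[of x] by (simp add: fun_eq_iff)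
  define I J where "I = jumps (f (Some z))" and "J = jumps (f y)"
  note ID = IG_D[OF IG[of "Some z"]] and JD = IG_D[OF IG[of y]]
  have I: "isotropic_set n I" "card I = k" "finite I" and J: "isotropic_set n J" "card J = k" "finite J"
    using isotropic_jumps[OF IG] card_jumps_IG[OF IG] isotropic_set_finite by (auto simp: I_def J_def)
  define Q where "Q = {1..2 * n + 1}"
  have IQ: "I \<subseteq> Q" and JQ: "J \<subseteq> Q" and finQ: "finite Q"
    using I(1) J(1) by (auto simp: isotropic_set_def Q_def)
  define r where "r = red (f (Some z))"
  \<comment> \<open>For \<open>p \<notin> I\<close> the form subtracts from the coordinate
    \<open>p\<close> its expression through the coordinates at \<open>I\<close>, which is valid on
    the subspace at \<open>z\<close> by \<open>expand_red\<close>.\<close>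
  define M where "M p q = (if q = p then 1 else 0) - (if p \<notin> I \<and> q \<in> I then r q p else 0)" for p q
  define \<phi> where "\<phi> p v = (\<Sum>q\<in>Q. M p q * v q)" for p and v :: cvec
  have \<phi>: "\<phi> p v = v p - (if p \<notin> I then \<Sum>q\<in>I. r q p * v q else 0)" if "p \<in> Q" for p v
  proof -
    have "\<phi> p v = (\<Sum>q\<in>Q. (if q = p then v p else 0)) - (\<Sum>q\<in>Q. if q \<in> I then (if p \<notin> I then r q p * v q else 0) else 0)"
      unfolding \<phi>_def sum_subtractf[symmetric] by (intro sum.cong) (auto simp: M_def algebra_simps)
    also have "(\<Sum>q\<in>Q. if q \<in> I then (if p \<notin> I then r q p * v q else 0) else 0) = (\<Sum>q\<in>I. if p \<notin> I then r q p * v q else 0)"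
      using IQ finQ by (subst sum.inter_restrict[symmetric]) (auto simp: Int_absorb1)
    finally show ?thesis using that finQ by simp
  qed
  let ?sI = "\<lambda>m. sorted_list_of_set I ! m" and ?sJ = "\<lambda>m. sorted_list_of_set J ! m"
  have sI: "?sI m \<in> I" if "m < k" for m using nth_sorted_mem[OF I(3,2) that] .
  have sJ: "?sJ m \<in> J" if "m < k" for m using nth_sorted_mem[OF J(3,2) that] .
  define D where "D v = det (mat k k (\<lambda>(m, c). \<phi> (?sJ c) (v m)))" for v
  define C where "C t = (\<Prod>c\<in>{0..<k}. M (?sJ c) (t c))" for t
  have D: "D v = (\<Sum>t\<in>{0..<k} \<rightarrow>\<^sub>E Q. C t * tdet k v t)" for v
    unfolding D_def \<phi>_def C_def by (rule det_linear_cols[OF finQ])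
  have "\<exists>e. \<forall>t. (\<forall>c<k. t c \<in> Q) \<longrightarrow> (\<forall>b. tdet k b t = e t * minor n k b (t ` {..<k}))"
    using tdet_eq_minor[of k _ n] by (intro choice) (auto simp: Q_def)
  then obtain e where e: "\<And>t b. (\<And>c. c < k \<Longrightarrow> t c \<in> Q) \<Longrightarrow> tdet k b t = e t * minor n k b (t ` {..<k})"
    by blast
  \<comment> \<open>The determinant \<open>D\<close> is a fixed linear combination of minors, so on
    the curve it is a form of degree at most \<open>d\<close>, although the bases \<open>b x\<close>
    need not depend polynomially on \<open>x\<close>.\<close>
  define G where "G = (\<Sum>t\<in>{0..<k} \<rightarrow>\<^sub>E Q. Polynomial.smult (C t * e t) (F (t ` {..<k})))"
  have degG: "degree G \<le> d" unfolding G_def using finQ by (intro degree_sum_smult_le F(1) finite_PiE) auto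
  have G: "form_at d G x = D (b x)" for x
    unfolding G_def form_at_sum D
    by (rule sum.cong[OF refl]) (use e[of _ "b x"] bF in \<open>auto simp: PiE_iff\<close>)

  have "form_at d G y \<noteq> 0"
  proof -
    let ?r' = "\<lambda>m. red (f y) (?sJ m)"
    have r': "reduced_at J (?sJ m) (?r' m)" if "m < k" for m
      using red(2)[OF JD(1,2)] sJ[OF that] by (simp add: J_def)
    \<comment> \<open>The correction in \<open>\<phi> p\<close> involves only \<open>q > p\<close>,
      beyond the support of a vector with leading index \<open>j \<le> p\<close>. So the matrix of
      the forms on the reduced basis of \<open>f y\<close> is unitriangular.\<close>
    have \<phi>r': "\<phi> p (red (f y) j) = (if p = j then 1 else 0)" if p: "p \<in> J" "j \<in> J" "j \<le> p" for p j
    proof -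
      have "reduced_at J j (red (f y) j)" using red(2)[OF JD(1,2)] p by (simp add: J_def)
      moreover have "r q p * red (f y) j q = 0" if "q \<in> I" "p \<notin> I" for q
      proof (cases "q < p")
        case True
        then show ?thesis using red(2)[OF ID(1,2)] that by (simp add: r_def I_def reduced_at_def)
      next
        case False
        then have "j < q" using that p by (cases "q = p") auto
        then show ?thesis using red(2)[OF JD(1,2)] p by (simp add: J_def reduced_at_def)
      qed
      then have "p \<notin> I \<Longrightarrow> (\<Sum>q\<in>I. r q p * red (f y) j q) = 0" by (intro sum.neutral) auto
      ultimately show ?thesis using p JQ by (auto simp: \<phi> reduced_at_def)
    qed
    have "D ?r' = prod_list (diag_mat (mat k k (\<lambda>(m, c). \<phi> (?sJ c) (?r' m))))"
      unfolding D_def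
    proof (rule det_lower_triangular[of k])
      fix i j assume ij: "i < j" "j < k"
      have "?sJ i \<le> ?sJ j" using ij J by (intro sorted_nth_mono) auto
      moreover have "?sJ i \<noteq> ?sJ j" using nth_sorted_eq_iff[OF J(3,2), of i j] ij by simp
      ultimately show "mat k k (\<lambda>(m, c). \<phi> (?sJ c) (?r' m)) $$ (i, j) = 0"
        using \<phi>r'[OF sJ sJ] ij by simp
    qed simp
    also have "\<dots> = (\<Prod>m=0..<k. 1)"
      unfolding prod_list_diag_prod using \<phi>r'[OF sJ sJ] by (intro prod.cong) auto
    finally have "D ?r' = 1" by simp
    moreover obtain t where "\<And>\<tau>. tdet k ?r' \<tau> = t * tdet k (b y) \<tau>"
      using minor_proportional[OF IG b(2)[of y], of ?r'] span_red_nth[OF IG, of y] by (auto simp: J_def)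
    then have "D ?r' = t * D (b y)" by (simp add: D sum_distrib_left mult.left_commute)
    ultimately show ?thesis using G[of y] by auto
  qed
  then have "G \<noteq> 0" by (cases y) (auto simp: form_at_def)

  have FIz: "poly (F I) z \<noteq> 0"
  proof -
    obtain t where "t \<noteq> 0" "(\<lambda>I. form_at d (F I) (Some z)) = (\<lambda>I. t * plv n k (f (Some z)) I)"
      using plucker_proportional[OF IG F(2)] by blast
    then show ?thesis using plv_jumps[OF IG, of "Some z"] by (auto simp: form_at_def I_def fun_eq_iff)
  qed
  \<comment> \<open>Cramer's rule: \<open>R m p\<close> is \<open>F I\<close> times the entry
    \<open>p\<close> of the \<open>m\<close>-th vector of the basis normalised to the identity in
    the columns \<open>I\<close>. This yields polynomial rows wherever \<open>F I\<close> is
    non-zero.\<close>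
  define R where "R m p = (if p \<in> Q then Polynomial.smult (e (?sI(m := p))) (F (?sI(m := p) ` {..<k})) else 0)" for m p
  have R: "poly (R m p) t = tdet k (b (Some t)) (?sI(m := p))" if "m < k" "p \<in> Q" for m p t
  proof -
    have "tdet k (b (Some t)) (?sI(m := p)) = e (?sI(m := p)) * minor n k (b (Some t)) (?sI(m := p) ` {..<k})"
      using sI IQ that by (intro e) auto
    then show ?thesis using that bF[of "Some t"] by (simp add: R_def form_at_def)
  qed
  have normal: "\<exists>b'. (\<forall>m<k. b' m \<in> f (Some t)) \<and> D (b (Some t)) = poly (F I) t * D b' \<and>
      (\<forall>m<k. \<forall>p\<in>Q. poly (R m p) t = poly (F I) t * b' m p)" if nz: "poly (F I) t \<noteq> 0" for t
  proof -
    let ?b = "b (Some t)"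
    define B where "B = mat k k (\<lambda>(m, c). ?b m (?sI c))"
    have B: "B \<in> carrier_mat k k" by (simp add: B_def)
    have detB: "det B = poly (F I) t"
      using bF[of "Some t" I] I by (simp add: minor_def B_def form_at_def isotropic_set_def)
    define A where "A = (1 / det B) \<cdot>\<^sub>m adj_mat B"
    have A: "A \<in> carrier_mat k k" using adj_mat(1)[OF B] by (simp add: A_def)
    have "A * B = (1 / det B) \<cdot>\<^sub>m (det B \<cdot>\<^sub>m 1\<^sub>m k)"
      using adj_mat(1,3)[OF B] B by (simp add: A_def mult_smult_assoc_mat[OF adj_mat(1)[OF B] B])
    also have "\<dots> = 1\<^sub>m k" using nz detB by (intro eq_matI) auto
    finally have AB: "A * B = 1\<^sub>m k" .
    define b' where "b' m = (\<Sum>s<k. cscale (A $$ (m, s)) (?b s))" for m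
    have tdb': "tdet k b' \<tau> = det A * tdet k ?b \<tau>" for \<tau>
    proof -
      have "mat k k (\<lambda>(r, s). A $$ (r, s)) = A" using A by (intro eq_matI) auto
      then show ?thesis using tdet_change[of k b' "\<lambda>m s. A $$ (m, s)" ?b \<tau>] by (simp add: b'_def)
    qed
    have delta: "b' m (?sI c) = (if m = c then 1 else 0)" if "m < k" "c < k" for m c
    proof -
      have "b' m (?sI c) = (A * B) $$ (m, c)"
        using A B that by (simp add: b'_def sum_fun_apply cscale_def scalar_prod_def B_def lessThan_atLeast0)
      then show ?thesis using AB that by simp
    qed
    have "det A * det B = 1" using det_mult[OF A B] AB by simp
    then have detA: "poly (F I) t * det A = 1" using detB by (simp add: mult.commute)
    have "b' m \<in> f (Some t)" for m
    proof -
      have "?b s \<in> f (Some t)" if "s < k" for s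
        using b(2)[of "Some t"] that by (metis cvec.span_base image_eqI lessThan_iff)
      then show ?thesis
        unfolding b'_def using IG_D(1)[OF IG[of "Some t"]]
        by (intro cvec.subspace_sum cvec.subspace_scale) auto
    qed
    moreover have "D b' = det A * D ?b" by (simp add: D tdb' sum_distrib_left mult.left_commute)
    then have "D ?b = poly (F I) t * D b'" using detA by (simp add: mult.assoc[symmetric])
    moreover have "poly (R m p) t = poly (F I) t * b' m p" if m: "m < k" "p \<in> Q" for m p
    proof -
      have "mat k k (\<lambda>(r, c). b' r ((?sI(m := p)) c)) =
          mat k k (\<lambda>(i, j). if j = m then b' i p else if i = j then 1 else 0)"
        using delta by (intro eq_matI) auto
      then have "tdet k b' (?sI(m := p)) = b' m p"
        unfolding tdet_def using det_replaced_column[OF m(1), of "\<lambda>i. b' i p"] by simp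
      then have "poly (F I) t * b' m p = (poly (F I) t * det A) * tdet k ?b (?sI(m := p))"
        using tdb'[of "?sI(m := p)"] by (simp only: mult.assoc)
      then show ?thesis using R[OF m] detA by simp
    qed
    ultimately show ?thesis by blast
  qed

  define PM where "PM = mat k k (\<lambda>(m, c). \<Sum>q\<in>Q. Polynomial.smult (M (?sJ c) q) (R m q))"
  have PM: "PM \<in> carrier_mat k k" by (simp add: PM_def)
  have PMt: "poly (PM $$ (m, c)) t = \<phi> (?sJ c) (\<lambda>q. poly (R m q) t)" if "m < k" "c < k" for m c t
    using that by (simp add: PM_def \<phi>_def poly_sum)
  have \<phi>_scale: "\<phi> p (\<lambda>q. a * v q) = a * \<phi> p v" for p a and v :: cvec
    by (simp add: \<phi>_def sum_distrib_left mult.left_commute)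
  have \<phi>_cong: "\<phi> p v = \<phi> p v'" if "\<And>q. q \<in> Q \<Longrightarrow> v q = v' q" for p and v v' :: cvec
    unfolding \<phi>_def using that by (intro sum.cong) auto
  \<comment> \<open>With \<open>b'\<close> the normalised basis, \<open>G\<close> is
    \<open>F I\<close> times \<open>D b'\<close>, and \<open>det PM\<close> is the
    \<open>k\<close>-th power of \<open>F I\<close> times \<open>D b'\<close>.\<close>
  have ident: "poly (F I ^ k * G) t = poly (F I * det PM) t" if nz: "poly (F I) t \<noteq> 0" for t
  proof -
    interpret ev: comm_ring_hom "\<lambda>p. poly p t" by unfold_locales auto
    obtain b' where b': "D (b (Some t)) = poly (F I) t * D b'"
      "\<And>m p. m < k \<Longrightarrow> p \<in> Q \<Longrightarrow> poly (R m p) t = poly (F I) t * b' m p"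
      using normal[OF nz] by blast
    have "poly (det PM) t = det (map_mat (\<lambda>p. poly p t) PM)" by simp
    also have "map_mat (\<lambda>p. poly p t) PM = poly (F I) t \<cdot>\<^sub>m mat k k (\<lambda>(m, c). \<phi> (?sJ c) (b' m))"
    proof (rule eq_matI)
      fix m c assume "m < dim_row (poly (F I) t \<cdot>\<^sub>m mat k k (\<lambda>(m, c). \<phi> (?sJ c) (b' m)))"
        "c < dim_col (poly (F I) t \<cdot>\<^sub>m mat k k (\<lambda>(m, c). \<phi> (?sJ c) (b' m)))"
      then have mc: "m < k" "c < k" by auto
      have "\<phi> (?sJ c) (\<lambda>q. poly (R m q) t) = poly (F I) t * \<phi> (?sJ c) (b' m)"
        unfolding \<phi>_scale[symmetric] using b'(2)[OF mc(1)] by (rule \<phi>_cong)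
      then show "map_mat (\<lambda>p. poly p t) PM $$ (m, c) =
          (poly (F I) t \<cdot>\<^sub>m mat k k (\<lambda>(m, c). \<phi> (?sJ c) (b' m))) $$ (m, c)"
        using PM mc PMt by simp
    qed (use PM in auto)
    also have "det \<dots> = poly (F I) t ^ k * D b'" by (simp add: D_def)
    finally show ?thesis using G[of "Some t"] b'(1) by (simp add: form_at_def)
  qed
  \<comment> \<open>The extra factor \<open>F I\<close> makes the identity hold at its zeros as
    well, so that it becomes an identity of polynomials.\<close>
  have "F I * (F I ^ k * G - F I * det PM) = 0"
  proof -
    have "poly (F I * (F I ^ k * G - F I * det PM)) t = 0" for t
      using ident[of t] by (cases "poly (F I) t = 0") auto
    then show ?thesis using poly_all_0_iff_0 by blast
  qed
  moreover have "F I \<noteq> 0" using FIz by auto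
  ultimately have eq: "F I ^ k * G = F I * det PM" by auto

  \<comment> \<open>Each column of \<open>PM\<close> that belongs to an element of
    \<open>J - I\<close> vanishes at \<open>z\<close> and contributes one linear factor.\<close>
  have "[:- z, 1:] ^ card (J - I) dvd det PM"
  proof -
    define u where "u c = (if ?sJ c \<in> I then 1 else [:- z, 1:])" for c
    have "J - I = ?sJ ` {..<k} - I" by (simp only: image_nth_sorted[OF J(3,2)])
    also have "\<dots> = ?sJ ` {c \<in> {0..<k}. ?sJ c \<notin> I}" by auto
    finally have "card (J - I) = card {c \<in> {0..<k}. ?sJ c \<notin> I}"
      using nth_sorted_eq_iff[OF J(3,2)] by (simp add: card_image inj_on_def)
    moreover have "(\<Prod>c\<in>{0..<k}. u c) = (\<Prod>c\<in>{c \<in> {0..<k}. ?sJ c \<notin> I}. [:- z, 1:])"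
      unfolding u_def by (rule prod.mono_neutral_cong_right) auto
    ultimately have "(\<Prod>c\<in>{0..<k}. u c) = [:- z, 1:] ^ card (J - I)" by simp
    moreover have dvd: "u c dvd PM $$ (m, c)" if mc: "m < k" "c < k" for m c
    proof (cases "?sJ c \<in> I")
      case False
      obtain b' where b': "\<And>m. m < k \<Longrightarrow> b' m \<in> f (Some z)"
        "\<And>m p. m < k \<Longrightarrow> p \<in> Q \<Longrightarrow> poly (R m p) z = poly (F I) z * b' m p"
        using normal[OF FIz] by blast
      let ?p = "?sJ c"
      have "b' m ?p = (\<Sum>q\<in>I. b' m q * r q ?p)"
        using expand_red[OF ID(1,2) b'(1)[OF mc(1)], THEN fun_cong, of ?p]
        by (simp add: sum_fun_apply cscale_def I_def r_def)
      then have "\<phi> ?p (b' m) = 0" using \<phi>[of ?p "b' m"] sJ[OF mc(2)] JQ False by (auto simp: mult.commute)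
      moreover have "\<phi> ?p (\<lambda>q. poly (R m q) z) = poly (F I) z * \<phi> ?p (b' m)"
        unfolding \<phi>_scale[symmetric] using b'(2)[OF mc(1)] by (rule \<phi>_cong)
      ultimately show ?thesis using PMt[OF mc] False by (simp add: u_def poly_eq_0_iff_dvd[symmetric])
    qed (simp add: u_def)
    moreover have "(\<Prod>c\<in>{0..<k}. u c) dvd det PM"
      unfolding det_col[OF PM] lessThan_atLeast0
    proof (rule dvd_sum)
      fix p assume "p \<in> {p. p permutes {0..<k}}"
      then have "u c dvd PM $$ (p c, c)" if "c \<in> {0..<k}" for c
        using permutes_in_image[of p "{0..<k}" c] that by (intro dvd) auto
      then show "(\<Prod>c\<in>{0..<k}. u c) dvd signof p * (\<Prod>c\<in>{0..<k}. PM $$ (p c, c))"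
        by (intro dvd_mult prod_dvd_prod)
    qed
    ultimately show ?thesis by simp
  qed
  then have "[:- z, 1:] ^ card (J - I) dvd F I ^ k * G" unfolding eq by (rule dvd_mult)
  moreover have "F I ^ k * G \<noteq> 0" using \<open>F I \<noteq> 0\<close> \<open>G \<noteq> 0\<close> by simp
  ultimately have "card (J - I) \<le> Polynomial.order z (F I ^ k * G)" unfolding order_divides by blast
  \<comment> \<open>Since \<open>F I\<close> does not vanish at \<open>z\<close>, the whole order of
    vanishing belongs to \<open>G\<close>.\<close>
  also have "\<dots> = Polynomial.order z G"
    using \<open>F I ^ k * G \<noteq> 0\<close> FIz by (subst order_mult) (auto intro: order_0I)
  also have "\<dots> \<le> d" using Polynomial.order_degree[OF \<open>G \<noteq> 0\<close>, of z] degG by simp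
  finally show ?thesis by (simp add: I_def J_def)
qed

section \<open>Overlap of jump sets along trees of rational curves\<close>

lemma card_Diff_eq_overlap:
  assumes "finite A" "card A = k"
  shows "card (A - B) + card (A \<inter> B) = k"
  using assms card_Diff_subset_Int[of A B] card_mono[of A "A \<inter> B"] by simp

text \<open>The overlap is symmetric in the two points, which reaches the point at infinity: unless
  both points are infinite, one of them can play the role of \<open>z\<close>.\<close>

lemma P1_map_jumps:
  assumes f: "f \<in> P1_maps n k d"
  shows "k \<le> card (jumps (f x) \<inter> jumps (f y)) + d"
proof -
  have IG: "f x \<in> IG n k" for x using f by (auto simp: P1_maps_def)
  have J: "finite (jumps (f x))" "card (jumps (f x)) = k" for x
    using isotropic_jumps[OF IG] isotropic_set_finite card_jumps_IG[OF IG] by blast+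
  have *: "k \<le> card (jumps (f (Some z)) \<inter> jumps (f y)) + d" for z y
    using P1_map_jumps_finite_point[OF f, of y z] card_Diff_eq_overlap[OF J, of y "jumps (f (Some z))"]
    by (simp add: Int_commute)
  show ?thesis
  proof (cases x)
    case None
    then show ?thesis using * J by (cases y) (auto simp: Int_commute)
  qed (use * in simp)
qed

text \<open>The marked points are joined by a path of components; neighbours agree at a node, and
  the defect of the overlap obeys a triangle inequality. The components of the path must be distinct
  for their degrees to sum to at most \<open>d\<close>.\<close>

lemma stable_map_jumps:
  assumes C: "C \<in> stable_maps n k d"
  shows "ev1 C \<in> IG n k" "ev2 C \<in> IG n k" "k \<le> card (jumps (ev1 C) \<inter> jumps (ev2 C)) + d"
proof -
  have C': "nodal_curve C" "connected_genus_0 C" "mark1 C \<in> points C" "mark2 C \<in> points C"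
    "\<forall>a<comps C. comp_map C a \<in> P1_maps n k (comp_deg C a)"
    "\<forall>N\<in>nodes C. \<forall>p\<in>N. \<forall>q\<in>N. map_at C p = map_at C q"
    and deg: "(\<Sum>a<comps C. comp_deg C a) = d"
    using C unfolding stable_maps_def by blast+
  have nodes: "\<And>N. N \<in> nodes C \<Longrightarrow> N \<subseteq> points C"
    and maps: "\<And>a. a < comps C \<Longrightarrow> comp_map C a \<in> P1_maps n k (comp_deg C a)"
    and glue: "\<And>N p q. N \<in> nodes C \<Longrightarrow> p \<in> N \<Longrightarrow> q \<in> N \<Longrightarrow> map_at C p = map_at C q"
    using C' unfolding nodal_curve_def by blast+
  have marks: "fst (mark1 C) < comps C" "fst (mark2 C) < comps C"
    using C'(3,4) by (auto simp: points_def)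
  define R where "R = {(i, j). \<exists>x y. {(i, x), (j, y)} \<in> nodes C}"
  have R: "i < comps C" "j < comps C" if "(i, j) \<in> R" for i j
    using that nodes by (fastforce simp: R_def points_def)+
  have IG: "map_at C (a, x) \<in> IG n k" if "a < comps C" for a x
    using maps[OF that] by (auto simp: map_at_def P1_maps_def)
  have J: "finite (jumps (map_at C (a, x)))" "card (jumps (map_at C (a, x))) = k" if "a < comps C" for a x
    using isotropic_jumps[OF IG[OF that]] isotropic_set_finite card_jumps_IG[OF IG[OF that]] by blast+
  show IG1: "ev1 C \<in> IG n k" and "ev2 C \<in> IG n k"
    using IG[of "fst (mark1 C)" "snd (mark1 C)"] IG[of "fst (mark2 C)" "snd (mark2 C)"] marks
    by (auto simp: ev1_def ev2_def)
  have "(fst (mark1 C), fst (mark2 C)) \<in> R\<^sup>*"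
    using C'(2) marks unfolding connected_genus_0_def R_def by blast
  then obtain l0 where "(fst (mark1 C), fst (mark2 C)) \<in> R ^^ l0" using rtrancl_imp_relpow by blast
  \<comment> \<open>A shortest path repeats no component, since a repetition could be cut
    out.\<close>
  define l where "l = (LEAST l. (fst (mark1 C), fst (mark2 C)) \<in> R ^^ l)"
  have l: "(fst (mark1 C), fst (mark2 C)) \<in> R ^^ l" and least: "\<And>l'. (fst (mark1 C), fst (mark2 C)) \<in> R ^^ l' \<Longrightarrow> l \<le> l'"
    unfolding l_def using \<open>(fst (mark1 C), fst (mark2 C)) \<in> R ^^ l0\<close> by (auto intro: LeastI Least_le)
  obtain g where g: "g 0 = fst (mark1 C)" "g l = fst (mark2 C)" "\<And>i. i < l \<Longrightarrow> (g i, g (Suc i)) \<in> R"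
    using l unfolding relpow_fun_conv by blast
  have sub: "(g i, g j) \<in> R ^^ (j - i)" if "i \<le> j" "j \<le> l" for i j
    unfolding relpow_fun_conv using that g(3) by (intro exI[of _ "\<lambda>m. g (i + m)"]) auto
  have inj: "inj_on g {..l}"
  proof (rule ccontr)
    assume "\<not> inj_on g {..l}"
    then obtain i j where ij: "i < j" "j \<le> l" "g i = g j"
      by (metis atMost_iff inj_onI linorder_neqE_nat)
    have "(g 0, g i) \<in> R ^^ i" "(g j, g l) \<in> R ^^ (l - j)"
      using sub[of 0 i] sub[of j l] ij by auto
    then have "(g 0, g l) \<in> R ^^ (i + (l - j))" using ij unfolding relpow_add by auto
    then show False using least[of "i + (l - j)"] ij g(1,2) by simp
  qed
  have gc: "g i < comps C" if "i \<le> l" for i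
    using that marks(1) g(1) R(2)[OF g(3), of "i - 1"] by (cases i) auto
  have step: "k \<le> card (jumps (map_at C (g i, x)) \<inter> jumps (map_at C (g i, y))) + comp_deg C (g i)"
    if "i \<le> l" for i x y
    using P1_map_jumps[OF maps[OF gc[OF that]]] by (simp add: map_at_def)
  have path: "\<forall>y. k \<le> card (jumps (ev1 C) \<inter> jumps (map_at C (g i, y))) + (\<Sum>j\<le>i. comp_deg C (g j))"
    if "i \<le> l" for i
    using that
  proof (induction i)
    case 0
    have "ev1 C = map_at C (g 0, snd (mark1 C))" using g(1) by (simp add: ev1_def)
    then show ?case using step[of 0] by simp
  next
    case (Suc i)
    then obtain x x' where "{(g i, x), (g (Suc i), x')} \<in> nodes C" using g(3)[of i] by (auto simp: R_def)
    then have eq: "map_at C (g i, x) = map_at C (g (Suc i), x')" by (rule glue) auto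
    show ?case
    proof
      fix y
      define A B B' where "A = jumps (ev1 C)" and "B = jumps (map_at C (g (Suc i), x'))"
        and "B' = jumps (map_at C (g (Suc i), y))"
      have B: "finite B" "card B = k" using J[OF gc[OF Suc.prems]] by (auto simp: B_def)
      have fB': "finite B'" using J[OF gc[OF Suc.prems]] by (auto simp: B'_def)
      have "k \<le> card (A \<inter> B) + (\<Sum>j\<le>i. comp_deg C (g j))"
        using Suc.IH[rule_format, of x] Suc.prems unfolding A_def B_def eq[symmetric] by simp
      moreover have "k \<le> card (B \<inter> B') + comp_deg C (g (Suc i))"
        using step[OF Suc.prems] by (simp add: B_def B'_def)
      \<comment> \<open>The triangle inequality: two subsets of the \<open>k\<close>-element set
        \<open>B\<close> meet in at least the excess of their sizes over \<open>k\<close>.\<close>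
      moreover have "card (A \<inter> B) + card (B \<inter> B') \<le> k + card (A \<inter> B')"
      proof -
        have "card (A \<inter> B) + card (B \<inter> B') = card ((A \<inter> B) \<union> (B \<inter> B')) + card ((A \<inter> B) \<inter> (B \<inter> B'))"
          using B by (intro card_Un_Int) auto
        moreover have "card ((A \<inter> B) \<union> (B \<inter> B')) \<le> card B" using B by (intro card_mono) auto
        moreover have "card ((A \<inter> B) \<inter> (B \<inter> B')) \<le> card (A \<inter> B')" using fB' by (intro card_mono) auto
        ultimately show ?thesis using B by simp
      qed
      ultimately show "k \<le> card (A \<inter> B') + (\<Sum>j\<le>Suc i. comp_deg C (g j))" by simp
    qed
  qed
  have "(\<Sum>j\<le>l. comp_deg C (g j)) = sum (comp_deg C) (g ` {..l})"
    using inj by (simp add: sum.reindex)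
  also have "\<dots> \<le> d" unfolding deg[symmetric] using gc by (intro sum_mono2) auto
  finally have "(\<Sum>j\<le>l. comp_deg C (g j)) \<le> d" .
  moreover have "ev2 C = map_at C (g l, snd (mark2 C))" using g(2) by (simp add: ev2_def)
  ultimately show "k \<le> card (jumps (ev1 C) \<inter> jumps (ev2 C)) + d"
    using path[of l] by (metis le_trans nat_add_left_cancel_le order_refl)
qed

section \<open>Comparison of the dimension bounds for the neighbourhood and the Schubert
  variety\<close>

theorem theorem6p6:
  fixes n k :: nat and w :: "nat \<Rightarrow> nat"
  assumes "1 \<le> n" and "1 \<le> k" and "k \<le> n + 1"
    and "w \<in> min_reps n k \<inter> W_odd n"
  shows "int (dim_IG n k (curve_nbhd n k 1 (schubert n k w))) - int (dim_IG n k (schubert n k w))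
           \<le> deg_q n k - 1 \<and>
         (\<forall>d\<ge>2. int (dim_IG n k (curve_nbhd n k d (schubert n k w))) - int (dim_IG n k (schubert n k w))
           < int d * deg_q n k - 1) \<and>
         (\<not> schubert n k w \<subseteq> closed_orbit n k \<longrightarrow>
           int (dim_IG n k (curve_nbhd n k 1 (schubert n k w))) - int (dim_IG n k (schubert n k w))
             < deg_q n k - 1)"
proof -
  have w: "w \<in> W_odd n" using assms(4) by simp
  define I X where "I = pivot_set k w" and "X = schubert n k w"
  have I: "isotropic_set n I" "card I = k" using pivot_set_isotropic[OF w assms(3)] by (auto simp: I_def)
  define c where "c = 2 * n + 1 - k"
  have c: "int c = 2 * int n + 1 - int k" using assms by (simp add: c_def)
  have lower: "cell_dim n I \<le> int (dim_IG n k X)"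
    using dim_schubert_ge[OF w assms(3)] card_cell_params[OF I(1)] by (simp add: I_def X_def)
  define D where "D = card (cell_params n I)"
  have D: "int D = cell_dim n I" by (simp add: D_def card_cell_params[OF I(1)])
  have witness: "\<exists>I'. isotropic_set n I' \<and> card I' = k \<and> bruhat_le I' I \<and> isotropic_set n (jumps V) \<and>
      card (jumps V) = k \<and> card (I' - jumps V) \<le> d"
    and nbhd_IG: "V \<in> IG n k"
    if VC: "V \<in> curve_nbhd n k d X" for V d
  proof -
    obtain C where C: "C \<in> stable_maps n k d" "ev1 C \<in> X" "V = ev2 C"
      using VC unfolding curve_nbhd_def by blast
    note S = stable_map_jumps[OF C(1)]
    show "V \<in> IG n k" using S(2) C(3) by simp
    have J: "isotropic_set n (jumps (ev1 C))" "card (jumps (ev1 C)) = k"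
      using isotropic_jumps[OF S(1)] card_jumps_IG[OF S(1)] by auto
    moreover have "bruhat_le (jumps (ev1 C)) I"
      using schubert_jumps[OF w assms(3)] C(2) by (simp add: I_def X_def)
    moreover have "card (jumps (ev1 C) - jumps V) \<le> d"
      using S(3) card_Diff_eq_overlap[OF isotropic_set_finite[OF J(1)] J(2), of "jumps V"] C(3) by simp
    ultimately show "\<exists>I'. isotropic_set n I' \<and> card I' = k \<and> bruhat_le I' I \<and> isotropic_set n (jumps V) \<and>
      card (jumps V) = k \<and> card (I' - jumps V) \<le> d"
      using isotropic_jumps[OF S(2)] card_jumps_IG[OF S(2)] C(3) by blast
  qed
  have upper: "dim_IG n k (curve_nbhd n k d X) \<le> D + d * c" for d
  proof (rule dim_IG_le)
    show "curve_nbhd n k d X \<subseteq> IG n k" using nbhd_IG by blast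
    fix V assume "V \<in> curve_nbhd n k d X"
    then obtain I' where I': "isotropic_set n I'" "card I' = k" "bruhat_le I' I" "isotropic_set n (jumps V)"
      "card (jumps V) = k" "card (I' - jumps V) \<le> d" using witness by blast
    have "cell_dim n (jumps V) \<le> cell_dim n I' + int d * (2 * int n + 1 - int k)"
      using I' assms by (intro cell_dim_exchange_iter) auto
    also have "cell_dim n I' \<le> cell_dim n I" using cell_dim_bruhat_mono[OF I(1) I'(1,3)] by simp
    finally have "int (card (cell_params n (jumps V))) \<le> int (D + d * c)"
      using card_cell_params[OF I'(4)] D c by simp
    then show "card (cell_params n (jumps V)) \<le> D + d * c" by (simp only: of_nat_le_iff)
  qed
  \<comment> \<open>The added constant is \<open>deg q - 2\<close>; the subtraction is not truncated
    because \<open>k \<le> n + 1 \<le> 2 * n\<close>.\<close>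
  have strict: "dim_IG n k (curve_nbhd n k 1 X) \<le> D + (2 * n - k)" if "\<not> X \<subseteq> closed_orbit n k"
  proof (rule dim_IG_le)
    have "1 \<notin> I" using that schubert_in_closed_orbit[OF w assms(3,2)] by (auto simp: I_def X_def)
    show "curve_nbhd n k 1 X \<subseteq> IG n k" using nbhd_IG by blast
    fix V assume "V \<in> curve_nbhd n k 1 X"
    then obtain I' where I': "isotropic_set n I'" "card I' = k" "bruhat_le I' I" "isotropic_set n (jumps V)"
      "card (jumps V) = k" "card (I' - jumps V) \<le> 1" using witness by blast
    have mono: "cell_dim n I' \<le> cell_dim n I" "I' \<noteq> I \<Longrightarrow> cell_dim n I' < cell_dim n I"
      using cell_dim_bruhat_mono[OF I(1) I'(1,3)] by auto
    have "cell_dim n (jumps V) \<le> cell_dim n I + 2 * int n - int k"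
    proof (cases "1 \<in> I'")
      case True
      then have "cell_dim n I' < cell_dim n I" using mono(2) \<open>1 \<notin> I\<close> by blast
      moreover have "cell_dim n (jumps V) \<le> cell_dim n I' + int 1 * (2 * int n + 1 - int k)"
        using I' assms by (intro cell_dim_exchange_iter) auto
      ultimately show ?thesis by simp
    next
      case False
      then have "cell_dim n (jumps V) \<le> cell_dim n I' + 2 * int n - int k"
        using I' assms by (intro cell_dim_exchange_strict) auto
      then show ?thesis using mono(1) by simp
    qed
    then have "int (card (cell_params n (jumps V))) \<le> int (D + (2 * n - k))"
      using card_cell_params[OF I'(4)] D assms by simp
    then show "card (cell_params n (jumps V)) \<le> D + (2 * n - k)" by (simp only: of_nat_le_iff)
  qed
  have "int (dim_IG n k (curve_nbhd n k d X)) - int (dim_IG n k X) \<le> int d * (deg_q n k - 1)" for d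
  proof -
    have "int (dim_IG n k (curve_nbhd n k d X)) \<le> int D + int d * int c" using upper[of d] by (metis of_nat_add of_nat_le_iff of_nat_mult)
    moreover have "deg_q n k - 1 = int c" using c by (simp add: deg_q_def)
    ultimately show ?thesis using lower D by simp
  qed
  note bound = this
  \<comment> \<open>The bound \<open>d * (deg q - 1)\<close> equals \<open>d * deg q - d\<close>,
    which lies below \<open>d * deg q - 1\<close> as soon as \<open>d\<close> is at least 2.\<close>
  have "int (dim_IG n k (curve_nbhd n k d X)) - int (dim_IG n k X) < int d * deg_q n k - 1" if "2 \<le> d" for d
    using bound[of d] that by (simp add: right_diff_distrib)
  moreover have "int (dim_IG n k (curve_nbhd n k 1 X)) - int (dim_IG n k X) < deg_q n k - 1"
    if "\<not> X \<subseteq> closed_orbit n k"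
    using strict[OF that] lower D assms by (simp add: deg_q_def)
  ultimately show ?thesis using bound[of 1] unfolding X_def by auto
qed

end
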